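(* Let $M$ be a toric Fano manifold with moment polytope $P$ and soliton vector field $X$, and let $$\mathcal L(u)=\int_{\partial P}u\,e^{\theta(x)}\,d\sigma-\int_P(n+\theta(x))\,e^{\theta(x)}\,u\,dx .$$ Then for the toric degeneration of $M$ induced by a positive rational piecewise linear convex function $u$ on $P$, the modified Futaki invariant is $$F_1=\frac1{2\,\mathrm{Vol}(P)}\,\mathcal L(u).$$
   Context: **Toric setting.** $M$ is a toric Fano manifold of complex dimension $n$, torus $T=(\mathbb C^* )^n$, open orbit coordinates $(w_1,\dots,w_n)$, and $P=\{x\in\mathbb R^n:\langle x,\ell_i\rangle\le1,\ i=1,\dots,d\}$ is the moment polytope of $-K_M$, $\ell_i\in\mathbb Z^n$ primitive outer normals to the facets. $dx$ is Lebesgue measure, $\mathrm{Vol}(P)$ the Lebesgue volume, $d\sigma=\langle\vec n,x\rangle d\sigma_0$ with $\vec n$ the unit outer normal and $d\sigma_0$ Lebesgue measure on $\partial P$. The soliton vector field is $X=\sum_i\theta_iw_i\frac{\partial}{\partial w_i}$, with $\theta_i\in\mathbb R$ determined by $\int_Px_ie^{\theta(x)}dx=0$ for all $i$, where $\theta(x)=\sum_i\theta_ix_i$ (this is the condition that the modified Futaki invariant $F_X(v)=\int_Mv(h_g-\theta_X)e^{\theta_X}\omega_g^n/n!$ vanishes for every $v$ in the reductive part of the Lie algebra of holomorphic vector fields). **Toric degenerations** (Donaldson). A rational piecewise linear (PL) convex function is $u=\max\{u^1,\dots,u^q\}$, $u^\lambda(x)=\sum_ia_i^\lambda x_i+c^\lambda$,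 with rational coefficients; after replacing $u$ by an integer multiple one assumes $a_i^\lambda\in\mathbb Z$. For $u>0$ on $P$ choose a positive integer $R>\max_Pu$, put $Q=\{(x,t):x\in P,\ 0<t<R-u(x)\}$, and choose an integer $l\ge1$ with $lQ$ an integral polytope. It defines an $(n+1)$-dimensional polarized toric variety $(M_Q,\mathfrak L)$; the face $t=0$ gives an embedding $i:M\to M_Q$ with $\mathfrak L|_M=K_M^{-l}$. The last factor of $(\mathbb C^* )^{n+1}$ gives a $\mathbb C^*$-action and there is an equivariant map $\pi:M_Q\to\mathbb{CP}^1$ with $\pi^{-1}(\infty)=i(M)$. $\mathcal W=M_Q\setminus i(M)\to\mathbb C$ is a test-configuration, the toric degeneration induced by $u$; $M_0=\pi^{-1}(0)$. The action of $X$ is the one induced from $T\times\{\mathrm{Id}\}\subset(\mathbb C^* )^{n+1}$. Sections of $\mathfrak L^{k/l}$ (for $k$ a multiple of $l$) over $M_Q$ have a basis $S_{I,i}$ indexed by lattice points $(I,i)\in k\overline Q$. Sign conventions: $\mathrm{Id}\times\mathbb C^*$ acts on $S_{I,k(R-u)(I/k)}|_{M_0}$ with weight $k(R-u)(I/k)$ and $X$ acts with weight $k\theta(I/k)$. **Modified Futaki invariant $F_1$.** Let $v$ be the vector field of the $\mathbb C^*$-action, and for $k$ a multiple of $l$ let $e^{X^k_\alpha},e^{v^k_\alpha}$ be the simultaneous eigenvalues of the time-one maps of $X$ and $v$ on $H^0(M_0,\mathfrak L^{k/l})$, $N_k=\dim H^0(M_0,\mathfrak L^{k/l})$, $$S_1=\sum_\alpha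 e^{X^k_\alpha/k}v^k_\alpha,\qquad S_2=\frac12\sum_\alpha e^{X^k_\alpha/k}\frac{X_\alpha^k}k\frac{v_\alpha^k}k .$$ $F_1$ is the coefficient of $k^{-1}$ in the expansion $-\frac{S_1-S_2}{kN_k}=F_0+F_1k^{-1}+\cdots$ as $k\to\infty$. *)

theory Defs
  imports
    "HOL-Analysis.Analysis"
    "HOL-Library.Function_Algebras"
    "HOL-Library.Landau_Symbols"
begin

section \<open>Toric Fano manifolds and their polytopes\<close>

definition rvec :: "int ^ 'n \<Rightarrow> real ^ 'n" where
  "rvec a = (\<chi> j. real_of_int (a $ j))"

definition moment_polytope :: "(int ^ 'n) set \<Rightarrow> (real ^ 'n) set" where
  "moment_polytope L = {x. \<forall>ell\<in>L. rvec ell \<bullet> x \<le> 1}"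

definition facet_at :: "(int ^ 'n) set \<Rightarrow> int ^ 'n \<Rightarrow> (real ^ 'n) set" where
  "facet_at L ell = {x \<in> moment_polytope L. rvec ell \<bullet> x = 1}"

definition primitive_vector :: "int ^ 'n \<Rightarrow> bool" where
  "primitive_vector ell \<longleftrightarrow> (GCD j\<in>UNIV. ell $ j) = 1"

definition lattice_basis :: "(int ^ 'n) set \<Rightarrow> bool" where
  "lattice_basis B \<longleftrightarrow> finite B \<and>
     (\<forall>I. \<exists>!c :: int ^ 'n \<Rightarrow> int. (\<forall>b. b \<notin> B \<longrightarrow> c b = 0) \<and> I = (\<Sum>b\<in>B. c b *s b))"

text \<open>
  A toric Fano manifold \<open>M\<close> of complex dimension \<open>n\<close> (the cardinality of the index type) is given
  by the set \<open>L\<close> of primitive outer normals of the moment polytope of \<open>-K\<^sub>M\<close>. The maximal cones of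
  the fan of \<open>M\<close> are spanned by the normals of the facets through a vertex, so that \<open>M\<close> is complete
  if and only if the polytope is bounded, and smooth if and only if these normals form a lattice
  basis at each vertex.
\<close>

definition toric_fano_manifold :: "(int ^ 'n) set \<Rightarrow> bool" where
  "toric_fano_manifold L \<longleftrightarrow>
     finite L \<and> bounded (moment_polytope L) \<and>
     (\<forall>ell\<in>L. primitive_vector ell \<and> facet_at L ell facet_of moment_polytope L) \<and>
     (\<forall>v. v extreme_point_of moment_polytope L \<longrightarrow> lattice_basis {ell\<in>L. rvec ell \<bullet> v = 1})"

text \<open>
  The coefficients \<open>\<theta>\<^sub>j\<close> of the soliton vector field \<open>X = \<Sum>\<^sub>j \<theta>\<^sub>j w\<^sub>j \<partial>/\<partial>w\<^sub>j\<close>; the function \<open>\<theta>(x)\<close> is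
  \<open>\<theta> \<bullet> x\<close>.
\<close>

definition soliton_vector_field :: "(int ^ 'n) set \<Rightarrow> real ^ 'n \<Rightarrow> bool" where
  "soliton_vector_field L \<theta> \<longleftrightarrow>
     (\<forall>j. (LINT x:moment_polytope L|lborel. x $ j * exp (\<theta> \<bullet> x)) = 0)"


section \<open>The functional \<open>\<L>\<close>\<close>

text \<open>
  Lebesgue measure on the hyperplane \<open>\<nu> \<bullet> x = c\<close>, where \<open>\<nu>\<close> is a unit vector: the image of Lebesgue
  measure on the slab \<open>c \<le> \<nu> \<bullet> x \<le> c + 1\<close> of thickness \<open>1\<close> under the orthogonal projection to the
  hyperplane. Thus the measure of a Borel subset of the hyperplane is the volume of the right prism
  of height \<open>1\<close> over it. In dimension \<open>1\<close> this is the unit point mass.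
\<close>

definition hyperplane_lebesgue :: "real ^ 'n \<Rightarrow> real \<Rightarrow> (real ^ 'n) measure" where
  "hyperplane_lebesgue \<nu> c =
     distr (restrict_space lborel {x. c \<le> \<nu> \<bullet> x \<and> \<nu> \<bullet> x \<le> c + 1}) borel
       (\<lambda>x. x - (\<nu> \<bullet> x - c) *\<^sub>R \<nu>)"

definition outer_unit_normal :: "int ^ 'n \<Rightarrow> real ^ 'n" where
  "outer_unit_normal ell = rvec ell /\<^sub>R norm (rvec ell)"

text \<open>
  Integration over \<open>\<partial>P\<close> against \<open>d\<sigma> = \<langle>n,x\<rangle> d\<sigma>\<^sub>0\<close>, facet by facet (facets overlap in null sets). The
  facet with normal \<open>ell\<close> lies in the hyperplane where \<open>\<langle>n,x\<rangle> = 1/|ell|\<close>.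
\<close>

definition boundary_integral :: "(int ^ 'n) set \<Rightarrow> (real ^ 'n \<Rightarrow> real) \<Rightarrow> real" where
  "boundary_integral L g =
     (\<Sum>ell\<in>L. LINT x:facet_at L ell|hyperplane_lebesgue (outer_unit_normal ell) (1 / norm (rvec ell)).
        g x * (outer_unit_normal ell \<bullet> x))"

definition L_functional ::
    "(int ^ 'n) set \<Rightarrow> real ^ 'n \<Rightarrow> (real ^ 'n \<Rightarrow> real) \<Rightarrow> real" where
  "L_functional L \<theta> u =
     boundary_integral L (\<lambda>x. u x * exp (\<theta> \<bullet> x)) -
     (LINT x:moment_polytope L|lborel. (real CARD('n) + \<theta> \<bullet> x) * exp (\<theta> \<bullet> x) * u x)"


section \<open>Rational piecewise linear convex functions\<close>

text \<open>
  The linear parts are already integral, i.e. the usual replacement of a rational piecewise linear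
  function by an integer multiple has been carried out.
\<close>

definition PL_convex :: "((int ^ 'n) \<times> rat) set \<Rightarrow> real ^ 'n \<Rightarrow> real" where
  "PL_convex \<Lambda> x = Max ((\<lambda>(a, c). rvec a \<bullet> x + real_of_rat c) ` \<Lambda>)"

definition degeneration_polytope ::
    "(real ^ 'n) set \<Rightarrow> (real ^ 'n \<Rightarrow> real) \<Rightarrow> nat \<Rightarrow> ((real ^ 'n) \<times> real) set" where
  "degeneration_polytope P u R = {(x, t). x \<in> P \<and> 0 < t \<and> t < real R - u x}"

definition scaled_closure :: "nat \<Rightarrow> ((real ^ 'n) \<times> real) set \<Rightarrow> ((real ^ 'n) \<times> real) set" where
  "scaled_closure l Q = (\<lambda>p. real l *\<^sub>R p) ` closure Q"

definition integral_polytope :: "((real ^ 'n) \<times> real) set \<Rightarrow> bool" where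
  "integral_polytope K \<longleftrightarrow>
     (\<exists>V :: ((int ^ 'n) \<times> int) set. finite V \<and>
        K = convex hull ((\<lambda>(I, i). (rvec I, real_of_int i)) ` V))"


section \<open>The polarized toric variety of an integral polytope\<close>

text \<open>
  An integral polytope \<open>K \<subseteq> \<real>\<^sup>n \<times> \<real>\<close> defines the graded semigroup of all \<open>(m, I, i)\<close> with
  \<open>(I, i)\<close> a lattice point of \<open>m K\<close>, and the polarized toric variety is \<open>Proj\<close> of its semigroup
  algebra, polarized by \<open>\<O>(1)\<close>. The closed points of the affine cone, i.e. of \<open>Spec\<close> of the semigroup
  algebra, are the monoid homomorphisms from the semigroup to \<open>(\<complex>, \<cdot>)\<close>; we extend them by \<open>0\<close>
  outside the semigroup. The vertex of the cone is removed, so the variety is the quotient of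
  \<^term>\<open>toric_cone\<close> by the \<open>\<complex>\<^sup>*\<close>-action coming from the grading. We work on the cone throughout,
  with conical subsets standing for subvarieties.
\<close>

type_synonym 'n lattice_point = "nat \<times> (int ^ 'n) \<times> int"

type_synonym 'n cone_point = "'n lattice_point \<Rightarrow> complex"

definition semigroup_of :: "((real ^ 'n) \<times> real) set \<Rightarrow> 'n lattice_point set" where
  "semigroup_of K = {(m, I, i). (rvec I, real_of_int i) \<in> (\<lambda>p. real m *\<^sub>R p) ` K}"

definition toric_cone :: "((real ^ 'n) \<times> real) set \<Rightarrow> 'n cone_point set" where
  "toric_cone K =
     {\<phi>. (\<forall>s. s \<notin> semigroup_of K \<longrightarrow> \<phi> s = 0) \<and> \<phi> 0 = 1 \<and>
         (\<forall>s\<in>semigroup_of K. \<forall>s'\<in>semigroup_of K. \<phi> (s + s') = \<phi> s * \<phi> s') \<and>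
         (\<exists>s\<in>semigroup_of K. fst s > 0 \<and> \<phi> s \<noteq> 0)}"

text \<open>The section \<open>S\<^sub>I\<^sub>,\<^sub>i\<close> of \<open>\<O>(m)\<close>, as a function on the cone.\<close>

definition basic_section :: "'n lattice_point \<Rightarrow> 'n cone_point \<Rightarrow> complex" where
  "basic_section s \<phi> = \<phi> s"

text \<open>
  The torus \<open>(\<complex>\<^sup>*)\<^sup>n \<times> \<complex>\<^sup>*\<close> acts on the cone so that the pullback action on functions multiplies
  \<open>S\<^sub>I\<^sub>,\<^sub>i\<close> by \<open>w\<^sup>I z\<^sup>i\<close>.
\<close>

definition torus_action :: "complex ^ 'n \<Rightarrow> complex \<Rightarrow> 'n cone_point \<Rightarrow> 'n cone_point" where
  "torus_action w z \<phi> = (\<lambda>(m, I, i). (\<Prod>j\<in>UNIV. (w $ j) powi (I $ j)) * z powi i * \<phi> (m, I, i))"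

text \<open>
  The equivariant map \<open>\<pi>\<close> to \<open>P\<^sup>1\<close> is \<open>[S\<^sub>I\<^sub>,\<^sub>i : S\<^sub>I\<^sub>,\<^sub>i\<^sub>+\<^sub>1]\<close> for all pairs of such sections of the same
  degree, the point \<open>[z\<^sub>0 : z\<^sub>1]\<close> being the number \<open>z\<^sub>0/z\<^sub>1\<close>. The face \<open>t = 0\<close> of the polytope is the
  fibre over \<open>\<infinity> = [1 : 0]\<close>, because \<open>S\<^sub>I\<^sub>,\<^sub>i\<close> vanishes there for \<open>i > 0\<close>.
\<close>

definition fibre :: "((real ^ 'n) \<times> real) set \<Rightarrow> complex \<Rightarrow> complex \<Rightarrow> 'n cone_point set" where
  "fibre K z\<^sub>0 z\<^sub>1 =
     {\<phi> \<in> toric_cone K. \<forall>m I i.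
        (m, I, i) \<in> semigroup_of K \<and> (m, I, i + 1) \<in> semigroup_of K \<longrightarrow>
        z\<^sub>0 * basic_section (m, I, i + 1) \<phi> = z\<^sub>1 * basic_section (m, I, i) \<phi>}"

text \<open>
  As a divisor, the fibre over \<open>0\<close> is the sum of the toric divisors of the facets
  \<open>t = l (R - u\<^sup>\<lambda>)\<close> with multiplicity one, since the linear part of \<open>u\<^sup>\<lambda>\<close> is integral. So the
  scheme-theoretic fibre is reduced and may be treated as a set of closed points.
\<close>

definition central_fibre :: "((real ^ 'n) \<times> real) set \<Rightarrow> 'n cone_point set" where
  "central_fibre K = fibre K 0 1"


section \<open>Global sections\<close>

interpretation fun_space: vector_space "\<lambda>(c :: complex) (f :: 'a \<Rightarrow> complex) x. c * f x"
  by unfold_locales (auto simp: fun_eq_iff algebra_simps)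

text \<open>
  \<open>H\<^sup>0(Y, \<O>(m))\<close> for a closed subvariety \<open>Y\<close>, given by its cone. The sets where a basic section
  \<open>\<chi>\<close> of positive degree \<open>e\<close> does not vanish form an affine open cover, and on such a set the
  sections of \<open>\<O>(m)\<close> are the degree \<open>m\<close> elements \<open>p/\<chi>\<^sup>j\<close> of the localization at \<open>\<chi>\<close> of the
  homogeneous coordinate ring of \<open>Y\<close>. A section is a function on the cone of \<open>Y\<close>, extended by
  \<open>0\<close>, that is of this form on each set of the cover. It need not be the restriction of an
  element of the coordinate ring.
\<close>

definition homogeneous_functions ::
    "((real ^ 'n) \<times> real) set \<Rightarrow> nat \<Rightarrow> ('n cone_point \<Rightarrow> complex) set" where
  "homogeneous_functions K d =
     fun_space.span {basic_section s |s. s \<in> semigroup_of K \<and> fst s = d}"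

definition global_sections ::
    "((real ^ 'n) \<times> real) set \<Rightarrow> 'n cone_point set \<Rightarrow> nat \<Rightarrow> ('n cone_point \<Rightarrow> complex) set" where
  "global_sections K Y m =
     {f. (\<forall>\<phi>. \<phi> \<notin> Y \<longrightarrow> f \<phi> = 0) \<and>
         (\<forall>s\<in>semigroup_of K. fst s > 0 \<longrightarrow>
            (\<exists>j. \<exists>p\<in>homogeneous_functions K (m + j * fst s).
               \<forall>\<phi>\<in>Y. basic_section s \<phi> \<noteq> 0 \<longrightarrow> f \<phi> = p \<phi> / basic_section s \<phi> ^ j))}"


section \<open>The modified Futaki invariant\<close>

text \<open>
  \<open>e\<^sup>X\<^sup>\<alpha>\<close>, \<open>e\<^sup>v\<^sup>\<alpha>\<close> for \<open>\<alpha> < N\<close> are the simultaneous eigenvalues, with multiplicities, of the operators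
  \<open>A\<close> and \<open>B\<close> on the \<open>N\<close>-dimensional space \<open>H\<close>. The logarithms are real.
\<close>

definition simultaneous_eigenvalues ::
    "('a \<Rightarrow> complex) set \<Rightarrow> (('a \<Rightarrow> complex) \<Rightarrow> ('a \<Rightarrow> complex)) \<Rightarrow>
     (('a \<Rightarrow> complex) \<Rightarrow> ('a \<Rightarrow> complex)) \<Rightarrow> nat \<Rightarrow> (nat \<Rightarrow> real) \<Rightarrow> (nat \<Rightarrow> real) \<Rightarrow> bool" where
  "simultaneous_eigenvalues H A B N X v \<longleftrightarrow>
     (\<exists>e. inj_on e {..<N} \<and> fun_space.independent (e ` {..<N}) \<and> fun_space.span (e ` {..<N}) = H \<and>
        (\<forall>\<alpha><N. A (e \<alpha>) = (\<lambda>\<phi>. complex_of_real (exp (X \<alpha>)) * e \<alpha> \<phi>) \<and>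
               B (e \<alpha>) = (\<lambda>\<phi>. complex_of_real (exp (v \<alpha>)) * e \<alpha> \<phi>)))"

text \<open>
  The time-one maps of the vector field \<open>X\<close> on \<open>T \<times> {Id}\<close> and of the generator \<open>v\<close> of the last
  \<open>\<complex>\<^sup>*\<close>, acting on functions by pullback.
\<close>

definition X_time_one ::
    "real ^ 'n \<Rightarrow> ('n cone_point \<Rightarrow> complex) \<Rightarrow> ('n cone_point \<Rightarrow> complex)" where
  "X_time_one \<theta> f = (\<lambda>\<phi>. f (torus_action (\<chi> j. complex_of_real (exp (\<theta> $ j))) 1 \<phi>))"

definition v_time_one :: "('n::finite cone_point \<Rightarrow> complex) \<Rightarrow> ('n cone_point \<Rightarrow> complex)" where
  "v_time_one f = (\<lambda>\<phi>. f (torus_action (\<chi> j. 1) (complex_of_real (exp 1)) \<phi>))"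

definition S1 :: "nat \<Rightarrow> nat \<Rightarrow> (nat \<Rightarrow> real) \<Rightarrow> (nat \<Rightarrow> real) \<Rightarrow> real" where
  "S1 k N X v = (\<Sum>\<alpha><N. exp (X \<alpha> / real k) * v \<alpha>)"

definition S2 :: "nat \<Rightarrow> nat \<Rightarrow> (nat \<Rightarrow> real) \<Rightarrow> (nat \<Rightarrow> real) \<Rightarrow> real" where
  "S2 k N X v = 1 / 2 * (\<Sum>\<alpha><N. exp (X \<alpha> / real k) * (X \<alpha> / real k) * (v \<alpha> / real k))"

text \<open>
  \<open>F\<^sub>1\<close> is the modified Futaki invariant of the toric degeneration with polytope \<open>K\<close>, the \<open>l\<close>-fold
  multiple of the closed degeneration polytope. Here \<open>k = l m\<close> runs through the multiples of \<open>l\<close>, and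
  the \<open>k/l\<close>-th power of the polarization is \<open>\<O>(m)\<close>. The coefficient of \<open>1/k\<close> is meant in the sense
  of asymptotic expansions.
\<close>

definition has_modified_Futaki_invariant ::
    "nat \<Rightarrow> ((real ^ 'n) \<times> real) set \<Rightarrow> real ^ 'n \<Rightarrow> real \<Rightarrow> bool" where
  "has_modified_Futaki_invariant l K \<theta> F\<^sub>1 \<longleftrightarrow>
     (\<exists>(N :: nat \<Rightarrow> nat) (X :: nat \<Rightarrow> nat \<Rightarrow> real) (v :: nat \<Rightarrow> nat \<Rightarrow> real) (F\<^sub>0 :: real).
        (\<forall>m>0. N m = fun_space.dim (global_sections K (central_fibre K) m) \<and>
           simultaneous_eigenvalues (global_sections K (central_fibre K) m)
             (X_time_one \<theta>) v_time_one (N m) (X m) (v m)) \<and>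
        (\<lambda>m. - (S1 (l * m) (N m) (X m) (v m) - S2 (l * m) (N m) (X m) (v m)) /
                 (real (l * m) * real (N m))
             - (F\<^sub>0 + F\<^sub>1 / real (l * m)))
          \<in> o(\<lambda>m. 1 / real (l * m)))"

end

theory Submission
  imports Defs
begin

text \<open>
  The modified Futaki invariant is a quotient of weighted counts of lattice points, and the formula is
  its two-term expansion. There are two independent parts.

  \<^emph>\<open>Algebra.\<close> Let \<open>k = l m\<close>. The cone over the degeneration polytope is cut out by the facets of \<open>P\<close>,
  by \<open>t \<ge> 0\<close> and by one top form for each \<open>u\<^sup>\<lambda>\<close>; the central fibre is the union of the strata of the top
  forms. A section over it is, on each stratum, a Laurent polynomial. Comparing the local expressions
  at the vertices of a face shows that its exponents lie in the cone over the face, and comparing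
  them at a lattice point common to two faces shows that the coefficients agree there. So the sections
  of \<open>\<O>(m)\<close> have a basis indexed by the lattice points of the top boundary (\<open>global_sections_strata\<close>).
  Since the degeneration polytope is a lattice polytope, the top boundary contains exactly one lattice
  point over each lattice point \<open>I\<close> of \<open>k P\<close>, at height \<open>k (R - u)(I/k)\<close>, and the basis consists of
  simultaneous eigenvectors (\<open>eigenvalues_on_central_fibre\<close>). With \<open>A\<^sub>k(f) = \<Sum> f(I/k)\<close>, summed over
  the lattice points of \<open>k P\<close>, and \<open>g = e\<^sup>\<theta> (R - u)\<close>, this gives \<open>S\<^sub>1 = k A\<^sub>k(g)\<close>, \<open>2 S\<^sub>2 = A\<^sub>k(\<theta> g)\<close>
  and \<open>N\<^sub>k = A\<^sub>k(1)\<close>.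

  \<^emph>\<open>Asymptotics.\<close> The expansion needed is \<open>A\<^sub>k(f) = k\<^sup>n \<integral>\<^sub>P f dx + k\<^sup>n\<^sup>-\<^sup>1 \<integral>\<^sub>\<partial>\<^sub>P f d\<sigma> / 2 + o(k\<^sup>n\<^sup>-\<^sup>1)\<close> for
  functions with kinks (\<open>euler_maclaurin\<close>). Moving one facet of \<open>k P\<close> by one lattice step adds a layer
  of lattice points, whose contribution is a Riemann sum for the integral over the facet against
  \<open>d\<sigma>\<close> (\<open>layer_sum_limit\<close>). On the other hand \<open>k\<^sup>n \<integral>\<^sub>P f dx\<close> is the average over a unit cube of
  translations \<open>y\<close> of the sum of \<open>f((I + y)/k)\<close> over those \<open>I\<close> with \<open>I + y\<close> in \<open>k P\<close>, that is, over the
  lattice points of \<open>k P\<close> with the facet of normal \<open>ell\<close> moved by \<open>\<lfloor>- ell(y)\<rfloor>\<close> steps. Averaging \<open>y\<close>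
  with \<open>-y\<close> moves every facet by \<open>-1/2\<close> and cancels the derivative of \<open>f\<close>.

  \<^emph>\<open>Conclusion.\<close> All facets of \<open>P\<close> have lattice distance one from the origin, so moving every facet of
  \<open>k P\<close> inwards by one step gives \<open>(k - 1) P\<close>. Comparing the asymptotics of both lattice sums yields
  \<open>\<integral>\<^sub>\<partial>\<^sub>P e\<^sup>\<theta> d\<sigma> = \<integral>\<^sub>P (n + \<theta>) e\<^sup>\<theta> dx\<close> (\<open>divergence_identity\<close>), that is \<open>\<L>(1) = 0\<close>, and for \<open>\<theta> = 0\<close> that the
  boundary has total mass \<open>n Vol(P)\<close>. Expanding the quotient gives
  \<open>F\<^sub>1 = (\<L>(u) - R \<L>(1)) / (2 Vol(P)) = \<L>(u) / (2 Vol(P))\<close>.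
\<close>


(* Lattice points are triples; quantified ones are to stay single variables. *)
declare split_paired_All [simp del] split_paired_Ex [simp del]

section \<open>Characters of the torus\<close>

definition lp_vec :: "'n::finite lattice_point \<Rightarrow> real \<times> (real ^ 'n) \<times> real" where
  "lp_vec = (\<lambda>(m, I, i). (real m, rvec I, real_of_int i))"

definition character :: "complex ^ 'n \<Rightarrow> complex \<Rightarrow> 'n lattice_point \<Rightarrow> complex" where
  "character w z = (\<lambda>(m, I, i). (\<Prod>j\<in>UNIV. (w $ j) powi (I $ j)) * z powi i)"

text \<open>
  The multiple \<open>j s\<close>. Degrees are natural numbers, so lattice points form a monoid only.
\<close>

definition copies :: "nat \<Rightarrow> 'a::comm_monoid_add \<Rightarrow> 'a" where
  "copies j s = (\<Sum>_<j. s)"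

lemma copies_simps [simp]: "copies 0 s = 0" "copies (Suc j) s = copies j s + s"
  by (simp_all add: copies_def)

lemma rvec_add: "rvec (a + b) = rvec a + rvec b"
  by (simp add: rvec_def vec_eq_iff)

lemma rvec_0 [simp]: "rvec 0 = 0"
  by (simp add: rvec_def vec_eq_iff)

lemma lp_vec_add: "lp_vec (s + t) = lp_vec s + lp_vec t"
  by (cases s, cases t) (simp add: lp_vec_def rvec_add)

lemma lp_vec_0 [simp]: "lp_vec 0 = 0"
  by (simp add: lp_vec_def zero_prod_def)

lemma lp_vec_copies: "lp_vec (copies j s) = real j *\<^sub>R lp_vec s"
  by (induction j) (simp_all add: lp_vec_add algebra_simps)

lemma fst_lp_vec: "fst (lp_vec s) = real (fst s)"
  by (cases s) (simp add: lp_vec_def)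

lemma fst_copies: "fst (copies j (s :: nat \<times> 'b::comm_monoid_add)) = j * fst s"
  by (induction j) simp_all

lemma character_add:
  assumes "\<And>j. w $ j \<noteq> 0" "z \<noteq> 0"
  shows "character w z (s + t) = character w z s * character w z t"
  using assms by (cases s, cases t) (simp add: character_def power_int_add prod.distrib)

lemma character_0 [simp]: "character w z 0 = 1"
  by (simp add: character_def zero_prod_def)

lemma character_copies:
  assumes "\<And>j. w $ j \<noteq> 0" "z \<noteq> 0"
  shows "character w z (copies j s) = character w z s ^ j"
  by (induction j) (simp_all add: character_add[OF assms])

lemma character_nonzero:
  assumes "\<And>j. w $ j \<noteq> 0" "z \<noteq> 0"
  shows "character w z s \<noteq> 0"
  using assms by (cases s) (simp add: character_def)

lemma two_powi_inj: "(2::complex) powi a = 2 powi b \<longleftrightarrow> a = b"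
proof
  assume "(2::complex) powi a = 2 powi b"
  then have "norm ((2::complex) powi a) = norm ((2::complex) powi b)" by simp
  then have "(2::real) powi a = 2 powi b" by (simp add: norm_power_int)
  then show "a = b"
    by (metis linorder_neq_iff one_less_numeral_iff power_int_strict_increasing semiring_norm(76))
qed simp

lemma characters_separate:
  assumes "fst s = fst t" "s \<noteq> (t :: 'n::finite lattice_point)"
  obtains w z where "\<And>j. w $ j \<noteq> 0" "z \<noteq> 0" "character w z s \<noteq> character w z t"
proof -
  obtain m I i m' J j where st: "s = (m, I, i)" "t = (m', J, j)"
    by (metis prod_cases3)
  show thesis
  proof (cases "i = j")
    case False
    with st two_powi_inj[of i j] that[of "\<chi> j. 1" 2] show ?thesis
      by (simp add: character_def)
  next
    case True
    with assms st have "I \<noteq> J" by auto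
    then obtain j0 where j0: "I $ j0 \<noteq> J $ j0" by (auto simp: vec_eq_iff)
    let ?w = "(\<chi> j. if j = j0 then 2 else 1) :: complex ^ 'n"
    have *: "(\<Prod>k\<in>UNIV. (?w $ k) powi (H $ k)) = 2 powi (H $ j0)" for H :: "int ^ 'n"
    proof -
      have "(\<Prod>k\<in>UNIV. (?w $ k) powi (H $ k)) = (\<Prod>k\<in>UNIV. if k = j0 then 2 powi (H $ j0) else 1)"
        by (intro prod.cong) auto
      then show ?thesis by simp
    qed
    have "character ?w 1 s \<noteq> character ?w 1 t"
      using j0 unfolding st character_def prod.case * by (simp add: two_powi_inj)
    then show ?thesis using that[of ?w 1] by simp
  qed
qed

text \<open>
  Dedekind's argument: multiplying a relation by the value of one character at a point and
  comparing with its translate by this point gives a shorter relation.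
\<close>

lemma characters_independent:
  fixes A :: "'n::finite lattice_point set"
  assumes "finite A" "\<And>s. s \<in> A \<Longrightarrow> fst s = d"
    and "\<And>w z. (\<And>j. w $ j \<noteq> 0) \<Longrightarrow> z \<noteq> 0 \<Longrightarrow> (\<Sum>s\<in>A. a s * character w z s) = 0"
  shows "\<forall>s\<in>A. a s = 0"
  using assms
proof (induction A arbitrary: a rule: finite_induct)
  case (insert t A)
  have "a s = 0" if s: "s \<in> A" for s
  proof -
    have "fst s = fst t" "s \<noteq> t" using insert s by auto
    then obtain w z where wz: "\<And>j. w $ j \<noteq> 0" "z \<noteq> 0" "character w z s \<noteq> character w z t"
      by (rule characters_separate) blast
    have "\<forall>s\<in>A. a s * (character w z s - character w z t) = 0"
    proof (rule insert.IH)
      fix w' :: "complex ^ 'n" and z' :: complex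
      assume w': "\<And>j. w' $ j \<noteq> 0" "z' \<noteq> 0"
      have mult: "character (\<chi> j. w $ j * w' $ j) (z * z') s = character w z s * character w' z' s" for s
        by (cases s) (simp add: character_def power_int_mult_distrib prod.distrib)
      have "(\<Sum>s\<in>insert t A. a s * character (\<chi> j. w $ j * w' $ j) (z * z') s) = 0"
        using wz w' by (intro insert.prems) auto
      then have 1: "(\<Sum>s\<in>insert t A. a s * character w z s * character w' z' s) = 0"
        by (simp add: mult mult.assoc)
      have "(\<Sum>s\<in>insert t A. a s * character w' z' s) = 0"
        using w' by (intro insert.prems) auto
      then have "(\<Sum>s\<in>insert t A. a s * character w z s * character w' z' s)
          - character w z t * (\<Sum>s\<in>insert t A. a s * character w' z' s) = 0"
        using 1 by simp
      then have "a t * character w z t * character w' z' t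
            + (\<Sum>s\<in>A. a s * character w z s * character w' z' s)
          - character w z t * (a t * character w' z' t + (\<Sum>s\<in>A. a s * character w' z' s)) = 0"
        using insert.hyps by simp
      then show "(\<Sum>s\<in>A. a s * (character w z s - character w z t) * character w' z' s) = 0"
        by (simp add: algebra_simps sum_subtractf sum_distrib_left)
    qed (use insert in auto)
    with s wz show ?thesis by auto
  qed
  moreover have "a t = 0"
  proof -
    have "(\<Sum>s\<in>insert t A. a s * character (\<chi> j. 1) 1 s) = 0"
      by (rule insert.prems) auto
    then have "a t * character (\<chi> j. 1) 1 t = 0"
      using calculation insert.hyps by (simp add: sum.neutral)
    then show ?thesis
      using character_nonzero[of "\<chi> j. 1" 1 t] by simp
  qed
  ultimately show ?case by simp
qed simp

text \<open>
  A sum of shifted characters stands for a Laurent polynomial, whose exponents \<open>s - r\<close> cannot be formed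
  in the monoid of lattice points.
\<close>

lemma character_sums_match:
  fixes A B :: "'n::finite lattice_point set"
  assumes fin: "finite A" "finite B"
    and deg: "\<And>s. s \<in> A \<Longrightarrow> fst s + fst p = d" "\<And>s. s \<in> B \<Longrightarrow> fst s + fst r = d"
    and eq: "\<And>w z. (\<And>j. w $ j \<noteq> 0) \<Longrightarrow> z \<noteq> 0 \<Longrightarrow>
      (\<Sum>s\<in>A. a s * character w z (s + p)) = (\<Sum>s\<in>B. b s * character w z (s + r))"
    and s: "s \<in> A" "a s \<noteq> 0"
  obtains t where "t \<in> B" "t + r = s + p" "b t = a s"
proof -
  let ?C = "(\<lambda>s. s + p) ` A \<union> (\<lambda>s. s + r) ` B"
  let ?a = "\<lambda>x. (\<Sum>s\<in>{s\<in>A. s + p = x}. a s) - (\<Sum>s\<in>{s\<in>B. s + r = x}. b s)"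
  have "\<forall>x\<in>?C. ?a x = 0"
  proof (rule characters_independent)
    fix w :: "complex ^ 'n" and z :: complex
    assume wz: "\<And>j. w $ j \<noteq> 0" "z \<noteq> 0"
    have 1: "(\<Sum>x\<in>?C. (\<Sum>s\<in>{s\<in>A. s + p = x}. a s * character w z (s + p)))
        = (\<Sum>s\<in>A. a s * character w z (s + p))"
      by (rule sum.group) (use fin in auto)
    have 2: "(\<Sum>x\<in>?C. (\<Sum>s\<in>{s\<in>B. s + r = x}. b s * character w z (s + r)))
        = (\<Sum>s\<in>B. b s * character w z (s + r))"
      by (rule sum.group) (use fin in auto)
    have "(\<Sum>x\<in>?C. ?a x * character w z x) =
      (\<Sum>x\<in>?C. (\<Sum>s\<in>{s\<in>A. s + p = x}. a s * character w z (s + p)))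
      - (\<Sum>x\<in>?C. (\<Sum>s\<in>{s\<in>B. s + r = x}. b s * character w z (s + r)))"
      unfolding sum_subtractf[symmetric]
      by (intro sum.cong refl) (simp add: left_diff_distrib sum_distrib_right)
    also have "\<dots> = 0" using 1 2 eq[OF wz] by simp
    finally show "(\<Sum>x\<in>?C. ?a x * character w z x) = 0" .
  qed (use fin deg in auto)
  then have 0: "?a (s + p) = 0" using s by blast
  have "{s'\<in>A. s' + p = s + p} = {s}" using s by auto
  with 0 have as: "a s = (\<Sum>t\<in>{t\<in>B. t + r = s + p}. b t)" by simp
  then have "{t\<in>B. t + r = s + p} \<noteq> {}" using s sum.empty by metis
  then obtain t where t: "t \<in> B" "t + r = s + p" by blast
  have "t' = t" if "t' + r = s + p" for t'
    using that t(2) by (metis add_right_imp_eq)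
  with t have "{t'\<in>B. t' + r = s + p} = {t}" by blast
  with as t show thesis using that by simp
qed


section \<open>Sections on a union of strata of a toric variety\<close>

lemma sum_fun_apply: "(sum g A) x = (\<Sum>a\<in>A. g a x)"
  by (induction A rule: infinite_finite_induct) (auto simp: zero_fun_def)

lemma span_image_finite:
  assumes "finite A" "p \<in> fun_space.span (g ` A)"
  obtains d where "p = (\<lambda>x. \<Sum>a\<in>A. d a * g a x)"
proof -
  have "\<exists>d. p = (\<lambda>x. \<Sum>a\<in>A. d a * g a x)"
    using assms(2)
  proof (induction rule: fun_space.span_induct_alt)
    case base
    show ?case by (rule exI[of _ "\<lambda>_. 0"]) (simp add: zero_fun_def)
  next
    case (step c x y)
    then obtain a d where a: "a \<in> A" "x = g a" and d: "y = (\<lambda>x. \<Sum>a\<in>A. d a * g a x)"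
      by auto
    have "(\<lambda>xa. c * x xa) + y = (\<lambda>x. \<Sum>b\<in>A. (d b + (if b = a then c else 0)) * g b x)"
      using a assms(1) unfolding d
      by (auto simp: fun_eq_iff distrib_right sum.distrib if_distrib[of "\<lambda>u. u * _"] cong: if_cong)
    then show ?case by (intro exI[of _ "\<lambda>b. d b + (if b = a then c else 0)"])
  qed
  then show thesis using that by blast
qed

lemma sum_in_span:
  assumes "\<And>a. a \<in> A \<Longrightarrow> g a \<in> B"
  shows "(\<lambda>x. \<Sum>a\<in>A. d a * g a x) \<in> fun_space.span B"
proof -
  have "(\<lambda>x. \<Sum>a\<in>A. d a * g a x) = (\<Sum>a\<in>A. (\<lambda>x. d a * g a x))"
    by (auto simp: sum_fun_apply fun_eq_iff)
  also have "\<dots> \<in> fun_space.span B"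
    by (intro fun_space.span_sum fun_space.span_scale fun_space.span_base assms)
  finally show ?thesis .
qed

lemma independent_imageI:
  assumes "finite A"
    and "\<And>c. (\<And>x. (\<Sum>a\<in>A. c a * g a x) = 0) \<Longrightarrow> \<forall>a\<in>A. c a = 0"
  shows "inj_on g A" "fun_space.independent (g ` A)"
proof -
  show inj: "inj_on g A"
  proof (rule inj_onI, rule ccontr)
    fix a b assume ab: "a \<in> A" "b \<in> A" "g a = g b" "a \<noteq> b"
    define c where "c = (\<lambda>x. (if x = a then 1 else 0) - (if x = b then 1 else 0 :: complex))"
    have "\<forall>a\<in>A. c a = 0"
    proof (rule assms(2))
      fix x
      have "(\<Sum>k\<in>A. c k * g k x) = (\<Sum>k\<in>A. (if k = a then g k x else 0) - (if k = b then g k x else 0))"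
        by (intro sum.cong) (auto simp: c_def)
      then show "(\<Sum>k\<in>A. c k * g k x) = 0"
        using ab assms(1) by (simp add: sum_subtractf)
    qed
    with ab show False by (auto simp: c_def)
  qed
  show "fun_space.independent (g ` A)"
  proof
    assume "fun_space.dependent (g ` A)"
    then obtain u where u: "\<exists>v\<in>g ` A. u v \<noteq> 0" "(\<Sum>v\<in>g ` A. (\<lambda>x. u v * v x)) = 0"
      using assms(1) by (auto simp: fun_space.dependent_finite)
    have "\<forall>a\<in>A. u (g a) = 0"
    proof (rule assms(2))
      fix x
      have "0 = (\<Sum>v\<in>g ` A. (\<lambda>x. u v * v x)) x" using u by simp
      also have "\<dots> = (\<Sum>a\<in>A. u (g a) * g a x)"
        by (simp add: sum_fun_apply sum.reindex[OF inj])
      finally show "(\<Sum>a\<in>A. u (g a) * g a x) = 0" by simp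
    qed
    with u show False by auto
  qed
qed

lemma toric_cone_copies:
  assumes "\<phi> \<in> toric_cone K" "s \<in> semigroup_of K" "\<And>s t. s \<in> semigroup_of K \<Longrightarrow> t \<in> semigroup_of K \<Longrightarrow> s + t \<in> semigroup_of K"
    "0 \<in> semigroup_of K"
  shows "copies j s \<in> semigroup_of K \<and> \<phi> (copies j s) = \<phi> s ^ j"
  using assms by (induction j) (auto simp: toric_cone_def)

text \<open>
  The forms in \<open>Q\<close> cut out the cone over the lattice polytope \<open>K\<close>, and \<open>V\<close> contains the vertices of \<open>K\<close>. The
  forms in \<open>G\<close> select some faces of \<open>K\<close>. The functions below live on the union of the corresponding
  invariant subvarieties, which consists of the points that vanish on all lattice points off these faces.
\<close>

locale toric_strata =
  fixes K :: "((real ^ 'n) \<times> real) set"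
    and Q G :: "(real \<times> (real ^ 'n) \<times> real) set"
    and V :: "'n lattice_point set"
  assumes finQ: "finite Q" and GQ: "G \<subseteq> Q"
    and semigroup_iff: "s \<in> semigroup_of K \<longleftrightarrow> (\<forall>q\<in>Q. 0 \<le> q \<bullet> lp_vec s)"
    and V_sub: "V \<subseteq> semigroup_of K"
    and hull: "\<And>x. fst x = 1 \<Longrightarrow> (\<And>q. q \<in> Q \<Longrightarrow> 0 \<le> q \<bullet> x) \<Longrightarrow> x \<in> convex hull (lp_vec ` V)"
    and degV: "\<And>v. v \<in> V \<Longrightarrow> fst v = 1"
    and fin_degree: "\<And>d. finite {s \<in> semigroup_of K. fst s = d}"
begin

definition strata :: "'n cone_point set" where
  "strata = {\<phi> \<in> toric_cone K. \<forall>s\<in>semigroup_of K. (\<forall>q\<in>G. 0 < q \<bullet> lp_vec s) \<longrightarrow> \<phi> s = 0}"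

definition face :: "(real \<times> (real ^ 'n) \<times> real) \<Rightarrow> 'n lattice_point set" where
  "face q = {s \<in> semigroup_of K. q \<bullet> lp_vec s = 0}"

text \<open>
  The point of the open torus orbit of the stratum \<open>q\<close> with torus coordinates \<open>w\<close> and \<open>z\<close>.
\<close>

definition stratum_point :: "(real \<times> (real ^ 'n) \<times> real) \<Rightarrow> complex ^ 'n \<Rightarrow> complex \<Rightarrow> 'n cone_point" where
  "stratum_point q w z = (\<lambda>s. if s \<in> face q then character w z s else 0)"

lemma zero_semigroup: "0 \<in> semigroup_of K"
  by (simp add: semigroup_iff)

lemma add_semigroup: "s \<in> semigroup_of K \<Longrightarrow> t \<in> semigroup_of K \<Longrightarrow> s + t \<in> semigroup_of K"
  by (simp add: semigroup_iff lp_vec_add inner_add_right)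

lemma add_face_iff:
  assumes "q \<in> Q" "s \<in> semigroup_of K" "t \<in> semigroup_of K"
  shows "s + t \<in> face q \<longleftrightarrow> s \<in> face q \<and> t \<in> face q"
proof -
  have "0 \<le> q \<bullet> lp_vec s" "0 \<le> q \<bullet> lp_vec t" using assms semigroup_iff by auto
  then show ?thesis using assms
    by (auto simp: face_def add_semigroup lp_vec_add inner_add_right)
qed

lemma copies_face: "s \<in> face q \<Longrightarrow> copies j s \<in> face q"
  by (auto simp: face_def semigroup_iff lp_vec_copies)

lemma stratum_point_in_strata:
  assumes "q \<in> G" "s \<in> face q" "0 < fst s" "\<And>j. w $ j \<noteq> 0" "z \<noteq> 0"
  shows "stratum_point q w z \<in> strata"
proof -
  have q: "q \<in> Q" using assms GQ by auto
  have "0 \<in> face q" by (simp add: face_def zero_semigroup)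
  then have "stratum_point q w z 0 = 1" by (simp add: stratum_point_def)
  moreover have "stratum_point q w z (s' + t') = stratum_point q w z s' * stratum_point q w z t'"
    if "s' \<in> semigroup_of K" "t' \<in> semigroup_of K" for s' t'
    by (simp add: stratum_point_def character_add[OF assms(4,5)] add_face_iff[OF q that])
  moreover have "stratum_point q w z s \<noteq> 0" "s \<in> semigroup_of K"
    using assms(2) character_nonzero[OF assms(4,5), of s] by (auto simp: stratum_point_def face_def)
  moreover have "stratum_point q w z s' = 0" if "s' \<notin> semigroup_of K" for s'
    using that by (simp add: stratum_point_def face_def)
  ultimately have "stratum_point q w z \<in> toric_cone K"
    using assms(3) unfolding toric_cone_def by blast
  then show ?thesis
    using assms(1) by (fastforce simp: strata_def stratum_point_def face_def)
qed

text \<open>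
  On a segment inside the hyperplane \<open>q = 0\<close> that leaves the cone, the last point in the cone lies
  on a facet \<open>q'\<close> that separates it from the end point. As the slice of the cone at height \<open>1\<close> is
  a lattice polytope, the face \<open>q = q' = 0\<close> contains a vertex \<open>v\<close>, and no translate of the end
  point by a multiple of \<open>v\<close> lies in the cone.
\<close>

lemma in_face_if_translates_in_face:
  assumes q: "q \<in> G" and s: "s \<in> face q" "0 < fst s"
    and t: "q \<bullet> lp_vec t = 0" "0 < fst t"
    and vert: "\<And>v. v \<in> V \<Longrightarrow> v \<in> face q \<Longrightarrow> \<exists>j. t + copies j v \<in> semigroup_of K"
  shows "t \<in> face q"
proof -
  have qQ: "q \<in> Q" using q GQ by auto
  define z0 where "z0 = lp_vec s /\<^sub>R real (fst s)"
  define z1 where "z1 = lp_vec t /\<^sub>R real (fst t)"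
  have z0: "0 \<le> q' \<bullet> z0" if "q' \<in> Q" for q'
    using that s by (auto simp: z0_def face_def semigroup_iff)
  have deg: "fst z0 = 1" "fst z1 = 1"
    using s t by (simp_all add: z0_def z1_def fst_lp_vec)
  have q0: "q \<bullet> z0 = 0" "q \<bullet> z1 = 0" using s t by (simp_all add: z0_def z1_def face_def)
  define N where "N = {q' \<in> Q. q' \<bullet> z1 < 0}"
  have "N = {}"
  proof (rule ccontr)
    assume ne: "N \<noteq> {}"
    have fin: "finite N" using finQ by (simp add: N_def)
    define g where "g = (\<lambda>q'. q' \<bullet> z0 / (q' \<bullet> z0 - q' \<bullet> z1))"
    define \<alpha> where "\<alpha> = Min (g ` N)"
    have "\<alpha> \<in> g ` N" unfolding \<alpha>_def using fin ne by (intro Min_in) simp_all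
    then obtain q' where q': "q' \<in> N" "g q' = \<alpha>" by blast
    have neg: "q'' \<bullet> z0 \<ge> 0" "q'' \<bullet> z1 < 0" if "q'' \<in> N" for q''
      using that z0 by (auto simp: N_def)
    have \<alpha>: "0 \<le> \<alpha>" "\<alpha> \<le> 1"
      using neg[OF q'(1)] unfolding q'(2)[symmetric] g_def by (auto simp: divide_simps)
    define z where "z = z0 + \<alpha> *\<^sub>R (z1 - z0)"
    have zin: "x \<bullet> z = (1 - \<alpha>) * (x \<bullet> z0) + \<alpha> * (x \<bullet> z1)" for x
      by (simp add: z_def inner_add_right inner_diff_right algebra_simps)
    have "0 \<le> q'' \<bullet> z" if "q'' \<in> Q" for q''
    proof (cases "q'' \<in> N")
      case True
      then have "\<alpha> \<le> g q''" using fin by (simp add: \<alpha>_def)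
      then show ?thesis using neg[OF True] unfolding zin g_def by (simp add: divide_simps algebra_simps)
    next
      case False
      then show ?thesis using that z0 \<alpha> unfolding zin by (auto simp: N_def)
    qed
    moreover have "fst z = 1" using deg by (simp add: z_def)
    ultimately have "z \<in> convex hull (lp_vec ` V)" by (intro hull)
    moreover have "(q + q') \<bullet> z = 0"
      using neg[OF q'(1)] q0 q'(2) unfolding inner_add_left zin g_def by (auto simp: field_simps)
    ultimately have "\<not> convex hull (lp_vec ` V) \<subseteq> {x. (q + q') \<bullet> x > 0}" by auto
    then have "\<not> lp_vec ` V \<subseteq> {x. (q + q') \<bullet> x > 0}"
      by (metis hull_minimal convex_halfspace_gt)
    then obtain v where v: "v \<in> V" "(q + q') \<bullet> lp_vec v \<le> 0" by force
    then have "v \<in> semigroup_of K" using V_sub by auto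
    then have "0 \<le> q \<bullet> lp_vec v" "0 \<le> q' \<bullet> lp_vec v" "v \<in> semigroup_of K"
      using q' qQ by (auto simp: semigroup_iff N_def)
    then have v0: "q' \<bullet> lp_vec v = 0" "v \<in> face q"
      using v(2) by (auto simp: inner_add_left face_def)
    obtain j where "t + copies j v \<in> semigroup_of K" using vert[OF v(1) v0(2)] by auto
    then have "0 \<le> q' \<bullet> lp_vec t"
      using q'(1) v0 by (force simp: semigroup_iff lp_vec_add lp_vec_copies inner_add_right N_def)
    moreover have "q' \<bullet> lp_vec t < 0"
      using neg(2)[OF q'(1)] t by (simp add: z1_def mult_less_0_iff zero_less_mult_iff)
    ultimately show False by simp
  qed
  have "0 \<le> q' \<bullet> lp_vec t" if "q' \<in> Q" for q'
  proof -
    have "0 \<le> q' \<bullet> z1" using \<open>N = {}\<close> that by (force simp: N_def)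
    then show ?thesis using t by (simp add: z1_def zero_le_mult_iff)
  qed
  then show ?thesis using t by (simp add: face_def semigroup_iff)
qed

definition boundary_points :: "nat \<Rightarrow> 'n lattice_point set" where
  "boundary_points m = {t \<in> semigroup_of K. fst t = m \<and> (\<exists>q\<in>G. q \<bullet> lp_vec t = 0)}"

definition restricted_section :: "'n lattice_point \<Rightarrow> 'n cone_point \<Rightarrow> complex" where
  "restricted_section t \<phi> = (if \<phi> \<in> strata then basic_section t \<phi> else 0)"

lemma finite_boundary_points: "finite (boundary_points m)"
  using fin_degree[of m] by (rule rev_finite_subset) (auto simp: boundary_points_def)

lemma boundary_points_iff: "t \<in> boundary_points m \<longleftrightarrow> fst t = m \<and> (\<exists>q\<in>G. t \<in> face q)"
  by (auto simp: boundary_points_def face_def)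

text \<open>
  A point of the union that does not vanish at \<open>s\<close> and \<open>t\<close> does not vanish at \<open>s + t\<close>, so \<open>s + t\<close> lies on a
  selected face. Faces of a cone contain the summands of their elements.
\<close>

lemma common_face:
  assumes "\<phi> \<in> strata" "s \<in> semigroup_of K" "t \<in> semigroup_of K" "\<phi> s \<noteq> 0" "\<phi> t \<noteq> 0"
  obtains q where "q \<in> G" "s \<in> face q" "t \<in> face q"
proof -
  have "\<phi> (s + t) \<noteq> 0" using assms by (auto simp: strata_def toric_cone_def)
  then obtain q where q: "q \<in> G" "\<not> 0 < q \<bullet> lp_vec (s + t)"
    using assms add_semigroup unfolding strata_def by blast
  then have "s + t \<in> face q"
    using GQ add_semigroup[OF assms(2,3)] by (force simp: face_def semigroup_iff)
  then show thesis using that[of q] add_face_iff[of q s t] q GQ assms by blast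
qed

lemma strata_copies:
  assumes "\<phi> \<in> strata" "s \<in> semigroup_of K"
  shows "\<phi> (copies j s) = \<phi> s ^ j" "copies j s \<in> semigroup_of K"
  using toric_cone_copies[of \<phi> K s j] assms add_semigroup zero_semigroup
  by (auto simp: strata_def)

lemma restricted_sections_independent:
  assumes "0 < m"
  shows "inj_on restricted_section (boundary_points m)"
    and "fun_space.independent (restricted_section ` boundary_points m)"
proof -
  have *: "\<forall>t\<in>boundary_points m. c t = 0"
    if c: "\<And>\<phi>. (\<Sum>t\<in>boundary_points m. c t * restricted_section t \<phi>) = 0" for c
  proof
    fix t assume t: "t \<in> boundary_points m"
    then obtain q where q: "q \<in> G" "t \<in> face q" "fst t = m" by (auto simp: boundary_points_iff)
    have "\<forall>s\<in>{s\<in>boundary_points m. s \<in> face q}. c s = 0"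
    proof (rule characters_independent)
      fix w :: "complex ^ 'n" and z :: complex
      assume wz: "\<And>j. w $ j \<noteq> 0" "z \<noteq> 0"
      then have Y: "stratum_point q w z \<in> strata"
        using q assms by (intro stratum_point_in_strata) auto
      have "0 = (\<Sum>t\<in>boundary_points m. c t * stratum_point q w z t)"
        using c[of "stratum_point q w z"] Y by (simp add: restricted_section_def basic_section_def)
      also have "\<dots> = (\<Sum>s\<in>{s\<in>boundary_points m. s \<in> face q}. c s * character w z s)"
        unfolding sum.inter_filter[OF finite_boundary_points]
        by (intro sum.cong) (auto simp: stratum_point_def)
      finally show "(\<Sum>s\<in>{s\<in>boundary_points m. s \<in> face q}. c s * character w z s) = 0" by simp
    next
      show "finite {s \<in> boundary_points m. s \<in> face q}"
        by (rule finite_subset[OF _ finite_boundary_points[of m]]) blast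
    qed (simp add: boundary_points_def)
    then show "c t = 0" using t q by blast
  qed
  show "inj_on restricted_section (boundary_points m)"
    by (rule independent_imageI[OF finite_boundary_points *])
  show "fun_space.independent (restricted_section ` boundary_points m)"
    by (rule independent_imageI[OF finite_boundary_points *])
qed

text \<open>
  The expression \<open>\<Sum> d\<^sub>s\<^sub>' S\<^sub>s\<^sub>' / S\<^sub>s\<^sup>j\<close> of a section of \<open>\<O>(m)\<close> on the affine open set where \<open>S\<^sub>s\<close> does not
  vanish.
\<close>

definition local_form ::
  "('n cone_point \<Rightarrow> complex) \<Rightarrow> nat \<Rightarrow> 'n lattice_point \<Rightarrow> nat \<Rightarrow> ('n lattice_point \<Rightarrow> complex) \<Rightarrow> bool" where
  "local_form f m s j d \<longleftrightarrow> (\<forall>\<phi>\<in>strata. \<phi> s \<noteq> 0 \<longrightarrow>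
     f \<phi> = (\<Sum>s' | s' \<in> semigroup_of K \<and> fst s' = m + j * fst s. d s' * \<phi> s') / \<phi> s ^ j)"

lemma global_section_local_form:
  assumes "f \<in> global_sections K strata m" "s \<in> semigroup_of K" "0 < fst s"
  obtains j d where "local_form f m s j d"
proof -
  obtain j p where p: "p \<in> homogeneous_functions K (m + j * fst s)"
    and f: "\<forall>\<phi>\<in>strata. basic_section s \<phi> \<noteq> 0 \<longrightarrow> f \<phi> = p \<phi> / basic_section s \<phi> ^ j"
    using assms unfolding global_sections_def by blast
  have "{basic_section s' |s'. s' \<in> semigroup_of K \<and> fst s' = m + j * fst s}
      = (basic_section :: 'n lattice_point \<Rightarrow> _) ` {s' \<in> semigroup_of K. fst s' = m + j * fst s}" by blast
  with p have "p \<in> fun_space.span (basic_section ` {s' \<in> semigroup_of K. fst s' = m + j * fst s})"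
    by (simp add: homogeneous_functions_def)
  then obtain d where
    "p = (\<lambda>x. \<Sum>a\<in>{s' \<in> semigroup_of K. fst s' = m + j * fst s}. d a * basic_section a x)"
    by (rule span_image_finite[OF fin_degree])
  then have "local_form f m s j d"
    using f by (simp add: local_form_def basic_section_def)
  then show thesis by (rule that)
qed

text \<open>
  Both expressions give the same function on the torus orbit of a common face, and on this orbit
  the coefficients of a Laurent polynomial are determined by its values.
\<close>

lemma local_forms_match:
  assumes q: "q \<in> G" and s: "s \<in> face q" "0 < fst s" and t: "t \<in> face q" "0 < fst t"
    and forms: "local_form f m s i d" "local_form f m t j e"
    and x: "x \<in> face q" "fst x = m + i * fst s" "d x \<noteq> 0"
  obtains y where "y \<in> face q" "fst y = m + j * fst t" "y + copies i s = x + copies j t" "e y = d x"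
proof -
  let ?A = "{x \<in> face q. fst x = m + i * fst s}" and ?B = "{x \<in> face q. fst x = m + j * fst t}"
  have fin: "finite {x \<in> face q. fst x = n}" for n
    using fin_degree[of n] by (rule rev_finite_subset) (auto simp: face_def)
  obtain y where "y \<in> ?B" "y + copies i s = x + copies j t" "e y = d x"
  proof (rule character_sums_match[where A = ?A and B = ?B and a = d and b = e and s = x
        and p = "copies j t" and r = "copies i s" and d = "m + i * fst s + j * fst t"])
    show "finite ?A" "finite ?B" by (rule fin)+
    show "fst x + fst (copies j t) = m + i * fst s + j * fst t" if "x \<in> ?A" for x
      using that by (simp add: fst_copies)
    show "fst x + fst (copies i s) = m + i * fst s + j * fst t" if "x \<in> ?B" for x
      using that by (simp add: fst_copies)
    show "x \<in> ?A" "d x \<noteq> 0" using x by auto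
    fix w :: "complex ^ 'n" and z :: complex
    assume wz: "\<And>j. w $ j \<noteq> 0" "z \<noteq> 0"
    note ch = character_add[OF wz] character_copies[OF wz]
    let ?p = "stratum_point q w z"
    have Y: "?p \<in> strata" using stratum_point_in_strata[OF q s wz] .
    have val: "?p s = character w z s" "?p t = character w z t"
      using s t by (simp_all add: stratum_point_def)
    have nz: "character w z s \<noteq> 0" "character w z t \<noteq> 0"
      using character_nonzero[OF wz] by auto
    have sub: "(\<Sum>s' | s' \<in> semigroup_of K \<and> fst s' = n. g s' * ?p s')
        = (\<Sum>s'\<in>{x \<in> face q. fst x = n}. g s' * character w z s')" for n g
      by (rule sum.mono_neutral_cong_right[OF fin_degree]) (auto simp: face_def stratum_point_def)
    have "f ?p = (\<Sum>x\<in>?A. d x * character w z x) / character w z s ^ i"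
      using forms(1) Y val nz sub unfolding local_form_def by auto
    moreover have "f ?p = (\<Sum>x\<in>?B. e x * character w z x) / character w z t ^ j"
      using forms(2) Y val nz sub unfolding local_form_def by auto
    ultimately have "(\<Sum>x\<in>?A. d x * character w z x) * character w z t ^ j
        = (\<Sum>x\<in>?B. e x * character w z x) * character w z s ^ i"
      using nz by (simp add: divide_simps)
    then show "(\<Sum>x\<in>?A. d x * character w z (x + copies j t))
        = (\<Sum>x\<in>?B. e x * character w z (x + copies i s))"
      by (simp add: ch sum_distrib_right mult.assoc)
  qed (rule that)
  then show thesis using that[of y] by simp
qed

lemma lattice_point_diff:
  fixes x :: "'n lattice_point"
  assumes "fst x = m + fst y"
  obtains t where "x = t + y" "fst t = m"
proof (rule that)
  show "x = (m, fst (snd x) - fst (snd y), snd (snd x) - snd (snd y)) + y"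
    by (cases x; cases y) (use assms in simp)
qed simp

text \<open>
  A priori the exponents of the Laurent polynomial only lie in the face minus multiples of \<open>s\<close>. The local
  forms at the vertices of the face confine them further, to the face itself.
\<close>

lemma local_form_support:
  assumes f: "f \<in> global_sections K strata m" and m: "0 < m"
    and q: "q \<in> G" and s: "s \<in> face q" "0 < fst s"
    and d: "local_form f m s i d" and x: "x \<in> face q" "fst x = m + i * fst s" "d x \<noteq> 0"
  obtains t where "t \<in> face q" "fst t = m" "x = t + copies i s"
proof -
  have "fst x = m + fst (copies i s)" using x by (simp add: fst_copies)
  then obtain t where t: "x = t + copies i s" "fst t = m"
    by (rule lattice_point_diff)
  have "t \<in> face q"
  proof (rule in_face_if_translates_in_face[OF q s])
    have "copies i s \<in> face q" using s by (simp add: copies_face)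
    then show "q \<bullet> lp_vec t = 0" "0 < fst t"
      using x t m by (simp_all add: face_def lp_vec_add inner_add_right)
    fix v assume v: "v \<in> V" "v \<in> face q"
    then obtain j e where e: "local_form f m v j e"
      using global_section_local_form[OF f, of v] degV[of v] by (auto simp: face_def)
    have "0 < fst v" using degV[OF v(1)] by simp
    then obtain y where y: "y \<in> face q" "y + copies i s = x + copies j v"
      by (rule local_forms_match[OF q s v(2) _ d e x])
    then have "y + copies i s = (t + copies j v) + copies i s" by (simp add: t algebra_simps)
    then have "y = t + copies j v" by (rule add_right_imp_eq)
    then show "\<exists>j. t + copies j v \<in> semigroup_of K" using y by (auto simp: face_def)
  qed
  then show thesis using that t by blast
qed

text \<open>
  The coefficient of \<open>S\<^sub>t\<close> in a section is read off from a local form at \<open>t\<close> itself. It is the same on all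
  faces through \<open>t\<close>, because the open set where \<open>S\<^sub>t\<close> does not vanish meets all their strata. This is why
  the Laurent polynomials on the strata glue to one linear combination.
\<close>

theorem global_sections_strata:
  assumes m: "0 < m"
  shows "global_sections K strata m = fun_space.span (restricted_section ` boundary_points m)"
proof
  show "fun_space.span (restricted_section ` boundary_points m) \<subseteq> global_sections K strata m"
  proof
    fix f assume "f \<in> fun_space.span (restricted_section ` boundary_points m)"
    then obtain c where c: "f = (\<lambda>\<phi>. \<Sum>t\<in>boundary_points m. c t * restricted_section t \<phi>)"
      by (rule span_image_finite[OF finite_boundary_points])
    define p where "p = (\<lambda>\<phi>. \<Sum>t\<in>boundary_points m. c t * basic_section t \<phi>)"
    have p: "p \<in> homogeneous_functions K (m + 0 * n)" for n
      unfolding homogeneous_functions_def p_def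
      by (rule sum_in_span) (unfold boundary_points_def mem_Collect_eq, simp, blast)
    show "f \<in> global_sections K strata m"
      unfolding global_sections_def
    proof (intro CollectI conjI ballI allI impI)
      fix s :: "'n lattice_point"
      show "\<exists>j. \<exists>p\<in>homogeneous_functions K (m + j * fst s).
          \<forall>\<phi>\<in>strata. basic_section s \<phi> \<noteq> 0 \<longrightarrow> f \<phi> = p \<phi> / basic_section s \<phi> ^ j"
        by (rule exI[of _ 0], rule bexI[OF _ p]) (simp add: c p_def restricted_section_def)
    qed (simp add: c restricted_section_def)
  qed
next
  show "global_sections K strata m \<subseteq> fun_space.span (restricted_section ` boundary_points m)"
  proof
    fix f assume f: "f \<in> global_sections K strata m"
    have "\<exists>j d. local_form f m t j d" if "t \<in> boundary_points m" for t
    proof -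
      have "t \<in> semigroup_of K" "0 < fst t" using that m by (simp_all add: boundary_points_def)
      then obtain j d where "local_form f m t j d" by (rule global_section_local_form[OF f])
      then show ?thesis by blast
    qed
    then obtain J D where JD: "\<And>t. t \<in> boundary_points m \<Longrightarrow> local_form f m t (J t) (D t)"
      by metis
    \<comment> \<open>the exponent \<open>t\<close> is the quotient of \<open>(J t + 1) t\<close> by \<open>(J t) t\<close>\<close>
    define c where "c t = D t (t + copies (J t) t)" for t
    \<comment> \<open>the coefficient does not depend on the local form\<close>
    have c_eq: "d (t + copies i s) = c t"
      if q: "q \<in> G" "s \<in> face q" "0 < fst s" "t \<in> face q" "fst t = m" and d: "local_form f m s i d"
      for q s t i d
    proof -
      have tb: "t \<in> boundary_points m" using q unfolding boundary_points_iff by blast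
      note e = JD[OF tb]
      have qQ: "q \<in> Q" using q GQ by auto
      have sem: "s \<in> semigroup_of K" "t \<in> semigroup_of K" "copies i s \<in> semigroup_of K"
         "copies (J t) t \<in> semigroup_of K"
        using q copies_face[OF q(2)] copies_face[OF q(4)] by (simp_all add: face_def)
      let ?x = "t + copies i s" and ?y = "t + copies (J t) t"
      have x: "?x \<in> face q" "fst ?x = m + i * fst s"
        using q sem by (simp_all add: add_face_iff[OF qQ] copies_face fst_copies)
      have y: "?y \<in> face q" "fst ?y = m + J t * fst t"
        using q sem by (simp_all add: add_face_iff[OF qQ] copies_face fst_copies)
      have xy: "?y + copies i s = ?x + copies (J t) t" by (simp add: algebra_simps)
      show ?thesis
      proof (cases "d ?x = 0 \<and> D t ?y = 0")
        case False
        then consider "d ?x \<noteq> 0" | "D t ?y \<noteq> 0" by auto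
        then show ?thesis
        proof cases
          case 1
          have "0 < fst t" using q m by simp
          then obtain y' where "y' + copies i s = ?x + copies (J t) t" "D t y' = d ?x"
            by (rule local_forms_match[OF q(1,2,3) q(4) _ d e x 1])
          moreover from this(1) xy have "y' = ?y" by (intro add_right_imp_eq[of y' "copies i s"]) simp
          ultimately show ?thesis by (simp add: c_def)
        next
          case 2
          have "0 < fst t" using q m by simp
          then obtain x' where "x' + copies (J t) t = ?y + copies i s" "d x' = D t ?y"
            by (rule local_forms_match[OF q(1,4) _ q(2,3) e d y 2])
          moreover from this(1) xy have "x' = ?x" by (intro add_right_imp_eq[of x' "copies (J t) t"]) simp
          ultimately show ?thesis by (simp add: c_def)
        qed
      qed (simp add: c_def)
    qed
    have "f = (\<lambda>\<phi>. \<Sum>t\<in>boundary_points m. c t * restricted_section t \<phi>)"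
    proof
      fix \<phi>
      show "f \<phi> = (\<Sum>t\<in>boundary_points m. c t * restricted_section t \<phi>)"
      proof (cases "\<phi> \<in> strata")
        case False
        then show ?thesis using f by (simp add: global_sections_def restricted_section_def)
      next
        case Y: True
        then obtain s where s: "s \<in> semigroup_of K" "0 < fst s" "\<phi> s \<noteq> 0"
          by (auto simp: strata_def toric_cone_def)
        obtain i d where d: "local_form f m s i d" using global_section_local_form[OF f s(1,2)] .
        have mult: "\<phi> (t + copies i s) = \<phi> t * \<phi> s ^ i" if "t \<in> semigroup_of K" for t
          using Y that strata_copies[OF Y s(1), of i] by (simp add: strata_def toric_cone_def)
        let ?S = "{x. x \<in> semigroup_of K \<and> fst x = m + i * fst s}"
        let ?T = "{t \<in> boundary_points m. \<phi> t \<noteq> 0}"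
        \<comment> \<open>only the multiples \<open>t + i s\<close> of boundary points \<open>t\<close> contribute at \<open>\<phi>\<close>\<close>
        have "(\<Sum>x\<in>?S. d x * \<phi> x) = (\<Sum>x\<in>(\<lambda>t. t + copies i s) ` ?T. d x * \<phi> x)"
        proof (rule sum.mono_neutral_right[OF fin_degree])
          show "(\<lambda>t. t + copies i s) ` ?T \<subseteq> ?S"
          proof
            fix x assume "x \<in> (\<lambda>t. t + copies i s) ` ?T"
            then obtain t where "x = t + copies i s" "t \<in> boundary_points m" by blast
            then show "x \<in> ?S"
              using strata_copies(2)[OF Y s(1), of i]
              by (simp add: boundary_points_def fst_copies add_semigroup)
          qed
          show "\<forall>x\<in>?S - (\<lambda>t. t + copies i s) ` ?T. d x * \<phi> x = 0"
          proof
            fix x assume x: "x \<in> ?S - (\<lambda>t. t + copies i s) ` ?T"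
            show "d x * \<phi> x = 0"
            proof (rule ccontr)
              assume nz: "d x * \<phi> x \<noteq> 0"
              then have xS: "x \<in> semigroup_of K" "fst x = m + i * fst s" "\<phi> x \<noteq> 0" "d x \<noteq> 0"
                using x by simp_all
              obtain q where q: "q \<in> G" "s \<in> face q" "x \<in> face q"
                by (rule common_face[OF Y s(1) xS(1) s(3) xS(3)])
              obtain t where t: "t \<in> face q" "fst t = m" "x = t + copies i s"
                by (rule local_form_support[OF f m q(1,2) s(2) d q(3) xS(2,4)])
              have "\<phi> t \<noteq> 0" using mult[of t] t nz by (auto simp: face_def)
              moreover have "t \<in> boundary_points m" using t q unfolding boundary_points_iff by blast
              ultimately have "t \<in> ?T" by simp
              then show False using x t by blast
            qed
          qed
        qed
        also have "\<dots> = (\<Sum>t\<in>?T. d (t + copies i s) * \<phi> (t + copies i s))"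
          by (subst sum.reindex) (auto simp: inj_on_def)
        also have "\<dots> = (\<Sum>t\<in>?T. c t * \<phi> t * \<phi> s ^ i)"
        proof (rule sum.cong[OF refl])
          fix t assume t: "t \<in> ?T"
          then have ts: "t \<in> semigroup_of K" by (simp add: boundary_points_def)
          have "\<phi> t \<noteq> 0" using t by simp
          then obtain q where q: "q \<in> G" "s \<in> face q" "t \<in> face q"
            by (rule common_face[OF Y s(1) ts s(3)])
          show "d (t + copies i s) * \<phi> (t + copies i s) = c t * \<phi> t * \<phi> s ^ i"
            using c_eq[OF q(1,2) s(2) q(3) _ d] t mult[OF ts] by (simp add: boundary_points_def)
        qed
        also have "\<dots> = (\<Sum>t\<in>boundary_points m. c t * \<phi> t) * \<phi> s ^ i"
          unfolding sum_distrib_right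
          by (rule sum.mono_neutral_left) (auto simp: finite_boundary_points)
        finally have "f \<phi> = (\<Sum>t\<in>boundary_points m. c t * \<phi> t)"
          using d Y s by (auto simp: local_form_def)
        then show ?thesis using Y by (simp add: restricted_section_def basic_section_def)
      qed
    qed
    also have "\<dots> \<in> fun_space.span (restricted_section ` boundary_points m)"
      by (rule sum_in_span) simp
    finally show "f \<in> fun_space.span (restricted_section ` boundary_points m)" .
  qed
qed

end

section \<open>The central fibre of a toric degeneration\<close>

lemma finite_lattice_points:
  assumes "bounded (B :: (real ^ 'n) set)"
  shows "finite {I :: int ^ 'n. rvec I \<in> B}"
proof -
  obtain b where b: "\<And>x. x \<in> B \<Longrightarrow> norm x \<le> b"
    using assms by (auto simp: bounded_iff)
  have "{I :: int ^ 'n. rvec I \<in> B} \<subseteq> vec_lambda ` (PiE UNIV (\<lambda>_. {-\<lceil>b\<rceil>..\<lceil>b\<rceil>}))"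
  proof
    fix I :: "int ^ 'n" assume "I \<in> {I. rvec I \<in> B}"
    then have n: "norm (rvec I) \<le> b" using b by auto
    have "\<bar>I $ j\<bar> \<le> \<lceil>b\<rceil>" for j
    proof -
      have "\<bar>rvec I $ j\<bar> \<le> b" using component_le_norm_cart[of "rvec I" j] n by linarith
      then have "real_of_int \<bar>I $ j\<bar> \<le> b" by (simp add: rvec_def)
      then show ?thesis by linarith
    qed
    then have "(\<lambda>j. I $ j) \<in> (PiE UNIV (\<lambda>_. {-\<lceil>b\<rceil>..\<lceil>b\<rceil>}))" by (auto simp: abs_le_iff minus_le_iff)
    then show "I \<in> vec_lambda ` (PiE UNIV (\<lambda>_. {-\<lceil>b\<rceil>..\<lceil>b\<rceil>}))"
      by (metis image_eqI vec_nth_inverse)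
  qed
  then show ?thesis by (rule finite_subset) (intro finite_imageI finite_PiE, auto)
qed

lemma rvec_inner: "rvec a \<bullet> rvec b = real_of_int (\<Sum>j\<in>UNIV. a $ j * b $ j)"
  by (simp add: rvec_def inner_vec_def)

lemma rvec_inner_Ints: "rvec a \<bullet> rvec b \<in> \<int>"
  unfolding rvec_inner by (rule Ints_of_int)

lemma closed_moment_polytope: "closed (moment_polytope L)"
proof -
  have "moment_polytope L = (\<Inter>ell\<in>L. {x. rvec ell \<bullet> x \<le> 1})"
    by (auto simp: moment_polytope_def)
  then show ?thesis by (auto intro!: closed_INT closed_halfspace_le)
qed

lemma zero_of_recession:
  assumes "bounded (moment_polytope L)" "\<And>ell. ell \<in> L \<Longrightarrow> rvec ell \<bullet> y \<le> 0"
  shows "y = 0"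
proof (rule ccontr)
  assume y: "y \<noteq> 0"
  obtain b where b: "\<And>x. x \<in> moment_polytope L \<Longrightarrow> norm x \<le> b"
    using assms(1) by (auto simp: bounded_iff)
  define c where "c = (\<bar>b\<bar> + 1) / norm y"
  have c: "0 \<le> c" by (simp add: c_def)
  have "rvec ell \<bullet> (c *\<^sub>R y) \<le> 1" if "ell \<in> L" for ell
  proof -
    have "rvec ell \<bullet> (c *\<^sub>R y) \<le> 0"
      using mult_nonneg_nonpos[OF c assms(2)[OF that]] by simp
    then show ?thesis by simp
  qed
  then have "norm (c *\<^sub>R y) \<le> b" by (intro b) (simp add: moment_polytope_def)
  then show False using y by (simp add: c_def)
qed

lemma continuous_on_PL_convex:
  assumes "finite \<Lambda>" "\<Lambda> \<noteq> {}"
  shows "continuous_on A (PL_convex \<Lambda>)"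
  using assms
proof (induction rule: finite_ne_induct)
  case (singleton x)
  then show ?case by (cases x) (auto simp: PL_convex_def intro!: continuous_intros)
next
  case (insert x F)
  obtain a c where x: "x = (a, c)" by (cases x)
  have "PL_convex (insert x F) = (\<lambda>y. max (rvec a \<bullet> y + real_of_rat c) (PL_convex F y))"
    using insert.hyps by (subst PL_convex_def) (simp add: fun_eq_iff PL_convex_def x)
  then show ?case using insert.IH by (auto intro!: continuous_intros)
qed

lemma scaled_pair_mem_iff:
  assumes "k \<noteq> 0"
  shows "(y, t) \<in> (\<lambda>p. k *\<^sub>R p) ` C \<longleftrightarrow> (y /\<^sub>R k, t / k) \<in> C"
proof
  assume "(y, t) \<in> (\<lambda>p. k *\<^sub>R p) ` C"
  then obtain p where "p \<in> C" "(y, t) = k *\<^sub>R p" by blast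
  then show "(y /\<^sub>R k, t / k) \<in> C" using assms by (cases p) simp
next
  assume "(y /\<^sub>R k, t / k) \<in> C"
  then show "(y, t) \<in> (\<lambda>p. k *\<^sub>R p) ` C"
    using assms by (intro image_eqI[of _ _ "(y /\<^sub>R k, t / k)"]) simp_all
qed

locale toric_degeneration =
  fixes L :: "(int ^ 'n) set" and \<Lambda> :: "((int ^ 'n) \<times> rat) set" and R l :: nat
  assumes finL: "finite L" and bounded_P: "bounded (moment_polytope L)"
    and fin\<Lambda>: "finite \<Lambda>" and \<Lambda>_ne: "\<Lambda> \<noteq> {}"
    and u_less: "\<And>x. x \<in> moment_polytope L \<Longrightarrow> PL_convex \<Lambda> x < real R"
    and l_pos: "1 \<le> l"
    and integral: "integral_polytope
      (scaled_closure l (degeneration_polytope (moment_polytope L) (PL_convex \<Lambda>) R))"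
begin

abbreviation u where "u \<equiv> PL_convex \<Lambda>"

definition K where "K = scaled_closure l (degeneration_polytope (moment_polytope L) u R)"

text \<open>
  The facets of the cone over the degeneration polytope: \<open>t \<ge> 0\<close>, the facets of the base \<open>P\<close>, and the
  graphs \<open>t = l m (R - u\<^sup>\<lambda>)\<close>.
\<close>

definition side_form :: "int ^ 'n \<Rightarrow> real \<times> (real ^ 'n) \<times> real" where
  "side_form ell = (real l, - rvec ell, 0)"

definition top_form :: "(int ^ 'n) \<times> rat \<Rightarrow> real \<times> (real ^ 'n) \<times> real" where
  "top_form = (\<lambda>(a, c). (real l * (real R - real_of_rat c), - rvec a, - 1))"

definition forms :: "(real \<times> (real ^ 'n) \<times> real) set" where
  "forms = insert (0, 0, 1) (side_form ` L \<union> top_form ` \<Lambda>)"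

lemma forms_nonneg_iff:
  "(\<forall>q\<in>forms. 0 \<le> q \<bullet> (m, y, t)) \<longleftrightarrow>
     (\<forall>ell\<in>L. rvec ell \<bullet> y \<le> m * real l) \<and> 0 \<le> t \<and>
     (\<forall>(a, c)\<in>\<Lambda>. rvec a \<bullet> y + m * real l * real_of_rat c \<le> m * real l * real R - t)"
proof -
  have "(\<forall>q\<in>forms. 0 \<le> q \<bullet> (m, y, t)) \<longleftrightarrow> 0 \<le> t \<and>
      (\<forall>ell\<in>L. 0 \<le> side_form ell \<bullet> (m, y, t)) \<and> (\<forall>p\<in>\<Lambda>. 0 \<le> top_form p \<bullet> (m, y, t))"
    by (simp add: forms_def ball_Un)
  also have "(\<forall>ell\<in>L. 0 \<le> side_form ell \<bullet> (m, y, t)) \<longleftrightarrow> (\<forall>ell\<in>L. rvec ell \<bullet> y \<le> m * real l)"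
    by (intro ball_cong refl) (simp add: side_form_def mult.commute)
  also have "(\<forall>p\<in>\<Lambda>. 0 \<le> top_form p \<bullet> (m, y, t)) \<longleftrightarrow>
      (\<forall>(a, c)\<in>\<Lambda>. rvec a \<bullet> y + m * real l * real_of_rat c \<le> m * real l * real R - t)"
    by (intro ball_cong refl) (simp add: top_form_def algebra_simps case_prod_beta')
  finally show ?thesis by (subst conj_left_commute)
qed

lemma PL_le_iff: "u x \<le> b \<longleftrightarrow> (\<forall>(a, c)\<in>\<Lambda>. rvec a \<bullet> x + real_of_rat c \<le> b)"
  unfolding PL_convex_def using fin\<Lambda> \<Lambda>_ne by (subst Max_le_iff) auto

lemma PL_ge: "(a, c) \<in> \<Lambda> \<Longrightarrow> rvec a \<bullet> x + real_of_rat c \<le> u x"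
  using PL_le_iff[of x "u x"] by auto

lemma PL_attained: "\<exists>a c. (a, c) \<in> \<Lambda> \<and> u x = rvec a \<bullet> x + real_of_rat c"
proof -
  have "u x \<in> (\<lambda>(a, c). rvec a \<bullet> x + real_of_rat c) ` \<Lambda>"
    unfolding PL_convex_def using fin\<Lambda> \<Lambda>_ne by (intro Max_in) auto
  then show ?thesis by auto
qed

text \<open>
  As \<open>u < R\<close> on \<open>P\<close>, every fibre over \<open>P\<close> is a nonempty open interval, and its closure adds both end
  points.
\<close>

lemma closure_degeneration_polytope:
  "closure (degeneration_polytope (moment_polytope L) u R)
     = {(x, t). x \<in> moment_polytope L \<and> 0 \<le> t \<and> t \<le> real R - u x}" (is "closure ?Q = ?C")
proof
  have cont: "continuous_on UNIV (\<lambda>p. real R - u (fst p) - snd p)"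
    by (intro continuous_intros continuous_on_compose2[OF continuous_on_PL_convex[OF fin\<Lambda> \<Lambda>_ne]]) auto
  have "closed ((fst -` moment_polytope L) \<inter> {p :: (real ^ 'n) \<times> real. 0 \<le> snd p} \<inter> {p. 0 \<le> real R - u (fst p) - snd p})"
    by (intro closed_Int closed_Collect_le cont continuous_intros closed_vimage_fst closed_moment_polytope)
  also have "(fst -` moment_polytope L) \<inter> {p :: (real ^ 'n) \<times> real. 0 \<le> snd p} \<inter> {p. 0 \<le> real R - u (fst p) - snd p} = ?C"
    by auto
  finally have "closed ?C" .
  then show "closure ?Q \<subseteq> ?C"
    by (intro closure_minimal) (auto simp: degeneration_polytope_def)
  show "?C \<subseteq> closure ?Q"
  proof clarify
    fix x t assume x: "x \<in> moment_polytope L" and t: "0 \<le> t" "t \<le> real R - u x"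
    have "t \<in> closure {0<..<real R - u x}" using t u_less[OF x] by simp
    then have "(x, t) \<in> closure ({x} \<times> {0<..<real R - u x})" by (simp add: closure_Times)
    also have "\<dots> \<subseteq> closure ?Q"
      using x by (intro closure_mono) (auto simp: degeneration_polytope_def)
    finally show "(x, t) \<in> closure ?Q" .
  qed
qed

lemma mem_scaled_iff:
  assumes "0 < m"
  shows "(y, t) \<in> (\<lambda>p. m *\<^sub>R p) ` K \<longleftrightarrow> (\<forall>q\<in>forms. 0 \<le> q \<bullet> (m, y, t))"
proof -
  let ?k = "m * real l"
  have k: "0 < ?k" using assms l_pos by simp
  have eq: "(\<lambda>p. m *\<^sub>R p) ` K = (\<lambda>p. ?k *\<^sub>R p) ` closure (degeneration_polytope (moment_polytope L) u R)"
    by (simp add: K_def scaled_closure_def image_image)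
  have "(y, t) \<in> (\<lambda>p. m *\<^sub>R p) ` K \<longleftrightarrow>
      (y /\<^sub>R ?k, t / ?k) \<in> closure (degeneration_polytope (moment_polytope L) u R)"
    unfolding eq by (rule scaled_pair_mem_iff[OF less_imp_neq[OF k, symmetric]])
  also have "\<dots> \<longleftrightarrow> (\<forall>ell\<in>L. rvec ell \<bullet> (y /\<^sub>R ?k) \<le> 1) \<and> 0 \<le> t / ?k \<and> u (y /\<^sub>R ?k) \<le> real R - t / ?k"
    unfolding closure_degeneration_polytope by (auto simp: moment_polytope_def)
  also have "u (y /\<^sub>R ?k) \<le> real R - t / ?k \<longleftrightarrow>
      (\<forall>(a, c)\<in>\<Lambda>. rvec a \<bullet> y + ?k * real_of_rat c \<le> ?k * real R - t)"
    unfolding PL_le_iff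
  proof (intro ball_cong refl, clarify)
    fix a :: "int ^ 'n" and c
    have "x / k + r \<le> b - t / k \<longleftrightarrow> x + k * r \<le> k * b - t" if "0 < k" for k x r b :: real
    proof -
      have "x / k + r \<le> b - t / k \<longleftrightarrow> k * (x / k + r) \<le> k * (b - t / k)" using that by simp
      also have "k * (x / k + r) = x + k * r" using that by (simp add: distrib_left)
      also have "k * (b - t / k) = k * b - t" using that by (simp add: right_diff_distrib)
      finally show ?thesis .
    qed
    from this[OF k, of "rvec a \<bullet> y"]
    show "rvec a \<bullet> (y /\<^sub>R ?k) + real_of_rat c \<le> real R - t / ?k \<longleftrightarrow>
       rvec a \<bullet> y + ?k * real_of_rat c \<le> ?k * real R - t"
      by (simp only: inner_scaleR_right inverse_eq_divide times_divide_eq_left mult_1)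
  qed
  also have "(\<forall>ell\<in>L. rvec ell \<bullet> (y /\<^sub>R ?k) \<le> 1) \<longleftrightarrow> (\<forall>ell\<in>L. rvec ell \<bullet> y \<le> ?k)"
    using k by (simp only: inner_scaleR_right inverse_eq_divide times_divide_eq_left mult_1 pos_divide_le_eq)
  also have "0 \<le> t / ?k \<longleftrightarrow> 0 \<le> t" using k by (simp add: zero_le_divide_iff)
  finally show ?thesis unfolding forms_nonneg_iff .
qed

text \<open>
  In degree \<open>0\<close> the dilated polytope is the origin, whereas the forms describe the recession cone; the
  two agree because \<open>P\<close> is bounded.
\<close>

lemma semigroup_K_iff: "s \<in> semigroup_of K \<longleftrightarrow> (\<forall>q\<in>forms. 0 \<le> q \<bullet> lp_vec s)"
proof -
  obtain m I i where s: "s = (m, I, i)" by (metis prod_cases3)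
  show ?thesis
  proof (cases "m = 0")
    case False
    then show ?thesis using mem_scaled_iff[of "real m" "rvec I" "real_of_int i"]
      by (simp add: s semigroup_of_def lp_vec_def)
  next
    case True
    have "(0, 0) \<in> closure (degeneration_polytope (moment_polytope L) u R)"
      using u_less[of 0] unfolding closure_degeneration_polytope by (simp add: moment_polytope_def)
    then have "K \<noteq> {}" unfolding K_def scaled_closure_def image_is_empty by (metis empty_iff)
    then have 1: "s \<in> semigroup_of K \<longleftrightarrow> rvec I = 0 \<and> i = 0"
      by (simp add: s True semigroup_of_def zero_prod_def image_constant_conv)
    have "rvec I = 0 \<and> i = 0" if h: "\<forall>q\<in>forms. 0 \<le> q \<bullet> (0, rvec I, real_of_int i)"
    proof -
      have "rvec I = 0"
        using h unfolding forms_nonneg_iff by (intro zero_of_recession[OF bounded_P]) auto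
      moreover obtain a c where "(a, c) \<in> \<Lambda>" using \<Lambda>_ne by auto
      ultimately show ?thesis using h unfolding forms_nonneg_iff by auto
    qed
    then have 2: "(\<forall>q\<in>forms. 0 \<le> q \<bullet> lp_vec s) \<longleftrightarrow> rvec I = 0 \<and> i = 0"
      by (auto simp: s True lp_vec_def zero_prod_def[symmetric])
    show ?thesis unfolding 1 2 ..
  qed
qed

lemma K_is_lattice_polytope:
  "\<exists>W. finite W \<and> K = convex hull ((\<lambda>(I, i). (rvec I, real_of_int i)) ` (W :: ((int ^ 'n) \<times> int) set))"
  using integral unfolding K_def integral_polytope_def .

lemma bounded_scaled: "bounded ((\<lambda>p. (m::real) *\<^sub>R p) ` K)"
proof -
  obtain W where W: "finite W" "K = convex hull ((\<lambda>(I, i). (rvec I, real_of_int i)) ` (W :: ((int ^ 'n) \<times> int) set))"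
    using K_is_lattice_polytope by blast
  have "bounded K" unfolding W(2) using W(1)
    by (intro bounded_convex_hull finite_imp_bounded finite_imageI)
  then show ?thesis by (rule bounded_scaling)
qed

lemma finite_degree: "finite {s \<in> semigroup_of K. fst s = d}"
proof -
  obtain b where b: "\<And>p. p \<in> (\<lambda>p. real d *\<^sub>R p) ` K \<Longrightarrow> norm p \<le> b"
    using bounded_scaled[of "real d"] unfolding bounded_iff by blast
  have "{s \<in> semigroup_of K. fst s = d} \<subseteq> {d} \<times> ({I. rvec I \<in> cball 0 b} \<times> {- \<lceil>b\<rceil>..\<lceil>b\<rceil>})"
  proof
    fix s assume s: "s \<in> {s \<in> semigroup_of K. fst s = d}"
    then obtain I i where s': "s = (d, I, i)" by (cases s) auto
    then have n: "norm (rvec I, real_of_int i) \<le> b" using s by (intro b) (simp add: semigroup_of_def)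
    have "norm (rvec I) \<le> b" "norm (real_of_int i) \<le> b"
      using n norm_fst_le[of "rvec I" "real_of_int i"] norm_snd_le[of "real_of_int i" "rvec I"]
      by linarith+
    then show "s \<in> {d} \<times> ({I. rvec I \<in> cball 0 b} \<times> {- \<lceil>b\<rceil>..\<lceil>b\<rceil>})"
      by (simp add: s') linarith
  qed
  moreover have "finite \<dots>" by (intro finite_cartesian_product finite_lattice_points) auto
  ultimately show ?thesis by (rule finite_subset)
qed

definition vertices :: "'n lattice_point set" where
  "vertices = {1} \<times> (SOME W. finite W \<and> K = convex hull ((\<lambda>(I, i). (rvec I, real_of_int i)) ` W))"

lemma vertices_hull: "{1} \<times> K = convex hull (lp_vec ` vertices)"
proof -
  define W where "W = (SOME W :: ((int ^ 'n) \<times> int) set. finite W \<and> K = convex hull ((\<lambda>(I, i). (rvec I, real_of_int i)) ` W))"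
  have W: "K = convex hull ((\<lambda>(I, i). (rvec I, real_of_int i)) ` W)"
    using someI_ex[OF K_is_lattice_polytope] unfolding W_def ..
  have "lp_vec ` vertices = {1} \<times> ((\<lambda>(I, i). (rvec I, real_of_int i)) ` W)"
    by (force simp: vertices_def W_def[symmetric] lp_vec_def image_iff)
  then show ?thesis by (simp add: convex_hull_Times W)
qed

sublocale toric_strata K forms "top_form ` \<Lambda>" vertices
proof
  show "finite forms" using finL fin\<Lambda> by (simp add: forms_def)
  show "top_form ` \<Lambda> \<subseteq> forms" by (auto simp: forms_def)
  show "s \<in> semigroup_of K \<longleftrightarrow> (\<forall>q\<in>forms. 0 \<le> q \<bullet> lp_vec s)" for s by (rule semigroup_K_iff)
  show "vertices \<subseteq> semigroup_of K"
  proof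
    fix v assume v: "v \<in> vertices"
    then have "lp_vec v \<in> {1} \<times> K" unfolding vertices_hull by (intro hull_inc imageI)
    moreover have "lp_vec v = (1, snd (lp_vec v))" using v by (auto simp: vertices_def lp_vec_def)
    ultimately have "snd (lp_vec v) \<in> (\<lambda>p. 1 *\<^sub>R p) ` K" by auto
    then show "v \<in> semigroup_of K"
      unfolding semigroup_K_iff using mem_scaled_iff[of 1 "fst (snd (lp_vec v))" "snd (snd (lp_vec v))"]
        \<open>lp_vec v = (1, snd (lp_vec v))\<close> by (metis prod.collapse zero_less_one)
  qed
  show "x \<in> convex hull (lp_vec ` vertices)" if "fst x = 1" "\<And>q. q \<in> forms \<Longrightarrow> 0 \<le> q \<bullet> x" for x
  proof -
    have "x = (1, fst (snd x), snd (snd x))" using that(1) by (simp add: prod_eq_iff)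
    then obtain y t where x: "x = (1, y, t)" by blast
    have "(y, t) \<in> (\<lambda>p. 1 *\<^sub>R p) ` K" using that(2) by (subst mem_scaled_iff) (auto simp: x)
    then show ?thesis unfolding vertices_hull[symmetric] by (simp add: x)
  qed
  show "fst v = 1" if "v \<in> vertices" for v using that by (auto simp: vertices_def)
  show "finite {s \<in> semigroup_of K. fst s = d}" for d by (rule finite_degree)
qed

text \<open>
  A top form that vanishes at a real point of the cone vanishes at a vertex of the polytope. As
  vertices are lattice points and the linear part of the form is integral, so is its constant term.
\<close>

lemma active_top_form_integral:
  assumes q: "(a, c) \<in> \<Lambda>" and m: "0 < m"
    and nonneg: "\<forall>q\<in>forms. 0 \<le> q \<bullet> (m, y, t)" and zero: "top_form (a, c) \<bullet> (m, y, t) = 0"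
  shows "real l * (real R - real_of_rat c) \<in> \<int>"
proof -
  let ?q = "top_form (a, c)"
  let ?x = "(m, y, t) /\<^sub>R m"
  have "?x \<in> convex hull (lp_vec ` vertices)"
    using nonneg m by (intro hull) (simp_all add: inner_scaleR_right del: scaleR_Pair)
  moreover have "?q \<bullet> ?x = 0" using zero by (simp add: inner_scaleR_right del: scaleR_Pair)
  ultimately have "\<not> convex hull (lp_vec ` vertices) \<subseteq> {x. ?q \<bullet> x > 0}"
    by (metis (mono_tags, lifting) less_irrefl mem_Collect_eq subsetD)
  then have "\<not> lp_vec ` vertices \<subseteq> {x. ?q \<bullet> x > 0}"
    by (metis hull_minimal convex_halfspace_gt)
  then obtain v where v: "v \<in> vertices" "\<not> ?q \<bullet> lp_vec v > 0" by blast
  have "?q \<in> forms" using q by (simp add: forms_def)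
  then have "0 \<le> ?q \<bullet> lp_vec v" using v(1) V_sub semigroup_K_iff by blast
  with v(2) have 0: "?q \<bullet> lp_vec v = 0" by simp
  obtain J j where "v = (1, J, j)" using v(1) by (auto simp: vertices_def)
  with 0 have "real l * (real R - real_of_rat c) = rvec a \<bullet> rvec J + real_of_int j"
    by (simp add: top_form_def lp_vec_def)
  then show ?thesis using rvec_inner_Ints[of a J] by simp
qed

lemma top_form_Ints:
  assumes "real l * (real R - real_of_rat c) \<in> \<int>"
  shows "top_form (a, c) \<bullet> lp_vec s \<in> \<int>"
proof -
  obtain m I i where s: "s = (m, I, i)" by (metis prod_cases3)
  have "top_form (a, c) \<bullet> lp_vec s = (real l * (real R - real_of_rat c)) * real m - rvec a \<bullet> rvec I - real_of_int i"
    by (simp add: s top_form_def lp_vec_def)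
  also have "\<dots> \<in> \<int>"
    by (rule Ints_diff[OF Ints_diff[OF Ints_mult[OF assms Ints_of_nat] rvec_inner_Ints] Ints_of_int])
  finally show ?thesis .
qed

lemma degree_zero: "(0, I, i) \<in> semigroup_of K \<Longrightarrow> I = 0 \<and> i = 0"
  by (auto simp: semigroup_of_def zero_prod_def rvec_def vec_eq_iff)

text \<open>
  Raise the point by the least value \<open>\<tau>\<close> of a top form on it. This form then vanishes at the raised point,
  so it is integral and \<open>\<tau>\<close> is an integer. Hence \<open>\<tau> \<ge> 1\<close> as soon as \<open>\<tau> > 0\<close>.
\<close>

lemma raised_point_iff:
  assumes s: "(m, I, i) \<in> semigroup_of K"
  shows "(m, I, i + 1) \<in> semigroup_of K \<longleftrightarrow> (\<forall>q\<in>top_form ` \<Lambda>. 0 < q \<bullet> lp_vec (m, I, i))"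
proof -
  have drop: "top_form p \<bullet> (x, y, t + \<tau>) = top_form p \<bullet> (x, y, t) - \<tau>" for p x y t \<tau>
    by (cases p) (simp add: top_form_def)
  have lp: "lp_vec (m, I, i + 1) = (real m, rvec I, real_of_int i + 1)" "lp_vec (m, I, i) = (real m, rvec I, real_of_int i)"
    by (simp_all add: lp_vec_def)
  have other: "0 \<le> q \<bullet> (real m, rvec I, real_of_int i + \<tau>)"
    if "q \<in> forms" "q \<notin> top_form ` \<Lambda>" "0 \<le> \<tau>" for q \<tau>
  proof -
    have "0 \<le> q \<bullet> (real m, rvec I, real_of_int i)" using s that semigroup_K_iff lp by metis
    then show ?thesis using that by (auto simp: forms_def side_form_def)
  qed
  show ?thesis
  proof
    assume "(m, I, i + 1) \<in> semigroup_of K"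
    then have "\<forall>q\<in>forms. 0 \<le> q \<bullet> lp_vec (m, I, i + 1)" by (simp add: semigroup_K_iff)
    then show "\<forall>q\<in>top_form ` \<Lambda>. 0 < q \<bullet> lp_vec (m, I, i)"
      unfolding lp forms_def by (force simp: drop)
  next
    assume pos: "\<forall>q\<in>top_form ` \<Lambda>. 0 < q \<bullet> lp_vec (m, I, i)"
    define \<tau> where "\<tau> = Min ((\<lambda>p. top_form p \<bullet> lp_vec (m, I, i)) ` \<Lambda>)"
    have "\<tau> \<in> (\<lambda>p. top_form p \<bullet> lp_vec (m, I, i)) ` \<Lambda>"
      unfolding \<tau>_def using fin\<Lambda> \<Lambda>_ne by (intro Min_in) auto
    then obtain a c where ac: "(a, c) \<in> \<Lambda>" "\<tau> = top_form (a, c) \<bullet> lp_vec (m, I, i)" by auto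
    have \<tau>0: "0 < \<tau>" using pos ac by auto
    have \<tau>_le: "\<tau> \<le> top_form p \<bullet> lp_vec (m, I, i)" if "p \<in> \<Lambda>" for p
      unfolding \<tau>_def using fin\<Lambda> that by simp
    have m: "0 < m"
    proof (rule ccontr)
      assume "\<not> 0 < m"
      then have "m = 0" by simp
      then have "(m, I, i) = 0" using degree_zero s by (simp add: zero_prod_def)
      then have "lp_vec (m, I, i) = 0" by simp
      then show False using \<tau>0 ac by simp
    qed
    have "\<forall>q\<in>forms. 0 \<le> q \<bullet> (real m, rvec I, real_of_int i + \<tau>)"
    proof
      fix q assume q: "q \<in> forms"
      show "0 \<le> q \<bullet> (real m, rvec I, real_of_int i + \<tau>)"
      proof (cases "q \<in> top_form ` \<Lambda>")
        case True
        then show ?thesis using \<tau>_le unfolding lp by (auto simp: drop)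
      qed (use other q \<tau>0 in simp)
    qed
    moreover have "top_form (a, c) \<bullet> (real m, rvec I, real_of_int i + \<tau>) = 0"
      using ac unfolding lp by (simp add: drop)
    ultimately have "real l * (real R - real_of_rat c) \<in> \<int>"
      using active_top_form_integral[OF ac(1), of "real m"] m by simp
    then have "\<tau> \<in> \<int>" unfolding ac by (rule top_form_Ints)
    then have "1 \<le> \<tau>" using \<tau>0 by (auto elim!: Ints_cases)
    show "(m, I, i + 1) \<in> semigroup_of K"
      unfolding semigroup_K_iff lp
    proof
      fix q assume q: "q \<in> forms"
      show "0 \<le> q \<bullet> (real m, rvec I, real_of_int i + 1)"
      proof (cases "q \<in> top_form ` \<Lambda>")
        case True
        then show ?thesis using \<tau>_le \<open>1 \<le> \<tau>\<close> unfolding lp by (force simp: drop)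
      qed (use other q in simp)
    qed
  qed
qed

lemma central_fibre_eq: "central_fibre K = strata"
proof -
  have "(\<forall>m I i. (m, I, i) \<in> semigroup_of K \<and> (m, I, i + 1) \<in> semigroup_of K \<longrightarrow>
        0 * basic_section (m, I, i + 1) \<phi> = 1 * basic_section (m, I, i) \<phi>) \<longleftrightarrow>
      (\<forall>s\<in>semigroup_of K. (\<forall>q\<in>top_form ` \<Lambda>. 0 < q \<bullet> lp_vec s) \<longrightarrow> \<phi> s = 0)"
    (is "?A \<longleftrightarrow> ?B") for \<phi>
  proof
    assume ?A
    show ?B
    proof (intro ballI impI)
      fix s assume s: "s \<in> semigroup_of K" "\<forall>q\<in>top_form ` \<Lambda>. 0 < q \<bullet> lp_vec s"
      obtain m I i where si: "s = (m, I, i)" by (metis prod_cases3)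
      have "0 * basic_section (m, I, i + 1) \<phi> = 1 * basic_section (m, I, i) \<phi>"
        using \<open>?A\<close> s raised_point_iff[of m I i] unfolding si by blast
      then show "\<phi> s = 0" by (simp add: si basic_section_def)
    qed
  next
    assume B: ?B
    show ?A
    proof (intro allI impI)
      fix m I i assume *: "(m, I, i) \<in> semigroup_of K \<and> (m, I, i + 1) \<in> semigroup_of K"
      then have "\<phi> (m, I, i) = 0" using B raised_point_iff[of m I i] by blast
      then show "0 * basic_section (m, I, i + 1) \<phi> = 1 * basic_section (m, I, i) \<phi>"
        by (simp add: basic_section_def)
    qed
  qed
  then show ?thesis unfolding central_fibre_def fibre_def strata_def by blast
qed

definition dilated_points :: "nat \<Rightarrow> (int ^ 'n) set" where
  "dilated_points k = {I. \<forall>ell\<in>L. rvec ell \<bullet> rvec I \<le> real k}"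

definition height :: "nat \<Rightarrow> int ^ 'n \<Rightarrow> real" where
  "height k I = real k * (real R - u (rvec I /\<^sub>R real k))"

text \<open>
  Over \<open>I\<close> the top boundary has height \<open>k (R - u(I/k))\<close>, where an active top form vanishes. That form is
  integral, so the height is an integer.
\<close>

lemma boundary_points_eq:
  assumes m: "0 < m"
  shows "bij_betw (\<lambda>I. (m, I, \<lfloor>height (l * m) I\<rfloor>)) (dilated_points (l * m)) (boundary_points m)"
    and "\<And>I. I \<in> dilated_points (l * m) \<Longrightarrow> of_int \<lfloor>height (l * m) I\<rfloor> = height (l * m) I"
proof -
  let ?k = "real m * real l"
  have k: "0 < ?k" using m l_pos by simp
  have top: "top_form (a, c) \<bullet> (real m, rvec I, t)
      = ?k * (real R - (rvec a \<bullet> (rvec I /\<^sub>R ?k) + real_of_rat c)) - t" for a c I t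
  proof -
    have 1: "k * (b - (x / k + c)) - t = k * (b - c) - x - t" if "0 < k" for k b x c :: real
      using that by (simp add: right_diff_distrib distrib_left)
    have "top_form (a, c) \<bullet> (real m, rvec I, t) = ?k * (real R - real_of_rat c) - rvec a \<bullet> rvec I - t"
      by (simp add: top_form_def algebra_simps)
    also have "\<dots> = ?k * (real R - (rvec a \<bullet> (rvec I /\<^sub>R ?k) + real_of_rat c)) - t"
      by (simp only: inner_scaleR_right inverse_eq_divide times_divide_eq_left mult_1 1[OF k])
    finally show ?thesis .
  qed
  have h: "height (l * m) I = ?k * (real R - u (rvec I /\<^sub>R ?k))" for I
    by (simp add: height_def mult.commute)
  have top_ge: "height (l * m) I - t \<le> top_form p \<bullet> (real m, rvec I, t)" if "p \<in> \<Lambda>" for p I t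
  proof -
    obtain a c where p: "p = (a, c)" by (cases p)
    have "rvec a \<bullet> (rvec I /\<^sub>R ?k) + real_of_rat c \<le> u (rvec I /\<^sub>R ?k)"
      using that unfolding p by (rule PL_ge)
    then have "?k * (real R - u (rvec I /\<^sub>R ?k)) \<le> ?k * (real R - (rvec a \<bullet> (rvec I /\<^sub>R ?k) + real_of_rat c))"
      using k by (intro mult_left_mono) linarith+
    then show ?thesis unfolding p top h by linarith
  qed
  have top_eq: "\<exists>p\<in>\<Lambda>. \<forall>t. top_form p \<bullet> (real m, rvec I, t) = height (l * m) I - t" for I
  proof -
    obtain a c where "(a, c) \<in> \<Lambda>" "u (rvec I /\<^sub>R ?k) = rvec a \<bullet> (rvec I /\<^sub>R ?k) + real_of_rat c"
      using PL_attained by blast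
    then show ?thesis by (intro bexI[of _ "(a, c)"] allI) (simp_all only: top h)
  qed
  have h0: "0 \<le> height (l * m) I" if "I \<in> dilated_points (l * m)" for I
  proof -
    have "rvec I /\<^sub>R ?k \<in> moment_polytope L"
      using that k unfolding dilated_points_def moment_polytope_def
      by (simp only: inner_scaleR_right inverse_eq_divide times_divide_eq_left mult_1 pos_divide_le_eq)
        (simp add: mult.commute)
    then show ?thesis using u_less[of "rvec I /\<^sub>R ?k"] k unfolding h
      by (intro mult_nonneg_nonneg) linarith+
  qed
  have cone: "\<forall>q\<in>forms. 0 \<le> q \<bullet> (real m, rvec I, t)"
    if "I \<in> dilated_points (l * m)" "0 \<le> t" "t \<le> height (l * m) I" for I t
  proof
    fix q assume "q \<in> forms"
    then consider "q = (0, 0, 1)" | ell where "ell \<in> L" "q = side_form ell" | p where "p \<in> \<Lambda>" "q = top_form p"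
      by (auto simp: forms_def)
    then show "0 \<le> q \<bullet> (real m, rvec I, t)"
    proof cases
      case 3
      then show ?thesis using top_ge[of p I t] that by simp
    qed (use that in \<open>auto simp: side_form_def dilated_points_def mult.commute\<close>)
  qed
  show int: "of_int \<lfloor>height (l * m) I\<rfloor> = height (l * m) I" if I: "I \<in> dilated_points (l * m)" for I
  proof -
    obtain p where p: "p \<in> \<Lambda>" "\<And>t. top_form p \<bullet> (real m, rvec I, t) = height (l * m) I - t"
      using top_eq by blast
    obtain a c where ac: "p = (a, c)" by (cases p)
    have "real l * (real R - real_of_rat c) \<in> \<int>"
    proof (rule active_top_form_integral[of a c "real m" "rvec I" "height (l * m) I"])
      show "\<forall>q\<in>forms. 0 \<le> q \<bullet> (real m, rvec I, height (l * m) I)"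
        using cone[OF I h0[OF I]] by simp
    qed (use p ac m in auto)
    then have "top_form p \<bullet> lp_vec (m, I, 0) \<in> \<int>" unfolding ac by (rule top_form_Ints)
    then have "height (l * m) I \<in> \<int>" using p(2)[of 0] by (simp add: lp_vec_def)
    then show ?thesis by (rule of_int_floor)
  qed
  show "bij_betw (\<lambda>I. (m, I, \<lfloor>height (l * m) I\<rfloor>)) (dilated_points (l * m)) (boundary_points m)"
  proof (rule bij_betwI')
    fix I assume I: "I \<in> dilated_points (l * m)"
    have lp: "lp_vec (m, I, \<lfloor>height (l * m) I\<rfloor>) = (real m, rvec I, height (l * m) I)"
      by (simp add: lp_vec_def int[OF I])
    have "(m, I, \<lfloor>height (l * m) I\<rfloor>) \<in> semigroup_of K"
      unfolding semigroup_K_iff lp using cone[OF I h0[OF I]] by simp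
    moreover obtain p where p: "p \<in> \<Lambda>" "top_form p \<bullet> (real m, rvec I, height (l * m) I) = 0"
      using top_eq[of I] by auto
    ultimately show "(m, I, \<lfloor>height (l * m) I\<rfloor>) \<in> boundary_points m"
      unfolding boundary_points_def using lp by auto
  next
    fix s assume "s \<in> boundary_points m"
    then obtain p where s: "s \<in> semigroup_of K" "fst s = m" "p \<in> \<Lambda>" "top_form p \<bullet> lp_vec s = 0"
      unfolding boundary_points_def by blast
    obtain I i where si: "s = (m, I, i)" using s(2) by (metis prod.collapse)
    have pos: "\<forall>q\<in>forms. 0 \<le> q \<bullet> (real m, rvec I, real_of_int i)"
      using s(1) unfolding semigroup_K_iff by (simp add: si lp_vec_def)
    then have I: "I \<in> dilated_points (l * m)"
      unfolding forms_nonneg_iff dilated_points_def by (simp add: mult.commute)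
    have "height (l * m) I - real_of_int i \<le> 0"
      using top_ge[OF s(3), of I "real_of_int i"] s(4) by (simp add: si lp_vec_def)
    moreover obtain p' where "p' \<in> \<Lambda>" "top_form p' \<bullet> (real m, rvec I, real_of_int i) = height (l * m) I - real_of_int i"
      using top_eq[of I] by blast
    then have "0 \<le> height (l * m) I - real_of_int i"
      using pos by (force simp: forms_def)
    ultimately have "height (l * m) I = real_of_int i" by simp
    then show "\<exists>I\<in>dilated_points (l * m). s = (m, I, \<lfloor>height (l * m) I\<rfloor>)"
      using I si by (intro bexI[of _ I]) auto
  qed auto
qed

lemma torus_action_strata_iff:
  assumes "\<And>j. w $ j \<noteq> 0" "z \<noteq> 0"
  shows "torus_action w z \<phi> \<in> strata \<longleftrightarrow> \<phi> \<in> strata"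
proof -
  have act: "torus_action w z \<phi> s = character w z s * \<phi> s" for \<phi> s
    by (cases s) (simp add: torus_action_def character_def)
  note nz = character_nonzero[OF assms]
  have "(character w z s * \<phi> s * (character w z s' * \<phi> s') = character w z (s + s') * \<phi> (s + s'))
      \<longleftrightarrow> \<phi> s * \<phi> s' = \<phi> (s + s')" for s s'
  proof -
    have "character w z s * \<phi> s * (character w z s' * \<phi> s') = character w z (s + s') * (\<phi> s * \<phi> s')"
      by (simp add: character_add[OF assms] mult_ac del: mult_cancel_left)
    then show ?thesis by (simp only: mult_cancel_left nz simp_thms)
  qed
  then have "(\<forall>s s'. s \<in> S \<longrightarrow> s' \<in> S \<longrightarrow> character w z (s + s') * \<phi> (s + s') = character w z s * \<phi> s * (character w z s' * \<phi> s'))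
      \<longleftrightarrow> (\<forall>s s'. s \<in> S \<longrightarrow> s' \<in> S \<longrightarrow> \<phi> (s + s') = \<phi> s * \<phi> s')" for S
    by metis
  then show ?thesis
    unfolding strata_def toric_cone_def Ball_def Bex_def mem_Collect_eq act
    using nz by simp
qed

lemma restricted_section_torus_action:
  assumes "\<And>j. w $ j \<noteq> 0" "z \<noteq> 0"
  shows "restricted_section (m, I, i) (torus_action w z \<phi>)
    = (\<Prod>j\<in>UNIV. (w $ j) powi (I $ j)) * z powi i * restricted_section (m, I, i) \<phi>"
  unfolding restricted_section_def torus_action_strata_iff[OF assms]
  by (simp add: basic_section_def torus_action_def)

text \<open>
  The torus preserves the union of strata and multiplies each basic section by a character, so the basis
  of restricted sections consists of eigenvectors of both time-one maps.
\<close>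

theorem eigenvalues_on_central_fibre:
  assumes m: "0 < m"
  obtains N X v where
    "N = fun_space.dim (global_sections K (central_fibre K) m)"
    "simultaneous_eigenvalues (global_sections K (central_fibre K) m) (X_time_one \<theta>) v_time_one N X v"
    "N = card (dilated_points (l * m))"
    "\<And>F :: real \<Rightarrow> real \<Rightarrow> real.
      (\<Sum>\<alpha><N. F (X \<alpha>) (v \<alpha>)) = (\<Sum>I\<in>dilated_points (l * m). F (\<theta> \<bullet> rvec I) (height (l * m) I))"
proof -
  let ?D = "dilated_points (l * m)" and ?H = "global_sections K (central_fibre K) m"
  let ?t = "\<lambda>I. (m, I, \<lfloor>height (l * m) I\<rfloor>)"
  note bij = boundary_points_eq(1)[OF m] and int = boundary_points_eq(2)[OF m]
  note ind = restricted_sections_independent[OF m]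
  have "finite ?D" using bij finite_boundary_points bij_betw_finite by blast
  then obtain e where e: "bij_betw e {..<card ?D} ?D"
    using ex_bij_betw_nat_finite[of ?D] by (auto simp: atLeast0LessThan)
  define N where "N = card ?D"
  define X where "X \<alpha> = \<theta> \<bullet> rvec (e \<alpha>)" for \<alpha>
  define v where "v \<alpha> = height (l * m) (e \<alpha>)" for \<alpha>
  define b where "b \<alpha> = restricted_section (?t (e \<alpha>))" for \<alpha>
  have te: "bij_betw (?t \<circ> e) {..<N} (boundary_points m)"
    using bij_betw_trans[OF e bij] by (simp add: N_def)
  have b: "b = restricted_section \<circ> (?t \<circ> e)" by (simp add: b_def fun_eq_iff)
  have im: "b ` {..<N} = restricted_section ` boundary_points m"
    using te unfolding b bij_betw_def by (metis image_comp)
  have inj: "inj_on b {..<N}"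
    unfolding b by (rule comp_inj_on) (use te ind(1) in \<open>simp_all only: bij_betw_def\<close>)
  have span: "fun_space.span (b ` {..<N}) = ?H"
    unfolding im central_fibre_eq global_sections_strata[OF m] ..
  have dim: "N = fun_space.dim ?H"
  proof -
    have "fun_space.dim ?H = card (b ` {..<N})"
      unfolding span[symmetric] im by (rule fun_space.dim_span_eq_card_independent[OF ind(2)])
    then show ?thesis using inj by (simp add: card_image)
  qed
  have exp_powi: "complex_of_real (exp x) powi i = complex_of_real (exp (real_of_int i * x))" for x i
    by (simp add: exp_power_int flip: of_real_power_int)
  have "X_time_one \<theta> (b \<alpha>) = (\<lambda>\<phi>. complex_of_real (exp (X \<alpha>)) * b \<alpha> \<phi>)" for \<alpha>
  proof
    fix \<phi>
    have "(\<Prod>j\<in>UNIV. complex_of_real (exp (\<theta> $ j)) powi (e \<alpha> $ j)) = complex_of_real (exp (X \<alpha>))"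
      unfolding exp_powi by (simp add: X_def inner_vec_def rvec_def exp_sum mult.commute)
    then show "X_time_one \<theta> (b \<alpha>) \<phi> = complex_of_real (exp (X \<alpha>)) * b \<alpha> \<phi>"
      unfolding X_time_one_def b_def
      by (subst restricted_section_torus_action) (simp_all del: of_real_exp)
  qed
  moreover have "v_time_one (b \<alpha>) = (\<lambda>\<phi>. complex_of_real (exp (v \<alpha>)) * b \<alpha> \<phi>)" if "\<alpha> < N" for \<alpha>
  proof
    fix \<phi>
    have "e \<alpha> \<in> ?D" using e that by (auto simp: bij_betw_def N_def)
    then have "complex_of_real (exp 1) powi \<lfloor>height (l * m) (e \<alpha>)\<rfloor> = complex_of_real (exp (v \<alpha>))"
      unfolding exp_powi by (simp add: int v_def)
    then show "v_time_one (b \<alpha>) \<phi> = complex_of_real (exp (v \<alpha>)) * b \<alpha> \<phi>"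
      unfolding v_time_one_def b_def
      by (subst restricted_section_torus_action) (simp_all del: of_real_exp)
  qed
  ultimately have "simultaneous_eigenvalues ?H (X_time_one \<theta>) v_time_one N X v"
    unfolding simultaneous_eigenvalues_def using inj ind(2) span im by (intro exI[of _ b]) simp
  moreover have "(\<Sum>\<alpha><N. F (X \<alpha>) (v \<alpha>)) = (\<Sum>I\<in>?D. F (\<theta> \<bullet> rvec I) (height (l * m) I))"
    for F :: "real \<Rightarrow> real \<Rightarrow> real"
    unfolding X_def v_def N_def by (rule sum.reindex_bij_betw[OF e, of "\<lambda>I. F (\<theta> \<bullet> rvec I) (height (l * m) I)"])
  ultimately show thesis using that[of N X v] dim by (simp add: N_def)
qed

end

section \<open>Tilings of space by lattice translates\<close>

definition pairing :: "int ^ 'n \<Rightarrow> int ^ 'n \<Rightarrow> int" where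
  "pairing a b = (\<Sum>j\<in>UNIV. a $ j * b $ j)"

definition floor_vec :: "real ^ 'n \<Rightarrow> int ^ 'n" where
  "floor_vec z = (\<chi> j. \<lfloor>z $ j\<rfloor>)"

lemma rvec_inner_pairing: "rvec a \<bullet> rvec b = real_of_int (pairing a b)"
  by (simp add: pairing_def rvec_inner)

lemma pairing_add: "pairing a (b + c) = pairing a b + pairing a c"
  by (simp add: pairing_def distrib_left sum.distrib)

lemma pairing_diff: "pairing a (b - c) = pairing a b - pairing a c"
  by (simp add: pairing_def right_diff_distrib sum_subtractf)

lemma pairing_scale: "pairing a (i *s b) = i * pairing a b"
  by (simp add: pairing_def sum_distrib_left mult_ac)

lemma rvec_diff: "rvec (a - b) = rvec a - rvec b"
  by (simp add: rvec_def vec_eq_iff)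

lemma rvec_scale: "rvec (i *s b) = real_of_int i *\<^sub>R rvec b"
  by (simp add: rvec_def vec_eq_iff)

lemma rvec_minus: "rvec (- a) = - rvec a"
  by (simp add: rvec_def vec_eq_iff)

lemma floor_vec_eq_iff:
  "floor_vec z = I \<longleftrightarrow> (\<forall>j. real_of_int (I $ j) \<le> z $ j \<and> z $ j < real_of_int (I $ j) + 1)"
  by (auto simp: floor_vec_def vec_eq_iff floor_eq_iff)

lemma floor_vec_add: "floor_vec (z + rvec I) = floor_vec z + I"
  by (simp add: floor_vec_def rvec_def vec_eq_iff)

lemma norm_floor_vec: "norm (rvec (floor_vec z) - z) \<le> real CARD('n)" for z :: "real ^ 'n"
proof -
  have "norm (rvec (floor_vec z) - z) \<le> (\<Sum>j\<in>UNIV. \<bar>(rvec (floor_vec z) - z) $ j\<bar>)"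
    by (rule norm_le_l1_cart)
  also have "\<dots> \<le> (\<Sum>j\<in>(UNIV :: 'n set). 1)"
    by (intro sum_mono) (simp add: rvec_def floor_vec_def, linarith)
  finally show ?thesis by simp
qed

lemma near_scaled_floor:
  fixes x :: "real ^ 'n"
  assumes "0 < k"
  shows "norm (rvec (floor_vec (real k *\<^sub>R x)) /\<^sub>R real k - x) \<le> real CARD('n) / real k"
proof -
  let ?J = "rvec (floor_vec (real k *\<^sub>R x))"
  have "?J /\<^sub>R real k - x = (?J - real k *\<^sub>R x) /\<^sub>R real k" using assms by (simp add: scaleR_diff_right)
  then have "norm (?J /\<^sub>R real k - x) = norm (?J - real k *\<^sub>R x) / real k" by (simp add: divide_inverse mult.commute)
  also have "\<dots> \<le> real CARD('n) / real k" by (intro divide_right_mono norm_floor_vec) simp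
  finally show ?thesis .
qed

lemma scaled_floor_tendsto:
  "(\<lambda>k. rvec (floor_vec (real k *\<^sub>R x)) /\<^sub>R real k) \<longlonglongrightarrow> x" for x :: "real ^ 'n"
proof (rule LIM_zero_cancel, rule Lim_null_comparison)
  show "\<forall>\<^sub>F k in sequentially. norm (rvec (floor_vec (real k *\<^sub>R x)) /\<^sub>R real k - x) \<le> real CARD('n) / real k"
    using eventually_gt_at_top[of 0] by eventually_elim (rule near_scaled_floor)
qed (rule lim_const_over_n)

lemma cube_measurable [measurable]: "{z. floor_vec z = I} \<in> sets borel"
  unfolding floor_vec_eq_iff by measurable

lemma emeasure_cube: "emeasure lborel {z :: real ^ 'n. floor_vec z = I} = 1"
proof (rule antisym)
  have 1: "(\<Prod>b\<in>Basis. ((rvec I + (\<chi> j. 1)) - rvec I) \<bullet> b) = (1 :: real)"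
    by (intro prod.neutral) (auto simp: Basis_vec_def inner_axis)
  have le: "rvec I \<bullet> b \<le> (rvec I + (\<chi> j. 1)) \<bullet> b" if "b \<in> Basis" for b :: "real ^ 'n"
    using that by (auto simp: Basis_vec_def inner_axis)
  have "emeasure lborel {z. floor_vec z = I} \<le> emeasure lborel (cbox (rvec I) (rvec I + (\<chi> j. 1)))"
    by (intro emeasure_mono) (auto simp: floor_vec_eq_iff mem_box_cart rvec_def less_imp_le)
  also have "\<dots> = 1" using 1 by (subst emeasure_lborel_cbox[OF le]) simp_all
  finally show "emeasure lborel {z :: real ^ 'n. floor_vec z = I} \<le> 1" .
  have "1 = emeasure lborel (box (rvec I) (rvec I + (\<chi> j. 1)))"
    using 1 by (subst emeasure_lborel_box[OF le]) simp_all
  also have "\<dots> \<le> emeasure lborel {z. floor_vec z = I}"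
    by (intro emeasure_mono) (auto simp: floor_vec_eq_iff mem_box_cart rvec_def less_imp_le)
  finally show "1 \<le> emeasure lborel {z :: real ^ 'n. floor_vec z = I}" .
qed

text \<open>
  A sum over lattice points is the integral of a step function whose pieces have volume one. This turns
  limits of lattice sums into limits of integrals over a fixed domain, where dominated convergence
  applies.
\<close>

lemma sum_eq_integral_of_tiling:
  fixes S :: "(real ^ 'n) set" and h :: "'a \<Rightarrow> real"
  assumes "finite A" and "\<And>I. I \<in> A \<Longrightarrow> {z\<in>S. r z = I} \<in> sets borel"
    and "\<And>I. I \<in> A \<Longrightarrow> emeasure lborel {z\<in>S. r z = I} = 1"
    and "\<And>I. I \<notin> A \<Longrightarrow> h I = 0"
  shows "(LINT z:S|lborel. h (r z)) = (\<Sum>I\<in>A. h I)"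
    and "set_integrable lborel S (\<lambda>z. h (r z))"
proof -
  have eq: "indicator S z *\<^sub>R h (r z) = (\<Sum>I\<in>A. h I * indicator {z\<in>S. r z = I} z)" for z
  proof (cases "z \<in> S \<and> r z \<in> A")
    case True
    then have "(\<Sum>I\<in>A. h I * indicator {z\<in>S. r z = I} z) = (\<Sum>I\<in>A. if I = r z then h I else 0)"
      by (intro sum.cong) (auto simp: indicator_def)
    then show ?thesis using True assms(1) by simp
  next
    case False
    then have "(\<Sum>I\<in>A. h I * indicator {z\<in>S. r z = I} z) = 0"
      by (intro sum.neutral) (auto simp: indicator_def)
    then show ?thesis using False assms(4) by (auto simp: indicator_def)
  qed
  have int: "integrable lborel (\<lambda>z. h I * indicator {z\<in>S. r z = I} z)" if "I \<in> A" for I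
    using assms(2,3)[OF that] by (intro integrable_mult_right integrable_real_indicator) auto
  show "set_integrable lborel S (\<lambda>z. h (r z))"
    unfolding set_integrable_def eq using int by (intro Bochner_Integration.integrable_sum)
  have m: "measure lborel {z\<in>S. r z = I} = 1" if "I \<in> A" for I
    using assms(3)[OF that] by (simp add: measure_def)
  show "(LINT z:S|lborel. h (r z)) = (\<Sum>I\<in>A. h I)"
    unfolding set_lebesgue_integral_def eq
    using int by (subst Bochner_Integration.integral_sum) (auto simp: m)
qed

lemma sum_eq_integral_floor:
  assumes "finite A" "\<And>I. I \<notin> A \<Longrightarrow> h I = 0"
  shows "(LINT z|lborel. h (floor_vec z)) = (\<Sum>I\<in>A. (h I :: real))"
    and "integrable lborel (\<lambda>z. h (floor_vec z))"
proof -
  have *: "{z \<in> UNIV. floor_vec z = I} \<in> sets borel" "emeasure lborel {z :: real ^ 'n \<in> UNIV. floor_vec z = I} = 1" for I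
    using cube_measurable emeasure_cube by auto
  show "(LINT z|lborel. h (floor_vec z)) = (\<Sum>I\<in>A. (h I :: real))"
    and "integrable lborel (\<lambda>z. h (floor_vec z))"
    using sum_eq_integral_of_tiling[where S = UNIV and r = floor_vec, OF assms(1) * assms(2)]
    by (simp_all add: set_lebesgue_integral_def set_integrable_def)
qed

lemma emeasure_translate: "A \<in> sets borel \<Longrightarrow> emeasure lborel {z. z - x \<in> A} = emeasure lborel A"
  for x :: "'a::euclidean_space"
proof -
  assume A: "A \<in> sets borel"
  have "emeasure lborel A = emeasure (distr lborel borel ((+) (-x))) A"
    by (simp add: lborel_distr_plus)
  also have "\<dots> = emeasure lborel {z. z - x \<in> A}"
    using A by (subst emeasure_distr) (auto simp: vimage_def)
  finally show ?thesis ..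
qed

definition layer_round :: "int ^ 'n \<Rightarrow> int ^ 'n \<Rightarrow> int \<Rightarrow> real ^ 'n \<Rightarrow> int ^ 'n" where
  "layer_round ell I0 j z = floor_vec z - (pairing ell (floor_vec z) - j) *s I0"

text \<open>
  The lattice points of one layer \<open>ell = j\<close> are reached from all cubes of the tiling by shifting
  along \<open>I0\<close>; cut to a slab of lattice width one, the shifted cubes reassemble to a whole cube.
\<close>

lemma emeasure_layer_tile:
  fixes a :: real
  assumes I0: "pairing ell I0 = 1" and I: "pairing ell I = j"
  defines "T \<equiv> {z \<in> {z. a \<le> rvec ell \<bullet> z \<and> rvec ell \<bullet> z < a + 1}.
     layer_round ell I0 j z = I}"
  shows "T \<in> sets borel" "emeasure lborel T = 1"
proof -
  define T' where "T' i = {z. a - real_of_int i \<le> rvec ell \<bullet> z \<and> rvec ell \<bullet> z < a - real_of_int i + 1 \<and> floor_vec z = I}" for i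
  define X where "X i = {z. a \<le> rvec ell \<bullet> z \<and> rvec ell \<bullet> z < a + 1 \<and> floor_vec z = I + i *s I0}" for i
  have [measurable]: "X i \<in> sets borel" "T' i \<in> sets borel" for i
    unfolding X_def T'_def floor_vec_eq_iff by measurable
  have T: "T = (\<Union>i. X i)"
  proof (rule set_eqI)
    fix z
    show "z \<in> T \<longleftrightarrow> z \<in> (\<Union>i. X i)"
    proof
      assume "z \<in> T"
      then have "z \<in> X (pairing ell (floor_vec z) - j)" by (auto simp: T_def X_def layer_round_def)
      then show "z \<in> (\<Union>i. X i)" by blast
    next
      assume "z \<in> (\<Union>i. X i)"
      then obtain i where z: "z \<in> X i" by blast
      then have "pairing ell (floor_vec z) = j + i" by (simp add: X_def pairing_add pairing_scale I I0)
      then show "z \<in> T" using z by (simp add: T_def X_def layer_round_def)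
    qed
  qed
  show "T \<in> sets borel" unfolding T by measurable
  have tr: "emeasure lborel (X i) = emeasure lborel (T' i)" for i
  proof -
    have "X i = {z. z - rvec (i *s I0) \<in> T' i}"
    proof (rule set_eqI)
      fix z
      have "floor_vec (z - rvec (i *s I0)) = floor_vec z - i *s I0"
        using floor_vec_add[of z "- (i *s I0)"] by (simp add: rvec_minus)
      moreover have "rvec ell \<bullet> rvec (i *s I0) = real_of_int i"
        by (simp add: rvec_inner_pairing pairing_scale I0)
      ultimately show "z \<in> X i \<longleftrightarrow> z \<in> {z. z - rvec (i *s I0) \<in> T' i}"
        by (auto simp: X_def T'_def inner_diff_right)
    qed
    then show ?thesis by (simp add: emeasure_translate)
  qed
  have T'un: "(\<Union>i. T' i) = {z. floor_vec z = I}"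
  proof (intro set_eqI iffI)
    fix z assume "z \<in> {z. floor_vec z = I}"
    then have "z \<in> T' (\<lceil>a - rvec ell \<bullet> z\<rceil>)" unfolding T'_def by simp linarith
    then show "z \<in> (\<Union>i. T' i)" by blast
  qed (auto simp: T'_def)
  have disX: "disjoint_family X"
  proof (unfold disjoint_family_on_def, intro ballI impI, rule ccontr)
    fix i i' assume "i \<noteq> i'" "X i \<inter> X i' \<noteq> {}"
    then obtain z where "z \<in> X i" "z \<in> X i'" by blast
    then have "pairing ell (I + i *s I0) = pairing ell (I + i' *s I0)" by (simp add: X_def)
    with \<open>i \<noteq> i'\<close> show False by (simp add: pairing_add pairing_scale I0)
  qed
  have disT': "disjoint_family T'"
  proof (unfold disjoint_family_on_def, intro ballI impI, rule ccontr)
    fix i i' assume "i \<noteq> i'" "T' i \<inter> T' i' \<noteq> {}"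
    then obtain z where z: "z \<in> T' i" "z \<in> T' i'" by blast
    then have "real_of_int i < real_of_int i' + 1" "real_of_int i' < real_of_int i + 1"
      unfolding T'_def by simp_all
    with \<open>i \<noteq> i'\<close> show False by linarith
  qed
  have "emeasure lborel T = (\<integral>\<^sup>+i. emeasure lborel (X i) \<partial>count_space UNIV)"
    unfolding T by (rule emeasure_UN_countable) (auto simp: disX)
  also have "\<dots> = (\<integral>\<^sup>+i. emeasure lborel (T' i) \<partial>count_space UNIV)" by (simp add: tr)
  also have "\<dots> = emeasure lborel (\<Union>i. T' i)"
    by (rule emeasure_UN_countable[symmetric]) (auto simp: disT')
  also have "\<dots> = 1" unfolding T'un by (rule emeasure_cube)
  finally show "emeasure lborel T = 1" .
qed

lemma lborel_integral_translate:
  fixes H :: "'a::euclidean_space \<Rightarrow> real"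
  assumes H: "integrable lborel H"
  shows "(LINT z|lborel. H (z - t)) = (LINT z|lborel. H z)" "integrable lborel (\<lambda>z. H (z - t))"
proof -
  have m [measurable]: "H \<in> borel_measurable borel" using borel_measurable_integrable[OF H] by simp
  have "(LINT z|lborel. H z) = (LINT z|distr lborel borel ((+) (- t)). H z)"
    by (simp add: lborel_distr_plus)
  then show "(LINT z|lborel. H (z - t)) = (LINT z|lborel. H z)"
    by (simp add: integral_distr)
  have "integrable (distr lborel borel ((+) (- t))) H" using H by (simp add: lborel_distr_plus)
  then show "integrable lborel (\<lambda>z. H (z - t))"
    by (subst (asm) integrable_distr_eq) simp_all
qed

lemma lborel_integral_scale:
  fixes H :: "'a::euclidean_space \<Rightarrow> real"
  assumes [measurable]: "H \<in> borel_measurable borel" and c: "0 < c"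
  shows "(LINT z|lborel. H z) = c ^ DIM('a) * (LINT x|lborel. H (c *\<^sub>R x))"
proof -
  have "(LINT z|lborel. H z) = (LINT z|density (distr lborel borel (\<lambda>x. 0 + c *\<^sub>R x)) (\<lambda>_. ennreal (\<bar>c\<bar> ^ DIM('a))). H z)"
    using c by (subst lborel_affine[of c 0]) (simp_all add: ennreal_power)
  also have "\<dots> = (LINT z|distr lborel borel (\<lambda>x. 0 + c *\<^sub>R x). c ^ DIM('a) * H z)"
    using c by (subst integral_density) auto
  also have "\<dots> = c ^ DIM('a) * (LINT x|lborel. H (c *\<^sub>R x))"
    by (subst integral_distr) auto
  finally show ?thesis .
qed

text \<open>
  Adding up \<open>M\<close> translates of the slab of lattice width one along the direction \<open>e\<close> replaces the
  stretching of a thin slab, so that only translations and dilations of Lebesgue measure occur.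
\<close>

lemma layer_sum_eq_integral:
  fixes a :: real and M :: nat and h :: "int ^ 'n \<Rightarrow> real"
  assumes I0: "pairing ell I0 = 1" and e: "rvec ell \<bullet> e = 1"
    and A: "finite A" "\<And>I. I \<in> A \<Longrightarrow> pairing ell I = j" "\<And>I. I \<notin> A \<Longrightarrow> h I = 0"
  defines "H z \<equiv> indicator {z. a \<le> rvec ell \<bullet> z \<and> rvec ell \<bullet> z < a + real M} z
      * h (layer_round ell I0 j (z - real_of_int \<lfloor>rvec ell \<bullet> z - a\<rfloor> *\<^sub>R e))"
  shows "integrable lborel H" "(LINT z|lborel. H z) = real M * (\<Sum>I\<in>A. h I)"
proof -
  let ?S = "{z. a \<le> rvec ell \<bullet> z \<and> rvec ell \<bullet> z < a + 1}"
  define H0 where "H0 z = indicator ?S z * h (layer_round ell I0 j z)" for z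
  note tile = emeasure_layer_tile[OF I0, where a = a and j = j]
  have H0: "integrable lborel H0" "(LINT z|lborel. H0 z) = (\<Sum>I\<in>A. h I)"
    using sum_eq_integral_of_tiling[where S = ?S and r = "layer_round ell I0 j", OF A(1) tile[OF A(2)] A(3)]
    by (simp_all add: set_lebesgue_integral_def set_integrable_def H0_def[abs_def])
  have H: "H z = (\<Sum>i<M. H0 (z - real i *\<^sub>R e))" for z
  proof -
    have mem: "z - real i *\<^sub>R e \<in> ?S \<longleftrightarrow> \<lfloor>rvec ell \<bullet> z - a\<rfloor> = int i" for i
      by (auto simp: inner_diff_right e floor_eq_iff algebra_simps)
    show ?thesis
    proof (cases "a \<le> rvec ell \<bullet> z \<and> rvec ell \<bullet> z < a + real M")
      case True
      define i where "i = nat \<lfloor>rvec ell \<bullet> z - a\<rfloor>"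
      have i: "\<lfloor>rvec ell \<bullet> z - a\<rfloor> = int i" "i < M"
        using True by (simp_all add: i_def) linarith
      have "(\<Sum>i'<M. H0 (z - real i' *\<^sub>R e)) = (\<Sum>i'<M. if i' = i then H0 (z - real i' *\<^sub>R e) else 0)"
        using mem i by (intro sum.cong) (auto simp: H0_def indicator_def)
      also have "\<dots> = H0 (z - real i *\<^sub>R e)" using i by simp
      also have "\<dots> = H z" using True i mem[of i] by (simp add: H_def H0_def indicator_def)
      finally show ?thesis ..
    next
      case False
      have "H0 (z - real i *\<^sub>R e) = 0" if "i < M" for i
      proof -
        have "\<not> \<lfloor>rvec ell \<bullet> z - a\<rfloor> = int i" using False that by (auto simp: floor_eq_iff)
        then show ?thesis using mem[of i] by (simp add: H0_def indicator_def)
      qed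
      then show ?thesis using False by (simp add: H_def indicator_def)
    qed
  qed
  note tr = lborel_integral_translate[OF H0(1)]
  show "integrable lborel H"
    unfolding H[abs_def] by (intro Bochner_Integration.integrable_sum tr)
  show "(LINT z|lborel. H z) = real M * (\<Sum>I\<in>A. h I)"
    unfolding H[abs_def] by (subst Bochner_Integration.integral_sum) (simp_all add: tr H0(2))
qed

lemma layer_round_near:
  fixes z :: "real ^ 'n"
  shows "norm (rvec (layer_round ell I0 j z) - z)
    \<le> real CARD('n) + (norm (rvec ell) * real CARD('n) + \<bar>rvec ell \<bullet> z - real_of_int j\<bar>) * norm (rvec I0)"
proof -
  define d where "d = pairing ell (floor_vec z) - j"
  have "real_of_int d = rvec ell \<bullet> (rvec (floor_vec z) - z) + (rvec ell \<bullet> z - real_of_int j)"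
    by (simp add: d_def rvec_inner_pairing[symmetric] inner_diff_right)
  then have "\<bar>real_of_int d\<bar> \<le> \<bar>rvec ell \<bullet> (rvec (floor_vec z) - z)\<bar> + \<bar>rvec ell \<bullet> z - real_of_int j\<bar>"
    by linarith
  also have "\<bar>rvec ell \<bullet> (rvec (floor_vec z) - z)\<bar> \<le> norm (rvec ell) * norm (rvec (floor_vec z) - z)"
    by (rule Cauchy_Schwarz_ineq2)
  also have "\<dots> \<le> norm (rvec ell) * real CARD('n)"
    by (intro mult_left_mono norm_floor_vec) simp
  finally have d: "\<bar>real_of_int d\<bar> \<le> norm (rvec ell) * real CARD('n) + \<bar>rvec ell \<bullet> z - real_of_int j\<bar>" by simp
  have "rvec (layer_round ell I0 j z) - z = (rvec (floor_vec z) - z) - real_of_int d *\<^sub>R rvec I0"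
    by (simp add: layer_round_def rvec_diff rvec_scale d_def scaleR_diff_left)
  then have "norm (rvec (layer_round ell I0 j z) - z) \<le> norm (rvec (floor_vec z) - z) + \<bar>real_of_int d\<bar> * norm (rvec I0)"
    by (metis norm_scaleR norm_triangle_ineq4)
  also have "\<dots> \<le> real CARD('n) + (norm (rvec ell) * real CARD('n) + \<bar>rvec ell \<bullet> z - real_of_int j\<bar>) * norm (rvec I0)"
    by (intro add_mono norm_floor_vec mult_right_mono d) simp
  finally show ?thesis .
qed

lemma integral_over_cube:
  fixes H :: "real ^ 'n \<Rightarrow> real"
  assumes H: "integrable lborel H" and N: "finite N" "\<And>z. H z \<noteq> 0 \<Longrightarrow> floor_vec z \<in> N"
  shows "(LINT z|lborel. H z) = (LINT y|lborel. indicator {y. floor_vec y = 0} y * (\<Sum>I\<in>N. H (y + rvec I)))"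
    and "integrable lborel (\<lambda>y. indicator {y. floor_vec y = 0} y * (\<Sum>I\<in>N. H (y + rvec I)))"
proof -
  have eq: "H z = (\<Sum>I\<in>N. indicator {z. floor_vec z = I} z * H z)" for z
  proof (cases "H z = 0")
    case False
    have "(\<Sum>I\<in>N. indicator {z. floor_vec z = I} z * H z) = (\<Sum>I\<in>N. if I = floor_vec z then H z else 0)"
      by (intro sum.cong) (auto simp: indicator_def)
    then show ?thesis using N False by simp
  qed simp
  have int: "integrable lborel (\<lambda>z. indicator {z. floor_vec z = I} z * H z)" for I
    using integrable_real_mult_indicator[OF _ H, of "{z. floor_vec z = I}"] cube_measurable by (simp add: mult.commute)
  have tr: "indicator {z. floor_vec z = I} (z - rvec (- I)) * H (z - rvec (- I))
      = indicator {y. floor_vec y = 0} z * H (z + rvec I)" for z I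
    by (simp add: rvec_minus floor_vec_add indicator_def)
  have t: "(LINT y|lborel. indicator {y. floor_vec y = 0} y * H (y + rvec I))
        = (LINT z|lborel. indicator {z. floor_vec z = I} z * H z)"
      "integrable lborel (\<lambda>y. indicator {y. floor_vec y = 0} y * H (y + rvec I))" for I
    using lborel_integral_translate[OF int[of I], of "rvec (- I)"] unfolding tr by simp_all
  have "(LINT z|lborel. H z) = (\<Sum>I\<in>N. LINT z|lborel. indicator {z. floor_vec z = I} z * H z)"
    by (subst eq) (simp add: int)
  also have "\<dots> = (\<Sum>I\<in>N. LINT y|lborel. indicator {y. floor_vec y = 0} y * H (y + rvec I))"
    using t(1) by simp
  also have "\<dots> = (LINT y|lborel. (\<Sum>I\<in>N. indicator {y. floor_vec y = 0} y * H (y + rvec I)))"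
    by (rule Bochner_Integration.integral_sum[symmetric]) (rule t)
  finally show "(LINT z|lborel. H z) = (LINT y|lborel. indicator {y. floor_vec y = 0} y * (\<Sum>I\<in>N. H (y + rvec I)))"
    by (simp add: sum_distrib_left)
  show "integrable lborel (\<lambda>y. indicator {y. floor_vec y = 0} y * (\<Sum>I\<in>N. H (y + rvec I)))"
    unfolding sum_distrib_left by (intro Bochner_Integration.integrable_sum t)
qed

lemma lborel_integral_reflect:
  fixes H :: "'a::euclidean_space \<Rightarrow> real"
  assumes H: "integrable lborel H"
  shows "(LINT z|lborel. H (- z)) = (LINT z|lborel. H z)" "integrable lborel (\<lambda>z. H (- z))"
proof -
  have m [measurable]: "H \<in> borel_measurable borel" using borel_measurable_integrable[OF H] by simp
  have l: "(lborel :: 'a measure) = distr lborel borel uminus"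
    using lborel_affine[of "-1" "0 :: 'a"] by (simp add: density_1)
  have "(LINT z|lborel. H z) = (LINT z|distr lborel borel uminus. H z)"
    by (subst l) simp
  then show "(LINT z|lborel. H (- z)) = (LINT z|lborel. H z)"
    by (simp add: integral_distr)
  have "integrable (distr lborel borel uminus) H" using H l by simp
  then show "integrable lborel (\<lambda>z. H (- z))"
    by (subst (asm) integrable_distr_eq) simp_all
qed

section \<open>Lattice points near a facet\<close>

definition facet_integral :: "(int ^ 'n) set \<Rightarrow> int ^ 'n \<Rightarrow> (real ^ 'n \<Rightarrow> real) \<Rightarrow> real" where
  "facet_integral L ell f = (LINT x:facet_at L ell|hyperplane_lebesgue (outer_unit_normal ell) (1 / norm (rvec ell)).
     f x * (outer_unit_normal ell \<bullet> x))"

lemma AE_not_on_hyperplane: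
  fixes a :: "'a::euclidean_space"
  assumes "a \<noteq> 0"
  shows "AE x in lborel. a \<bullet> x \<noteq> b"
proof -
  have "{x. a \<bullet> x = b} \<in> null_sets lebesgue"
    using negligible_hyperplane[of a b] assms by (simp add: negligible_iff_null_sets)
  then have "AE x in lebesgue. a \<bullet> x \<noteq> b" by (rule AE_I') auto
  then show ?thesis by (simp add: AE_completion_iff)
qed

lemma closed_facet_at: "closed (facet_at L ell)"
proof -
  have "facet_at L ell = moment_polytope L \<inter> {x. rvec ell \<bullet> x = 1}"
    by (auto simp: facet_at_def)
  then show ?thesis by (simp add: closed_Int closed_moment_polytope closed_hyperplane)
qed

text \<open>
  The density \<open>\<langle>n,x\<rangle>\<close> is \<open>1/|ell|\<close> on the facet. The projection along the unit normal moves points along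
  the multiple of \<open>ell\<close> on which \<open>ell\<close> takes the value \<open>1\<close>.
\<close>

lemma facet_integral_eq:
  assumes f: "continuous_on UNIV f" and ell: "rvec ell \<noteq> 0"
  defines "r \<equiv> norm (rvec ell)"
  defines "p x \<equiv> x - (rvec ell \<bullet> x - 1) *\<^sub>R (rvec ell /\<^sub>R r\<^sup>2)"
  shows "facet_integral L ell f = (1 / r) *
    (LINT x|lborel. indicator {x. 1 \<le> rvec ell \<bullet> x \<and> rvec ell \<bullet> x \<le> 1 + r} x *
        (indicator (facet_at L ell) (p x) * f (p x)))"
proof -
  define \<nu> where "\<nu> = outer_unit_normal ell"
  have r: "r > 0" using ell by (simp add: r_def)
  have \<nu>: "\<nu> = rvec ell /\<^sub>R r" by (simp add: \<nu>_def outer_unit_normal_def r_def)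
  let ?S = "{x. 1 / r \<le> \<nu> \<bullet> x \<and> \<nu> \<bullet> x \<le> 1 / r + 1}"
  have S: "?S = {x. 1 \<le> rvec ell \<bullet> x \<and> rvec ell \<bullet> x \<le> 1 + r}"
    using r by (auto simp: \<nu> field_simps)
  have p: "x - (\<nu> \<bullet> x - 1 / r) *\<^sub>R \<nu> = p x" for x
    using r by (simp add: p_def \<nu> power2_eq_square field_simps)
  have [measurable]: "f \<in> borel_measurable borel" using f by (rule borel_measurable_continuous_onI)
  have [measurable]: "facet_at L ell \<in> sets borel" using closed_facet_at by (rule borel_closed)
  have [measurable]: "p \<in> borel \<rightarrow>\<^sub>M borel" unfolding p_def by measurable
  have [measurable]: "?S \<in> sets borel" by measurable
  have "facet_integral L ell f = (LINT x|distr (restrict_space lborel ?S) borel p.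
      indicator (facet_at L ell) x *\<^sub>R (f x * (\<nu> \<bullet> x)))"
    unfolding facet_integral_def hyperplane_lebesgue_def set_lebesgue_integral_def \<nu>_def[symmetric] r_def[symmetric] p ..
  also have "\<dots> = (LINT x|restrict_space lborel ?S. indicator (facet_at L ell) (p x) *\<^sub>R (f (p x) * (\<nu> \<bullet> p x)))"
    by (rule integral_distr) (auto intro: measurable_restrict_space1)
  also have "\<dots> = (LINT x|lborel. indicator ?S x *\<^sub>R (indicator (facet_at L ell) (p x) *\<^sub>R (f (p x) * (\<nu> \<bullet> p x))))"
    by (subst integral_restrict_space) auto
  also have "\<dots> = (LINT x|lborel. (1 / r) * (indicator ?S x * (indicator (facet_at L ell) (p x) * f (p x))))"
    by (intro Bochner_Integration.integral_cong refl)
      (auto simp: indicator_def facet_at_def \<nu> divide_inverse)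
  also have "\<dots> = (1 / r) * (LINT x|lborel. indicator ?S x * (indicator (facet_at L ell) (p x) * f (p x)))"
    by simp
  finally show ?thesis unfolding S .
qed

lemma pairing_layer_round: "pairing ell I0 = 1 \<Longrightarrow> pairing ell (layer_round ell I0 j z) = j"
  by (simp add: layer_round_def pairing_diff pairing_scale)

definition lattice_points :: "(int ^ 'n) set \<Rightarrow> nat \<Rightarrow> (int ^ 'n \<Rightarrow> int) \<Rightarrow> (int ^ 'n) set" where
  "lattice_points L k b = {I. \<forall>ell\<in>L. pairing ell I \<le> int k + b ell}"

definition layer :: "(int ^ 'n) set \<Rightarrow> int ^ 'n \<Rightarrow> nat \<Rightarrow> (int ^ 'n \<Rightarrow> int) \<Rightarrow> int \<Rightarrow> (int ^ 'n) set" where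
  "layer L ell k b c = {I. pairing ell I = int k + c \<and> (\<forall>ell'\<in>L - {ell}. pairing ell' I \<le> int k + b ell')}"

text \<open>
  A bounded polytope whose facets lie in the hyperplanes \<open>ell = 1\<close>; since \<open>ell\<close> takes the value \<open>1\<close> on the
  lattice, all of them have lattice distance one from the origin.
\<close>

locale lattice_polytope =
  fixes L :: "(int ^ 'n) set"
  assumes fin: "finite L" and bnd: "bounded (moment_polytope L)"
    and prim: "\<And>ell. ell \<in> L \<Longrightarrow> \<exists>I0. pairing ell I0 = 1"
begin

lemma rvec_nonzero: "ell \<in> L \<Longrightarrow> rvec ell \<noteq> 0"
  using prim[of ell] rvec_inner_pairing[of ell] by (metis inner_zero_left of_int_1 zero_neq_one)

definition radius :: real where
  "radius = (SOME \<rho>. 0 < \<rho> \<and> (\<forall>x\<in>moment_polytope L. norm x \<le> \<rho>))"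

lemma radius: "0 < radius" "x \<in> moment_polytope L \<Longrightarrow> norm x \<le> radius"
proof -
  have "\<exists>\<rho>. 0 < \<rho> \<and> (\<forall>x\<in>moment_polytope L. norm x \<le> \<rho>)" using bnd by (auto simp: bounded_pos)
  from someI_ex[OF this] show "0 < radius" "x \<in> moment_polytope L \<Longrightarrow> norm x \<le> radius"
    by (auto simp: radius_def)
qed

lemma norm_le_of_forms:
  assumes "0 < t" "\<And>ell. ell \<in> L \<Longrightarrow> rvec ell \<bullet> x \<le> t"
  shows "norm x \<le> t * radius"
proof -
  have "x /\<^sub>R t \<in> moment_polytope L"
    using assms by (simp add: moment_polytope_def field_simps)
  then have "norm (x /\<^sub>R t) \<le> radius" by (rule radius)
  then show ?thesis using assms(1) by (simp add: field_simps)
qed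

lemma norm_lattice_points:
  assumes "I \<in> lattice_points L k b" "0 < k" "\<And>ell. ell \<in> L \<Longrightarrow> b ell \<le> int B"
  shows "norm (rvec I /\<^sub>R real k) \<le> (1 + real B) * radius"
proof (rule norm_le_of_forms)
  fix ell assume ell: "ell \<in> L"
  then have "pairing ell I \<le> int k + int B" using assms(1) assms(3)[OF ell] by (force simp: lattice_points_def)
  then have "rvec ell \<bullet> rvec I \<le> real k + real B" by (simp add: rvec_inner_pairing)
  also have "\<dots> \<le> real k * (1 + real B)"
  proof -
    have "real B * 1 \<le> real B * real k" using assms(2) by (intro mult_left_mono) auto
    then show ?thesis by (simp add: algebra_simps)
  qed
  finally show "rvec ell \<bullet> (rvec I /\<^sub>R real k) \<le> 1 + real B" using assms(2) by (simp add: field_simps)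
qed simp

lemma finite_lattice_points_dilated: "finite (lattice_points L k b)"
proof -
  define t where "t = real k + (\<Sum>ell\<in>L. real_of_int \<bar>b ell\<bar>) + 1"
  have "0 \<le> (\<Sum>ell\<in>L. real_of_int \<bar>b ell\<bar>)" by (intro sum_nonneg) auto
  then have t: "0 < t" unfolding t_def by linarith
  have "lattice_points L k b \<subseteq> {I. rvec I \<in> cball 0 (t * radius)}"
  proof
    fix I assume I: "I \<in> lattice_points L k b"
    have "norm (rvec I) \<le> t * radius"
    proof (rule norm_le_of_forms[OF t])
      fix ell assume ell: "ell \<in> L"
      then have "real_of_int \<bar>b ell\<bar> \<le> (\<Sum>ell\<in>L. real_of_int \<bar>b ell\<bar>)" using fin by (intro member_le_sum) auto
      moreover have "pairing ell I \<le> int k + b ell" using I ell by (simp add: lattice_points_def)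
      then have "real_of_int (pairing ell I) \<le> real_of_int (int k + b ell)" by (simp only: of_int_le_iff)
      ultimately show "rvec ell \<bullet> rvec I \<le> t" by (simp add: rvec_inner_pairing t_def)
    qed
    then show "I \<in> {I. rvec I \<in> cball 0 (t * radius)}" by simp
  qed
  then show ?thesis by (rule finite_subset) (rule finite_lattice_points[OF bounded_cball])
qed

lemma layer_subset: "layer L ell k b c \<subseteq> lattice_points L k (b(ell := c))"
  by (auto simp: layer_def lattice_points_def)

text \<open>
  Riemann sums over the lattice points of a hyperplane parallel to a facet. The region and the
  hyperplane may be moved by a bounded lattice distance, which tends to zero after rescaling.
\<close>

proposition layer_sum_limit:
  assumes ell: "ell \<in> L" and f: "continuous_on UNIV f"
  shows "(\<lambda>k. (\<Sum>I\<in>layer L ell k b c. f (rvec I /\<^sub>R real k)) / real k ^ (CARD('n) - 1))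
    \<longlonglongrightarrow> facet_integral L ell f"
proof -
  obtain I0 where I0: "pairing ell I0 = 1" using prim[OF ell] by auto
  define r where "r = norm (rvec ell)"
  have r: "0 < r" using rvec_nonzero[OF ell] by (simp add: r_def)
  define e where "e = rvec ell /\<^sub>R r\<^sup>2"
  have e: "rvec ell \<bullet> e = 1" using r by (simp add: e_def r_def power2_norm_eq_inner[symmetric])
  have norm_e: "norm e = 1 / r" using r by (simp add: e_def r_def power2_eq_square divide_inverse)
  define p where "p x = x - (rvec ell \<bullet> x - 1) *\<^sub>R e" for x
  have ell_p: "rvec ell \<bullet> p x = 1" for x by (simp add: p_def inner_diff_right e)
  define B where "B = nat (\<bar>c\<bar> + (\<Sum>ell'\<in>L. \<bar>b ell'\<bar>))"
  have B0: "0 \<le> (\<Sum>ell'\<in>L. \<bar>b ell'\<bar>)" by (intro sum_nonneg) auto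
  have B: "(b(ell := c)) ell' \<le> int B" if "ell' \<in> L" for ell'
  proof -
    have "\<bar>b ell'\<bar> \<le> (\<Sum>ell'\<in>L. \<bar>b ell'\<bar>)" using fin that by (intro member_le_sum) auto
    then show ?thesis using B0 unfolding B_def by (cases "ell' = ell") auto
  qed
  \<comment> \<open>\<open>M k\<close> slabs of lattice width \<open>1/k\<close> fill the slab of Euclidean width \<open>1\<close>, that is of lattice width \<open>r\<close>, in the limit\<close>
  define M where "M k = nat \<lfloor>real k * r\<rfloor>" for k :: nat
  define h where "h k I = (if I \<in> layer L ell k b c then f (rvec I /\<^sub>R real k) else 0)" for k I
  \<comment> \<open>\<open>y k x\<close> is a lattice point of the layer at bounded distance from \<open>k (p x)\<close>\<close>
  define y where "y k x = layer_round ell I0 (int k + c) (real k *\<^sub>R x - real_of_int \<lfloor>rvec ell \<bullet> (real k *\<^sub>R x) - real k\<rfloor> *\<^sub>R e)" for k x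
  define G where "G k x = indicator {z. real k \<le> rvec ell \<bullet> z \<and> rvec ell \<bullet> z < real k + real (M k)} (real k *\<^sub>R x) * h k (y k x)" for k x
  have M_le: "real (M k) \<le> real k * r" for k
    using r by (simp add: M_def)
  have Mlim: "(\<lambda>k. real (M k) / real k) \<longlonglongrightarrow> r"
  proof (rule tendsto_sandwich)
    show "(\<lambda>k. r - 1 / real k) \<longlonglongrightarrow> r"
      using tendsto_diff[OF tendsto_const lim_const_over_n, of r 1] by simp
    show "(\<lambda>k. r) \<longlonglongrightarrow> r" by simp
    show "\<forall>\<^sub>F k in sequentially. r - 1 / real k \<le> real (M k) / real k"
      using eventually_gt_at_top[of 0]
    proof eventually_elim
      case (elim k)
      have "real k * r - 1 \<le> real (M k)" unfolding M_def by linarith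
      then have "(real k * r - 1) / real k \<le> real (M k) / real k" by (rule divide_right_mono) simp
      then show ?case using elim by (simp add: diff_divide_distrib)
    qed
    show "\<forall>\<^sub>F k in sequentially. real (M k) / real k \<le> r"
      using eventually_gt_at_top[of 0]
    proof eventually_elim
      case (elim k)
      then show ?case using M_le[of k] by (simp add: field_simps)
    qed
  qed
  have finA: "finite (layer L ell k b c)" for k
    using layer_subset finite_lattice_points_dilated by (rule finite_subset)
  have sum_eq: "(\<Sum>I\<in>layer L ell k b c. f (rvec I /\<^sub>R real k)) * real (M k) = real k ^ CARD('n) * (LINT x|lborel. G k x)"
    and G_meas: "G k \<in> borel_measurable lborel" if k: "0 < k" for k
  proof -
    have A: "\<And>I. I \<in> layer L ell k b c \<Longrightarrow> pairing ell I = int k + c" "\<And>I. I \<notin> layer L ell k b c \<Longrightarrow> h k I = 0"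
      by (simp add: layer_def) (simp add: h_def)
    note L = layer_sum_eq_integral[OF I0 e finA[of k] A, where a = "real k" and M = "M k"]
    let ?H = "\<lambda>z. indicator {z. real k \<le> rvec ell \<bullet> z \<and> rvec ell \<bullet> z < real k + real (M k)} z *
      h k (layer_round ell I0 (int k + c) (z - real_of_int \<lfloor>rvec ell \<bullet> z - real k\<rfloor> *\<^sub>R e))"
    have H: "integrable lborel ?H" "(LINT z|lborel. ?H z) = real (M k) * (\<Sum>I\<in>layer L ell k b c. h k I)"
      using L by simp_all
    then have m [measurable]: "?H \<in> borel_measurable borel" using borel_measurable_integrable by fastforce
    have G: "G k = (\<lambda>x. ?H (real k *\<^sub>R x))" by (simp add: G_def y_def fun_eq_iff)
    show "(\<Sum>I\<in>layer L ell k b c. f (rvec I /\<^sub>R real k)) * real (M k) = real k ^ CARD('n) * (LINT x|lborel. G k x)"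
      using H(2) lborel_integral_scale[OF m, of "real k"] k unfolding G by (simp add: h_def mult.commute)
    show "G k \<in> borel_measurable lborel" 
      unfolding G by (rule measurable_compose[OF _ m]) measurable
  qed
  define C where "C = real CARD('n) + (norm (rvec ell) * real CARD('n) + (1 + \<bar>real_of_int c\<bar>)) * norm (rvec I0) + norm e"
  have C0: "0 \<le> C" by (simp add: C_def)
  have near: "norm (rvec (y k x) /\<^sub>R real k - p x) \<le> C / real k" if k: "0 < k" for k x
  proof -
    define i where "i = \<lfloor>rvec ell \<bullet> (real k *\<^sub>R x) - real k\<rfloor>"
    define z where "z = real k *\<^sub>R x - real_of_int i *\<^sub>R e"
    have i: "real_of_int i \<le> real k * (rvec ell \<bullet> x) - real k" "real k * (rvec ell \<bullet> x) - real k < real_of_int i + 1"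
      unfolding i_def by simp_all
    have "\<bar>rvec ell \<bullet> z - real_of_int (int k + c)\<bar> \<le> 1 + \<bar>real_of_int c\<bar>"
      using i by (simp add: z_def inner_diff_right e)
    then have "norm (rvec (y k x) - z) \<le> real CARD('n) + (norm (rvec ell) * real CARD('n) + (1 + \<bar>real_of_int c\<bar>)) * norm (rvec I0)"
      unfolding y_def i_def[symmetric] z_def[symmetric]
      by (intro order.trans[OF layer_round_near] add_mono mult_right_mono) auto
    moreover have "norm (z - real k *\<^sub>R p x) \<le> norm e"
    proof -
      have "z - real k *\<^sub>R p x = (real k * (rvec ell \<bullet> x) - real k - real_of_int i) *\<^sub>R e"
        by (simp add: z_def p_def algebra_simps)
      moreover have "\<bar>real k * (rvec ell \<bullet> x) - real k - real_of_int i\<bar> \<le> 1" using i by linarith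
      ultimately show ?thesis by (simp add: mult_left_le_one_le)
    qed
    ultimately have "norm (rvec (y k x) - real k *\<^sub>R p x) \<le> C"
      using norm_triangle_ineq[of "rvec (y k x) - z" "z - real k *\<^sub>R p x"] by (simp add: C_def)
    moreover have "rvec (y k x) /\<^sub>R real k - p x = (rvec (y k x) - real k *\<^sub>R p x) /\<^sub>R real k"
      using k by (simp add: scaleR_diff_right)
    then have "norm (rvec (y k x) /\<^sub>R real k - p x) = norm (rvec (y k x) - real k *\<^sub>R p x) / real k"
      by (simp add: divide_inverse mult.commute)
    ultimately show ?thesis by (simp add: divide_right_mono)
  qed
  have ylim: "(\<lambda>k. rvec (y k x) /\<^sub>R real k) \<longlonglongrightarrow> p x" for x
  proof (rule LIM_zero_cancel, rule Lim_null_comparison)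
    show "\<forall>\<^sub>F k in sequentially. norm (rvec (y k x) /\<^sub>R real k - p x) \<le> C / real k"
      using eventually_gt_at_top[of 0] by eventually_elim (rule near)
    show "(\<lambda>k. C / real k) \<longlonglongrightarrow> 0" by (rule lim_const_over_n)
  qed
  let ?S = "{x. 1 \<le> rvec ell \<bullet> x \<and> rvec ell \<bullet> x \<le> 1 + r}"
  define g where "g x = indicator ?S x * (indicator (facet_at L ell) (p x) * f (p x))" for x
  \<comment> \<open>the relative boundary of the facet is a null set: no other \<open>ell'\<close> is constantly \<open>1\<close> on the hyperplane\<close>
  have pos: "AE x in lborel. \<forall>ell'\<in>L - {ell}. rvec ell' \<bullet> p x \<noteq> 1"
  proof (rule AE_finite_allI)
    show "finite (L - {ell})" using fin by simp
    fix ell' assume ell': "ell' \<in> L - {ell}"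
    define a where "a = rvec ell' - (rvec ell' \<bullet> e) *\<^sub>R rvec ell"
    have pa: "rvec ell' \<bullet> p x = a \<bullet> x + rvec ell' \<bullet> e" for x
      by (simp add: p_def a_def inner_diff_right inner_diff_left algebra_simps)
    show "AE x in lborel. rvec ell' \<bullet> p x \<noteq> 1"
    proof (cases "a = 0")
      case False
      then show ?thesis using AE_not_on_hyperplane[of a "1 - rvec ell' \<bullet> e"] by (simp add: pa algebra_simps)
    next
      case True
      have "rvec ell' \<bullet> e \<noteq> 1"
      proof
        assume "rvec ell' \<bullet> e = 1"
        then have "rvec ell' = rvec ell" using True by (simp add: a_def)
        then show False using ell' by (simp add: rvec_def vec_eq_iff)
      qed
      then show ?thesis by (simp add: pa True)
    qed
  qed
  define \<rho> where "\<rho> = (1 + real B) * radius"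
  have "bounded (f ` cball 0 \<rho>)"
    by (intro compact_imp_bounded compact_continuous_image continuous_on_subset[OF f] compact_cball) auto
  then obtain m where m': "\<forall>x\<in>cball 0 \<rho>. \<bar>f x\<bar> \<le> m" by (auto simp: bounded_iff)
  then have m: "\<bar>f x\<bar> \<le> m" if "norm x \<le> \<rho>" for x using that by simp
  have m0: "0 \<le> m"
  proof -
    have "\<bar>f 0\<bar> \<le> m" using radius(1) by (intro m) (simp add: \<rho>_def)
    then show ?thesis by linarith
  qed
  have "(\<lambda>k. LINT x|lborel. G (Suc k) x) \<longlonglongrightarrow> (LINT x|lborel. g x)"
  proof (rule integral_dominated_convergence)
    let ?w = "\<lambda>x :: real ^ 'n. m * indicator (cball 0 (\<rho> + C + 1)) x"
    show "integrable lborel ?w"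
      by (intro integrable_mult_right integrable_real_indicator emeasure_bounded_finite) auto
    show "AE x in lborel. norm (G (Suc k) x) \<le> ?w x" for k
    proof (rule AE_I2)
      fix x
      show "norm (G (Suc k) x) \<le> ?w x"
      proof (cases "G (Suc k) x = 0")
        case True
        then show ?thesis using m0 by simp
      next
        case False
        let ?k = "Suc k"
        have in1: "real ?k \<le> real ?k * (rvec ell \<bullet> x)" "real ?k * (rvec ell \<bullet> x) < real ?k + real (M ?k)"
          and in2: "y ?k x \<in> layer L ell ?k b c"
          using False unfolding G_def h_def by (auto simp: indicator_def split: if_splits)
        have "rvec ell \<bullet> x \<ge> 1" using in1(1) by simp
        have "real ?k * (rvec ell \<bullet> x) \<le> real ?k * (1 + r)" using in1(2) M_le[of ?k] unfolding distrib_left mult_1_right by linarith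
        then have "rvec ell \<bullet> x \<le> 1 + r" by (rule mult_left_le_imp_le) simp
        have ny: "norm (rvec (y ?k x) /\<^sub>R real ?k) \<le> \<rho>"
          unfolding \<rho>_def
        proof (rule norm_lattice_points[where b = "b(ell := c)"])
          show "y ?k x \<in> lattice_points L ?k (b(ell := c))" using in2 layer_subset by blast
        qed (simp, rule B)
        have "C / real ?k \<le> C" using C0 by (simp add: field_simps)
        then have "norm (p x) \<le> \<rho> + C"
          using near[of ?k x] ny norm_triangle_ineq4[of "rvec (y ?k x) /\<^sub>R real ?k" "rvec (y ?k x) /\<^sub>R real ?k - p x"] by simp
        moreover have "norm (x - p x) \<le> 1"
        proof -
          have "norm (x - p x) = \<bar>rvec ell \<bullet> x - 1\<bar> * (1 / r)" by (simp add: p_def norm_e)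
          also have "\<dots> \<le> r * (1 / r)"
            using \<open>rvec ell \<bullet> x \<ge> 1\<close> \<open>rvec ell \<bullet> x \<le> 1 + r\<close> r by (intro mult_right_mono) auto
          finally show ?thesis using r by simp
        qed
        ultimately have "norm x \<le> \<rho> + C + 1" using norm_triangle_ineq[of "p x" "x - p x"] by simp
        moreover have "\<bar>G ?k x\<bar> \<le> m"
          using m[OF ny] m0 unfolding G_def h_def by (simp add: indicator_def)
        ultimately show ?thesis by simp
      qed
    qed
    show "G (Suc k) \<in> borel_measurable lborel" for k by (rule G_meas) simp
    show "g \<in> borel_measurable lborel"
    proof -
      have [measurable]: "f \<in> borel_measurable borel" using f by (rule borel_measurable_continuous_onI)
      have [measurable]: "facet_at L ell \<in> sets borel" using closed_facet_at by (rule borel_closed)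
      have [measurable]: "p \<in> borel \<rightarrow>\<^sub>M borel" unfolding p_def by measurable
      show ?thesis unfolding g_def by measurable
    qed
    have "AE x in lborel. (\<lambda>k. G k x) \<longlonglongrightarrow> g x"
      using AE_not_on_hyperplane[OF rvec_nonzero[OF ell], of "1 + r"] pos
    proof eventually_elim
      fix x assume x: "rvec ell \<bullet> x \<noteq> 1 + r" "\<forall>ell'\<in>L - {ell}. rvec ell' \<bullet> p x \<noteq> 1"
      show "(\<lambda>k. G k x) \<longlonglongrightarrow> g x"
      proof (cases "1 \<le> rvec ell \<bullet> x \<and> rvec ell \<bullet> x < 1 + r")
        case False
        then have "x \<notin> ?S" using x(1) by auto
        then have gx: "g x = 0" by (simp add: g_def)
        have G0: "G k x = 0" if "0 < k" for k
        proof -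
          have "\<not> (real k \<le> real k * (rvec ell \<bullet> x) \<and> real k * (rvec ell \<bullet> x) < real k + real (M k))"
          proof
            assume *: "real k \<le> real k * (rvec ell \<bullet> x) \<and> real k * (rvec ell \<bullet> x) < real k + real (M k)"
            then have "real k * (rvec ell \<bullet> x) < real k * (1 + r)" using M_le[of k] unfolding distrib_left mult_1_right by linarith
            then have "rvec ell \<bullet> x < 1 + r" using that by simp
            then show False using False * that by simp
          qed
          then show ?thesis by (simp add: G_def)
        qed
        have ev: "\<forall>\<^sub>F k in sequentially. 0 = G k x"
          using eventually_gt_at_top[of 0] by eventually_elim (simp add: G0)
        show ?thesis unfolding gx using ev by (rule Lim_transform_eventually[OF tendsto_const])
      next
        case True
        have inS: "x \<in> ?S" using True by auto
        have "\<forall>\<^sub>F k in sequentially. rvec ell \<bullet> x - 1 < real (M k) / real k"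
          using True by (intro order_tendstoD(1)[OF Mlim]) linarith
        then have in_slab: "\<forall>\<^sub>F k in sequentially. G k x = h k (y k x)"
          using eventually_gt_at_top[of 0]
        proof eventually_elim
          case (elim k)
          then have "real k * (rvec ell \<bullet> x) < real k + real (M k)" by (simp add: field_simps)
          moreover have "real k \<le> real k * (rvec ell \<bullet> x)" using True by (simp add: mult_le_cancel_left1)
          ultimately show ?case by (simp add: G_def indicator_def)
        qed
        have in_layer: "y k x \<in> layer L ell k b c \<longleftrightarrow>
            (\<forall>ell'\<in>L - {ell}. rvec ell' \<bullet> (rvec (y k x) /\<^sub>R real k) - real_of_int (b ell') / real k \<le> 1)"
          if "0 < k" for k
        proof -
          have "pairing ell' I \<le> int k + b ell' \<longleftrightarrow>
            rvec ell' \<bullet> (rvec I /\<^sub>R real k) - real_of_int (b ell') / real k \<le> 1" for ell' I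
          proof -
            have "pairing ell' I \<le> int k + b ell' \<longleftrightarrow> rvec ell' \<bullet> rvec I \<le> real k + real_of_int (b ell')"
              unfolding rvec_inner_pairing by linarith
            also have "\<dots> \<longleftrightarrow> rvec ell' \<bullet> (rvec I /\<^sub>R real k) - real_of_int (b ell') / real k \<le> 1"
              using that by (simp add: field_simps)
            finally show ?thesis .
          qed
          then show ?thesis by (simp add: layer_def y_def pairing_layer_round[OF I0])
        qed
        have dlim: "(\<lambda>k. rvec ell' \<bullet> (rvec (y k x) /\<^sub>R real k) - real_of_int (b ell') / real k) \<longlonglongrightarrow> rvec ell' \<bullet> p x" for ell'
          using tendsto_diff[OF tendsto_inner[OF tendsto_const ylim] lim_const_over_n, of "rvec ell'" x "real_of_int (b ell')"] by simp
        show ?thesis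
        proof (cases "\<forall>ell'\<in>L - {ell}. rvec ell' \<bullet> p x < 1")
          case inside: True
          have "rvec ell' \<bullet> p x \<le> 1" if "ell' \<in> L" for ell'
            using inside ell_p[of x] that by (cases "ell' = ell") (auto simp: less_imp_le)
          then have "p x \<in> facet_at L ell"
            using ell_p[of x] by (simp add: facet_at_def moment_polytope_def)
          then have gx: "g x = f (p x)" using inS by (simp add: g_def)
          have "\<forall>\<^sub>F k in sequentially. \<forall>ell'\<in>L - {ell}. rvec ell' \<bullet> (rvec (y k x) /\<^sub>R real k) - real_of_int (b ell') / real k < 1"
            using fin inside order_tendstoD(2)[OF dlim] by (intro eventually_ball_finite) auto
          then have ev: "\<forall>\<^sub>F k in sequentially. f (rvec (y k x) /\<^sub>R real k) = G k x"
            using in_slab eventually_gt_at_top[of 0]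
          proof eventually_elim
            case (elim k)
            then have "y k x \<in> layer L ell k b c" using in_layer[of k] less_imp_le by blast
            then show ?case using elim by (simp add: h_def)
          qed
          have "isCont f (p x)" using f by (simp add: continuous_on_eq_continuous_at)
          then have "(\<lambda>k. f (rvec (y k x) /\<^sub>R real k)) \<longlonglongrightarrow> f (p x)" using ylim by (rule isCont_tendsto_compose)
          then show ?thesis unfolding gx using ev by (rule Lim_transform_eventually)
        next
          case False
          then obtain ell' where ell': "ell' \<in> L - {ell}" "1 < rvec ell' \<bullet> p x" using x(2) by force
          then have "p x \<notin> facet_at L ell" by (force simp: facet_at_def moment_polytope_def)
          then have gx: "g x = 0" by (simp add: g_def)
          have "\<forall>\<^sub>F k in sequentially. 1 < rvec ell' \<bullet> (rvec (y k x) /\<^sub>R real k) - real_of_int (b ell') / real k"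
            using ell'(2) by (rule order_tendstoD(1)[OF dlim])
          then have ev: "\<forall>\<^sub>F k in sequentially. 0 = G k x"
            using in_slab eventually_gt_at_top[of 0]
          proof eventually_elim
            case (elim k)
            have "y k x \<notin> layer L ell k b c"
            proof
              assume "y k x \<in> layer L ell k b c"
              then have "rvec ell' \<bullet> (rvec (y k x) /\<^sub>R real k) - real_of_int (b ell') / real k \<le> 1"
                using in_layer[of k] elim ell'(1) by blast
              with elim show False by linarith
            qed
            then show ?case using elim by (simp add: h_def)
          qed
          show ?thesis unfolding gx using ev by (rule Lim_transform_eventually[OF tendsto_const])
        qed
      qed
    qed
    then show "AE x in lborel. (\<lambda>k. G (Suc k) x) \<longlonglongrightarrow> g x"
      by eventually_elim (rule LIMSEQ_Suc)
  qed
  then have Glim: "(\<lambda>k. LINT x|lborel. G k x) \<longlonglongrightarrow> (LINT x|lborel. g x)" by (rule LIMSEQ_imp_Suc)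
  have 1: "(\<lambda>k. (LINT x|lborel. G k x) / (real (M k) / real k)) \<longlonglongrightarrow> (LINT x|lborel. g x) / r"
    using Glim Mlim r by (intro tendsto_divide) auto
  have 2: "(LINT x|lborel. g x) / r = facet_integral L ell f"
    using facet_integral_eq[OF f rvec_nonzero[OF ell], of L]
    by (simp add: g_def[abs_def] p_def e_def r_def)
  have 3: "\<forall>\<^sub>F k in sequentially. (LINT x|lborel. G k x) / (real (M k) / real k)
      = (\<Sum>I\<in>layer L ell k b c. f (rvec I /\<^sub>R real k)) / real k ^ (CARD('n) - 1)"
    using order_tendstoD(1)[OF Mlim r] eventually_gt_at_top[of 0]
  proof eventually_elim
    case (elim k)
    have M0: "real (M k) \<noteq> 0" using elim by (cases "M k = 0") simp_all
    have pow: "real k ^ CARD('n) = real k * real k ^ (CARD('n) - 1)"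
      by (metis power_eq_if zero_less_card_finite less_irrefl)
    have "(LINT x|lborel. G k x) = (\<Sum>I\<in>layer L ell k b c. f (rvec I /\<^sub>R real k)) * real (M k) / real k ^ CARD('n)"
      using sum_eq[of k] elim by (simp add: field_simps)
    then show ?case using M0 elim unfolding pow by (simp add: field_simps)
  qed
  show ?thesis using Lim_transform_eventually[OF 1 3] unfolding 2 .
qed

end

section \<open>Functions with kinks\<close>

lemma derivative_remainder_limit:
  fixes f :: "real ^ 'n \<Rightarrow> real"
  assumes f: "(f has_derivative A) (at x)" and h: "\<And>k. 0 < k \<Longrightarrow> norm (h k) \<le> C / real k"
  shows "(\<lambda>k. real k * (f (x + h k) - f x - A (h k))) \<longlonglongrightarrow> 0"
proof (rule LIMSEQ_I)
  fix \<epsilon> :: real assume \<epsilon>: "0 < \<epsilon>"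
  define D where "D = \<bar>C\<bar> + 1"
  have D: "0 < D" by (simp add: D_def)
  obtain d where d: "0 < d" "\<And>y. norm (y - x) < d \<Longrightarrow> norm (f y - f x - A (y - x)) \<le> \<epsilon> / (2 * D) * norm (y - x)"
    using f \<epsilon> D unfolding has_derivative_at_alt by (metis divide_pos_pos mult_pos_pos zero_less_numeral)
  obtain k0 :: nat where k0: "D / d < real k0" using reals_Archimedean2 by blast
  show "\<exists>no. \<forall>k\<ge>no. norm (real k * (f (x + h k) - f x - A (h k)) - 0) < \<epsilon>"
  proof (intro exI allI impI)
    fix k assume k: "max 1 k0 \<le> k"
    then have kpos: "0 < k" by simp
    have hk: "norm (h k) \<le> D / real k"
      by (rule order.trans[OF h[OF kpos]]) (auto simp: D_def intro!: divide_right_mono)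
    have "D / d < real k" using k0 k by simp
    then have "D / real k < d" using d(1) kpos by (simp add: field_simps)
    then have "norm (f (x + h k) - f x - A (h k)) \<le> \<epsilon> / (2 * D) * norm (h k)"
      using d(2)[of "x + h k"] hk by simp
    also have "\<dots> \<le> \<epsilon> / (2 * D) * (D / real k)" using \<epsilon> D by (intro mult_left_mono hk) simp
    finally have "real k * norm (f (x + h k) - f x - A (h k)) \<le> real k * (\<epsilon> / (2 * D) * (D / real k))"
      by (rule mult_left_mono) simp
    also have "\<dots> = \<epsilon> / 2" using D kpos by simp
    finally show "norm (real k * (f (x + h k) - f x - A (h k)) - 0) < \<epsilon>" using \<epsilon> by (simp add: norm_mult abs_mult)
  qed
qed

text \<open>
  The Lipschitz bounds provide dominating constants, and differentiability almost everywhere gives the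
  pointwise limits. Piecewise linear functions have both properties.
\<close>

definition ae_smooth :: "(real ^ 'n \<Rightarrow> real) \<Rightarrow> bool" where
  "ae_smooth f \<longleftrightarrow> (\<forall>\<rho>. \<exists>C. \<forall>x y. norm x \<le> \<rho> \<longrightarrow> norm y \<le> \<rho> \<longrightarrow> \<bar>f x - f y\<bar> \<le> C * norm (x - y))
     \<and> (AE x in lborel. f differentiable (at x))"

lemma ae_smooth_lipschitz:
  assumes "ae_smooth f"
  obtains C where "0 \<le> C" "\<And>x y. norm x \<le> \<rho> \<Longrightarrow> norm y \<le> \<rho> \<Longrightarrow> \<bar>f x - f y\<bar> \<le> C * norm (x - y)"
proof -
  obtain C where C: "\<forall>x y. norm x \<le> \<rho> \<longrightarrow> norm y \<le> \<rho> \<longrightarrow> \<bar>f x - f y\<bar> \<le> C * norm (x - y)"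
    using assms unfolding ae_smooth_def by blast
  show thesis
  proof (rule that[of "\<bar>C\<bar>"])
    fix x y :: "real ^ 'a" assume "norm x \<le> \<rho>" "norm y \<le> \<rho>"
    then have "\<bar>f x - f y\<bar> \<le> C * norm (x - y)" using C by blast
    also have "\<dots> \<le> \<bar>C\<bar> * norm (x - y)" by (intro mult_right_mono) auto
    finally show "\<bar>f x - f y\<bar> \<le> \<bar>C\<bar> * norm (x - y)" .
  qed simp
qed

lemma ae_smooth_continuous:
  assumes "ae_smooth f"
  shows "continuous_on UNIV f"
proof -
  have "isCont f x" for x
  proof -
    obtain C where C: "0 \<le> C" "\<And>u v. norm u \<le> norm x + 1 \<Longrightarrow> norm v \<le> norm x + 1 \<Longrightarrow> \<bar>f u - f v\<bar> \<le> C * norm (u - v)"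
      using ae_smooth_lipschitz[OF assms] by metis
    have "(\<lambda>y. f y - f x) \<midarrow>x\<rightarrow> 0"
    proof (rule Lim_null_comparison)
      have "\<forall>\<^sub>F y in at x. dist y x < 1" by (auto simp: eventually_at intro!: exI[of _ 1])
      then show "\<forall>\<^sub>F y in at x. norm (f y - f x) \<le> C * norm (y - x)"
      proof eventually_elim
        case (elim y)
        then have "norm y \<le> norm x + 1" using norm_triangle_ineq2[of y x] by (simp add: dist_norm)
        then show ?case using C(2)[of y x] by simp
      qed
      have "(\<lambda>y. C * norm (y - x)) \<midarrow>x\<rightarrow> C * norm (x - x)" by (intro tendsto_intros)
      then show "(\<lambda>y. C * norm (y - x)) \<midarrow>x\<rightarrow> 0" by simp
    qed
    then show ?thesis unfolding isCont_def by (rule LIM_zero_cancel)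
  qed
  then show ?thesis by (simp add: continuous_on_eq_continuous_at)
qed

lemma ae_smooth_bounded:
  assumes "ae_smooth f"
  obtains m where "0 \<le> m" "\<And>x. norm x \<le> \<rho> \<Longrightarrow> \<bar>f x\<bar> \<le> m"
proof -
  have "bounded (f ` cball 0 \<rho>)"
    by (intro compact_imp_bounded compact_continuous_image continuous_on_subset[OF ae_smooth_continuous[OF assms]] compact_cball) auto
  then obtain m where m: "\<forall>x\<in>cball 0 \<rho>. \<bar>f x\<bar> \<le> m" by (auto simp: bounded_iff)
  show thesis
  proof (rule that[of "\<bar>m\<bar>"])
    show "\<bar>f x\<bar> \<le> \<bar>m\<bar>" if "norm x \<le> \<rho>" for x using m that by force
  qed simp
qed

lemma ae_smooth_const: "ae_smooth (\<lambda>_. c)"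
  unfolding ae_smooth_def by (auto intro!: exI[of _ 0])

lemma ae_smooth_inner: "ae_smooth (\<lambda>x. a \<bullet> x)"
  unfolding ae_smooth_def
proof (intro conjI allI exI impI)
  fix x y
  show "\<bar>a \<bullet> x - a \<bullet> y\<bar> \<le> norm a * norm (x - y)"
    unfolding inner_diff_right[symmetric] by (rule Cauchy_Schwarz_ineq2)
qed (auto intro!: AE_I2 bounded_linear_imp_differentiable bounded_linear_inner_right)

lemma ae_smooth_mult:
  assumes f: "ae_smooth f" and g: "ae_smooth g"
  shows "ae_smooth (\<lambda>x. f x * g x)"
  unfolding ae_smooth_def
proof (intro conjI allI)
  fix \<rho>
  obtain C where C: "0 \<le> C" "\<And>x y. norm x \<le> \<rho> \<Longrightarrow> norm y \<le> \<rho> \<Longrightarrow> \<bar>f x - f y\<bar> \<le> C * norm (x - y)"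
    using ae_smooth_lipschitz[OF f] by metis
  obtain D where D: "0 \<le> D" "\<And>x y. norm x \<le> \<rho> \<Longrightarrow> norm y \<le> \<rho> \<Longrightarrow> \<bar>g x - g y\<bar> \<le> D * norm (x - y)"
    using ae_smooth_lipschitz[OF g] by metis
  obtain m where m: "0 \<le> m" "\<And>x. norm x \<le> \<rho> \<Longrightarrow> \<bar>f x\<bar> \<le> m" using ae_smooth_bounded[OF f] by metis
  obtain p where p: "0 \<le> p" "\<And>x. norm x \<le> \<rho> \<Longrightarrow> \<bar>g x\<bar> \<le> p" using ae_smooth_bounded[OF g] by metis
  show "\<exists>E. \<forall>x y. norm x \<le> \<rho> \<longrightarrow> norm y \<le> \<rho> \<longrightarrow> \<bar>f x * g x - f y * g y\<bar> \<le> E * norm (x - y)"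
  proof (intro exI[of _ "m * D + p * C"] allI impI)
    fix x y :: "real ^ 'a" assume xy: "norm x \<le> \<rho>" "norm y \<le> \<rho>"
    have "f x * g x - f y * g y = f x * (g x - g y) + g y * (f x - f y)" by (simp add: algebra_simps)
    then have "\<bar>f x * g x - f y * g y\<bar> \<le> \<bar>f x\<bar> * \<bar>g x - g y\<bar> + \<bar>g y\<bar> * \<bar>f x - f y\<bar>"
      by (metis abs_mult abs_triangle_ineq)
    also have "\<dots> \<le> m * (D * norm (x - y)) + p * (C * norm (x - y))"
      using xy C D m p by (intro add_mono mult_mono) auto
    finally show "\<bar>f x * g x - f y * g y\<bar> \<le> (m * D + p * C) * norm (x - y)" by (simp add: algebra_simps)
  qed
next
  have "AE x in lborel. f differentiable (at x)" "AE x in lborel. g differentiable (at x)"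
    using f g by (auto simp: ae_smooth_def)
  then show "AE x in lborel. (\<lambda>x. f x * g x) differentiable (at x)"
    by eventually_elim (rule differentiable_mult)
qed

lemma ae_smooth_diff:
  assumes f: "ae_smooth f" and g: "ae_smooth g"
  shows "ae_smooth (\<lambda>x. f x - g x)"
  unfolding ae_smooth_def
proof (intro conjI allI)
  fix \<rho>
  obtain C where C: "\<And>x y. norm x \<le> \<rho> \<Longrightarrow> norm y \<le> \<rho> \<Longrightarrow> \<bar>f x - f y\<bar> \<le> C * norm (x - y)"
    using ae_smooth_lipschitz[OF f] by metis
  obtain D where D: "\<And>x y. norm x \<le> \<rho> \<Longrightarrow> norm y \<le> \<rho> \<Longrightarrow> \<bar>g x - g y\<bar> \<le> D * norm (x - y)"
    using ae_smooth_lipschitz[OF g] by metis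
  show "\<exists>E. \<forall>x y. norm x \<le> \<rho> \<longrightarrow> norm y \<le> \<rho> \<longrightarrow> \<bar>(f x - g x) - (f y - g y)\<bar> \<le> E * norm (x - y)"
  proof (intro exI[of _ "C + D"] allI impI)
    fix x y :: "real ^ 'a" assume xy: "norm x \<le> \<rho>" "norm y \<le> \<rho>"
    then show "\<bar>(f x - g x) - (f y - g y)\<bar> \<le> (C + D) * norm (x - y)"
      using C[OF xy] D[OF xy] unfolding distrib_right by linarith
  qed
next
  have "AE x in lborel. f differentiable (at x)" "AE x in lborel. g differentiable (at x)"
    using f g by (auto simp: ae_smooth_def)
  then show "AE x in lborel. (\<lambda>x. f x - g x) differentiable (at x)"
    by eventually_elim (rule differentiable_diff)
qed

lemma exp_lipschitz:
  fixes a b :: real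
  assumes "\<bar>a\<bar> \<le> M" "\<bar>b\<bar> \<le> M"
  shows "\<bar>exp a - exp b\<bar> \<le> exp M * \<bar>a - b\<bar>"
proof -
  have "norm (exp a - exp b) \<le> exp M * norm (a - b)"
  proof (rule field_differentiable_bound[where S = "{-M..M}" and f' = exp])
    show "(exp has_field_derivative exp z) (at z within {-M..M})" for z :: real
      by (rule DERIV_subset[OF DERIV_exp]) simp
  qed (use assms in auto)
  then show ?thesis by simp
qed

lemma ae_smooth_exp:
  fixes \<theta> :: "real ^ 'n"
  shows "ae_smooth (\<lambda>x. exp (\<theta> \<bullet> x))"
  unfolding ae_smooth_def
proof (intro conjI allI)
  fix \<rho> :: real
  show "\<exists>C. \<forall>x y. norm x \<le> \<rho> \<longrightarrow> norm y \<le> \<rho> \<longrightarrow> \<bar>exp (\<theta> \<bullet> x) - exp (\<theta> \<bullet> y)\<bar> \<le> C * norm (x - y)"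
  proof (intro exI[of _ "exp (norm \<theta> * \<rho>) * norm \<theta>"] allI impI)
    fix x y :: "real ^ 'n" assume xy: "norm x \<le> \<rho>" "norm y \<le> \<rho>"
    have b: "\<bar>\<theta> \<bullet> z\<bar> \<le> norm \<theta> * \<rho>" if "norm z \<le> \<rho>" for z
      using Cauchy_Schwarz_ineq2[of \<theta> z] mult_left_mono[OF that, of "norm \<theta>"] by simp
    have "\<bar>exp (\<theta> \<bullet> x) - exp (\<theta> \<bullet> y)\<bar> \<le> exp (norm \<theta> * \<rho>) * \<bar>\<theta> \<bullet> x - \<theta> \<bullet> y\<bar>"
      by (rule exp_lipschitz[OF b[OF xy(1)] b[OF xy(2)]])
    also have "\<bar>\<theta> \<bullet> x - \<theta> \<bullet> y\<bar> \<le> norm \<theta> * norm (x - y)"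
      unfolding inner_diff_right[symmetric] by (rule Cauchy_Schwarz_ineq2)
    finally show "\<bar>exp (\<theta> \<bullet> x) - exp (\<theta> \<bullet> y)\<bar> \<le> exp (norm \<theta> * \<rho>) * norm \<theta> * norm (x - y)"
      by (simp add: mult.assoc)
  qed
next
  have "((\<lambda>x. exp (\<theta> \<bullet> x)) has_derivative (\<lambda>h. exp (\<theta> \<bullet> x) * (\<theta> \<bullet> h))) (at x)" for x
    by (auto intro!: derivative_eq_intros)
  then show "AE x in lborel. (\<lambda>x. exp (\<theta> \<bullet> x)) differentiable (at x)"
    by (intro AE_I2) (auto simp: differentiable_def)
qed

text \<open>
  Off the hyperplanes where two affine functions of different slope agree, all active ones coincide,
  so the maximum is affine nearby.
\<close>

lemma ae_smooth_PL_convex: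
  fixes \<Lambda> :: "((int ^ 'n) \<times> rat) set"
  assumes fin: "finite \<Lambda>" and ne: "\<Lambda> \<noteq> {}"
  shows "ae_smooth (PL_convex \<Lambda>)"
  unfolding ae_smooth_def
proof (intro conjI allI)
  let ?u = "PL_convex \<Lambda>"
  define g :: "(int ^ 'n) \<times> rat \<Rightarrow> real ^ 'n \<Rightarrow> real" where "g = (\<lambda>(a, c) x. rvec a \<bullet> x + real_of_rat c)"
  have u: "?u x = Max ((\<lambda>q. g q x) ` \<Lambda>)" for x by (simp add: PL_convex_def g_def case_prod_beta')
  have ge: "g q x \<le> ?u x" if "q \<in> \<Lambda>" for q x unfolding u using fin that by simp
  have att: "\<exists>q\<in>\<Lambda>. ?u x = g q x" for x
  proof -
    have "?u x \<in> (\<lambda>q. g q x) ` \<Lambda>" unfolding u using fin ne by (intro Max_in) simp_all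
    then show ?thesis by blast
  qed
  have gd: "g q y - g q x = rvec (fst q) \<bullet> (y - x)" for q x y
    by (simp add: g_def case_prod_beta' inner_diff_right)
  show "\<exists>C. \<forall>x y. norm x \<le> \<rho> \<longrightarrow> norm y \<le> \<rho> \<longrightarrow> \<bar>?u x - ?u y\<bar> \<le> C * norm (x - y)" for \<rho>
  proof (intro exI allI impI)
    let ?C = "\<Sum>q\<in>\<Lambda>. norm (rvec (fst q))"
    have half: "?u x - ?u y \<le> ?C * norm (x - y)" for x y
    proof -
      obtain q where q: "q \<in> \<Lambda>" "?u x = g q x" using att by blast
      have "?u x - ?u y \<le> g q x - g q y" using q ge[of q y] by simp
      also have "\<dots> \<le> norm (rvec (fst q)) * norm (x - y)" unfolding gd by (rule norm_cauchy_schwarz)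
      also have "\<dots> \<le> ?C * norm (x - y)"
        using fin q(1) by (intro mult_right_mono member_le_sum) auto
      finally show ?thesis .
    qed
    fix x y
    show "\<bar>?u x - ?u y\<bar> \<le> ?C * norm (x - y)"
      using half[of x y] half[of y x] by (simp add: abs_le_iff norm_minus_commute)
  qed
  have "AE x in lborel. \<forall>q\<in>\<Lambda>. \<forall>q'\<in>\<Lambda>. fst q \<noteq> fst q' \<longrightarrow> g q x \<noteq> g q' x"
  proof (intro AE_finite_allI fin)
    fix q q' assume "q \<in> \<Lambda>" "q' \<in> \<Lambda>"
    show "AE x in lborel. fst q \<noteq> fst q' \<longrightarrow> g q x \<noteq> g q' x"
    proof (cases "fst q = fst q'")
      case False
      then have "rvec (fst q) - rvec (fst q') \<noteq> 0" by (auto simp: rvec_def vec_eq_iff)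
      from AE_not_on_hyperplane[OF this, of "real_of_rat (snd q') - real_of_rat (snd q)"]
      show ?thesis by eventually_elim (auto simp: g_def case_prod_beta' inner_diff_left)
    qed simp
  qed
  then show "AE x in lborel. ?u differentiable (at x)"
  proof eventually_elim
    case (elim x)
    obtain q where q: "q \<in> \<Lambda>" "?u x = g q x" using att by blast
    have g_cont: "isCont (g q') x" for q' by (auto simp: g_def case_prod_beta' intro!: continuous_intros)
    have "\<forall>\<^sub>F y in nhds x. \<forall>q'\<in>\<Lambda>. g q' y \<le> g q y"
    proof (intro eventually_ball_finite fin ballI)
      fix q' assume q': "q' \<in> \<Lambda>"
      have le: "g q' x \<le> g q x" using ge[OF q', of x] q by simp
      show "\<forall>\<^sub>F y in nhds x. g q' y \<le> g q y"
      proof (cases "fst q' = fst q")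
        case True
        have "g q' y \<le> g q y" for y using gd[of q' y x] gd[of q y x] le True by simp
        then show ?thesis by simp
      next
        case False
        then have "0 < g q x - g q' x" using elim q q' le by force
        moreover have "((\<lambda>y. g q y - g q' y) \<longlongrightarrow> g q x - g q' x) (nhds x)"
          using g_cont[of q] g_cont[of q'] by (intro tendsto_diff) (simp_all add: continuous_within tendsto_at_iff_tendsto_nhds)
        ultimately have "\<forall>\<^sub>F y in nhds x. 0 < g q y - g q' y" by (intro order_tendstoD(1))
        then show ?thesis by eventually_elim simp
      qed
    qed
    then have ev: "\<forall>\<^sub>F y in nhds x. g q y = ?u y"
    proof eventually_elim
      case (elim y)
      then show ?case using q att[of y] ge[of q y] by force
    qed
    have "(g q has_derivative (\<lambda>h. rvec (fst q) \<bullet> h)) (at x)"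
      unfolding g_def case_prod_beta' by (auto intro!: derivative_eq_intros)
    then have "(?u has_derivative (\<lambda>h. rvec (fst q) \<bullet> h)) (at x)"
      by (rule has_derivative_transform_eventually) (use ev q in \<open>auto simp: eventually_nhds_conv_at\<close>)
    then show ?case by (auto simp: differentiable_def)
  qed
qed

section \<open>Euler-Maclaurin summation over lattice polytopes\<close>

context lattice_polytope
begin

definition lattice_sum :: "nat \<Rightarrow> (int ^ 'n \<Rightarrow> int) \<Rightarrow> (real ^ 'n \<Rightarrow> real) \<Rightarrow> real" where
  "lattice_sum k b f = (\<Sum>I\<in>lattice_points L k b. f (rvec I /\<^sub>R real k))"

lemma lattice_points_cong:
  "(\<And>ell. ell \<in> L \<Longrightarrow> b ell = b' ell) \<Longrightarrow> lattice_points L k b = lattice_points L k b'"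
  by (auto simp: lattice_points_def)

lemma lattice_sum_layer:
  assumes "ell \<in> L"
  shows "lattice_sum k (b(ell := c)) f - lattice_sum k (b(ell := c - 1)) f
    = (\<Sum>I\<in>layer L ell k b c. f (rvec I /\<^sub>R real k))"
proof -
  have un: "lattice_points L k (b(ell := c)) = lattice_points L k (b(ell := c - 1)) \<union> layer L ell k b c"
  proof (intro set_eqI iffI)
    fix I assume I: "I \<in> lattice_points L k (b(ell := c))"
    show "I \<in> lattice_points L k (b(ell := c - 1)) \<union> layer L ell k b c"
    proof (cases "pairing ell I = int k + c")
      case True
      then show ?thesis using I by (auto simp: lattice_points_def layer_def split: if_splits)
    next
      case False
      have "pairing ell I \<le> int k + c" using I assms by (auto simp: lattice_points_def)
      then have "pairing ell I \<le> int k + (c - 1)" using False by simp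
      then show ?thesis using I by (auto simp: lattice_points_def)
    qed
  next
    fix I assume I: "I \<in> lattice_points L k (b(ell := c - 1)) \<union> layer L ell k b c"
    then show "I \<in> lattice_points L k (b(ell := c))"
    proof
      assume "I \<in> lattice_points L k (b(ell := c - 1))"
      then show ?thesis unfolding lattice_points_def by (auto split: if_splits)
    next
      assume "I \<in> layer L ell k b c"
      then show ?thesis using layer_subset by blast
    qed
  qed
  have dis: "lattice_points L k (b(ell := c - 1)) \<inter> layer L ell k b c = {}"
    using assms by (auto simp: lattice_points_def layer_def)
  have "finite (layer L ell k b c)"
    using layer_subset finite_lattice_points_dilated by (rule finite_subset)
  then show ?thesis
    unfolding lattice_sum_def un by (subst sum.union_disjoint) (auto simp: dis finite_lattice_points_dilated)
qed

definition boundary_term :: "(real ^ 'n \<Rightarrow> real) \<Rightarrow> real" where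
  "boundary_term f = (\<Sum>ell\<in>L. facet_integral L ell f)"

text \<open>
  Moving one facet by \<open>m\<close> lattice steps adds \<open>m\<close> layers, or removes \<open>-m\<close> layers if \<open>m\<close> is negative.
\<close>

lemma shift_one_facet:
  assumes ell: "ell \<in> L" and f: "continuous_on UNIV f"
  shows "(\<lambda>k. (lattice_sum k (b(ell := d + m)) f - lattice_sum k (b(ell := d)) f) / real k ^ (CARD('n) - 1))
    \<longlonglongrightarrow> real_of_int m * facet_integral L ell f"
proof (induction m rule: int_induct[where k = 0])
  case base
  then show ?case by simp
next
  case (step1 i)
  from tendsto_add[OF step1.IH layer_sum_limit[OF ell f, of b "d + (i + 1)"]]
  show ?case unfolding lattice_sum_layer[OF ell, symmetric] add_divide_distrib[symmetric]
    by (simp add: distrib_right del: fun_upd_apply)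
next
  case (step2 i)
  from tendsto_diff[OF step2.IH layer_sum_limit[OF ell f, of b "d + i"]]
  show ?case unfolding lattice_sum_layer[OF ell, symmetric] diff_divide_distrib[symmetric]
    by (simp add: left_diff_distrib add_diff_eq del: fun_upd_apply)
qed

lemma shift_limit:
  assumes f: "continuous_on UNIV f"
  shows "(\<lambda>k. (lattice_sum k b f - lattice_sum k (\<lambda>_. 0) f) / real k ^ (CARD('n) - 1))
    \<longlonglongrightarrow> (\<Sum>ell\<in>L. real_of_int (b ell) * facet_integral L ell f)"
proof -
  define bM where "bM M = (\<lambda>ell. if ell \<in> M then b ell else 0)" for M
  have "(\<lambda>k. (lattice_sum k (bM M) f - lattice_sum k (\<lambda>_. 0) f) / real k ^ (CARD('n) - 1))
    \<longlonglongrightarrow> (\<Sum>ell\<in>M. real_of_int (b ell) * facet_integral L ell f)" if "M \<subseteq> L" for M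
    using finite_subset[OF that fin] that
  proof (induction M rule: finite_induct)
    case empty
    then show ?case by (simp add: bM_def)
  next
    case (insert ell M)
    have eqs: "bM (insert ell M) = (bM M)(ell := 0 + b ell)" "(bM M)(ell := 0) = bM M"
      using insert.hyps by (auto simp: bM_def fun_eq_iff)
    have ell: "ell \<in> L" using insert.prems by simp
    from tendsto_add[OF shift_one_facet[OF ell f, of "bM M" 0 "b ell"] insert.IH]
    show ?case using insert.hyps insert.prems
      unfolding eqs(1)[symmetric] eqs(2) add_divide_distrib[symmetric] by simp
  qed
  note lim = this[of L]
  have "lattice_points L k (bM L) = lattice_points L k b" for k
    by (rule lattice_points_cong) (simp add: bM_def)
  then show ?thesis using lim by (simp add: lattice_sum_def)
qed

lemma card_lattice_points_bound:
  obtains E where "\<And>k. 0 < k \<Longrightarrow> real (card (lattice_points L k (\<lambda>_. int B))) \<le> E * real k ^ CARD('n)"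
proof -
  define \<rho> where "\<rho> = (1 + real B) * radius + real CARD('n)"
  show thesis
  proof (rule that)
    fix k :: nat assume k: "0 < k"
    let ?N = "lattice_points L k (\<lambda>_. int B)"
    define h where "h I = (if I \<in> ?N then 1 else 0 :: real)" for I
    have h: "h I = 0" if "I \<notin> ?N" for I using that by (simp add: h_def)
    note s = sum_eq_integral_floor[where A = ?N and h = h, OF finite_lattice_points_dilated h]
    have m: "(\<lambda>z. h (floor_vec z)) \<in> borel_measurable borel"
      using borel_measurable_integrable[OF s(2)] by simp
    have "real (card ?N) = (\<Sum>I\<in>?N. h I)" by (simp add: h_def)
    also have "\<dots> = real k ^ CARD('n) * (LINT x|lborel. h (floor_vec (real k *\<^sub>R x)))"
      using s(1) lborel_integral_scale[OF m, of "real k"] k by simp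
    finally have card: "real (card ?N) = real k ^ CARD('n) * (LINT x|lborel. h (floor_vec (real k *\<^sub>R x)))" .
    have "(LINT x|lborel. h (floor_vec (real k *\<^sub>R x))) \<le> (LINT x|lborel. indicator (cball (0 :: real ^ 'n) \<rho>) x)"
    proof (rule integral_mono')
      show "integrable lborel (indicator (cball (0 :: real ^ 'n) \<rho>) :: _ \<Rightarrow> real)"
        by (intro integrable_real_indicator emeasure_bounded_finite) auto
      fix x :: "real ^ 'n"
      show "h (floor_vec (real k *\<^sub>R x)) \<le> indicator (cball 0 \<rho>) x"
      proof (cases "floor_vec (real k *\<^sub>R x) \<in> ?N")
        case True
        let ?J = "rvec (floor_vec (real k *\<^sub>R x))"
        have J: "norm (?J /\<^sub>R real k) \<le> (1 + real B) * radius"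
          using True k by (intro norm_lattice_points) auto
        have d: "norm (?J /\<^sub>R real k - x) \<le> real CARD('n)"
          using near_scaled_floor[OF k, of x] k order.trans[of _ "real CARD('n) / real k"]
          by (simp add: divide_le_eq mult_le_cancel_left1)
        have "norm x \<le> \<rho>"
          using J d norm_triangle_ineq4[of "?J /\<^sub>R real k" "?J /\<^sub>R real k - x"] by (simp add: \<rho>_def)
        then show ?thesis using True by (simp add: h_def)
      qed (simp add: h_def)
      show "0 \<le> (indicator (cball 0 \<rho>) x :: real)" by simp
    qed
    then show "real (card ?N) \<le> (LINT x|lborel. indicator (cball (0 :: real ^ 'n) \<rho>) x) * real k ^ CARD('n)"
      unfolding card mult.commute[of "real k ^ CARD('n)"] by (rule mult_right_mono) simp
  qed
qed

text \<open>
  All the polytopes lie between those whose facets are moved by \<open>-B\<close> and by \<open>B\<close>, and the number of lattice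
  points between these two is of order \<open>k\<^sup>n\<^sup>-\<^sup>1\<close>. So the bound is uniform in \<open>b\<close>.
\<close>

lemma shift_bound:
  assumes f: "ae_smooth f"
  obtains D where "\<And>k b. 0 < k \<Longrightarrow> (\<And>ell. ell \<in> L \<Longrightarrow> \<bar>b ell\<bar> \<le> int B) \<Longrightarrow>
    \<bar>lattice_sum k b f - lattice_sum k (\<lambda>_. 0) f\<bar> \<le> D * real k ^ (CARD('n) - 1)"
proof -
  obtain m where m: "0 \<le> m" "\<And>x. norm x \<le> (1 + real B) * radius \<Longrightarrow> \<bar>f x\<bar> \<le> m"
    using ae_smooth_bounded[OF f] by metis
  let ?P = "\<lambda>k. lattice_points L k (\<lambda>_. int B)" and ?M = "\<lambda>k. lattice_points L k (\<lambda>_. - int B)"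
  have cont: "continuous_on UNIV (\<lambda>_ :: real ^ 'n. 1 :: real)" by (rule continuous_on_const)
  have card: "lattice_sum k b (\<lambda>_. 1) = real (card (lattice_points L k b))" for k b
    by (simp add: lattice_sum_def)
  define X where "X k = (real (card (?P k)) - real (card (?M k))) / real k ^ (CARD('n) - 1)" for k
  have "convergent X"
    using tendsto_diff[OF shift_limit[OF cont, of "\<lambda>_. int B"] shift_limit[OF cont, of "\<lambda>_. - int B"]]
    unfolding card diff_divide_distrib[symmetric] by (auto simp: convergent_def X_def[abs_def])
  then obtain E where E: "\<forall>k. norm (X k) \<le> E" using convergent_imp_Bseq[of X] unfolding Bseq_def by blast
  show thesis
  proof (rule that)
    fix k :: nat and b :: "int ^ 'n \<Rightarrow> int" assume k: "0 < k" and b: "\<And>ell. ell \<in> L \<Longrightarrow> \<bar>b ell\<bar> \<le> int B"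
    have MP: "?M k \<subseteq> ?P k" unfolding lattice_points_def by force
    have cardPM: "real (card (?P k - ?M k)) \<le> E * real k ^ (CARD('n) - 1)"
    proof -
      have "real (card (?P k - ?M k)) = real (card (?P k)) - real (card (?M k))"
        using MP finite_lattice_points_dilated by (simp add: card_Diff_subset card_mono of_nat_diff)
      also have "\<dots> \<le> E * real k ^ (CARD('n) - 1)"
      proof -
        have "(real (card (?P k)) - real (card (?M k))) / real k ^ (CARD('n) - 1) \<le> E"
          using order.trans[OF abs_ge_self spec[OF E, of k, unfolded real_norm_def]] unfolding X_def .
        then show ?thesis using k by (simp add: pos_divide_le_eq)
      qed
      finally show ?thesis .
    qed
    have part: "\<bar>lattice_sum k b' f - lattice_sum k (\<lambda>_. - int B) f\<bar> \<le> m * (E * real k ^ (CARD('n) - 1))"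
      if b': "\<And>ell. ell \<in> L \<Longrightarrow> \<bar>b' ell\<bar> \<le> int B" for b'
    proof -
      have sub: "?M k \<subseteq> lattice_points L k b'" "lattice_points L k b' \<subseteq> ?P k"
        using b' by (auto simp: lattice_points_def abs_le_iff) (smt (verit))+
      have "lattice_sum k b' f - lattice_sum k (\<lambda>_. - int B) f
          = (\<Sum>I\<in>lattice_points L k b' - ?M k. f (rvec I /\<^sub>R real k))"
        unfolding lattice_sum_def using sub(1) finite_lattice_points_dilated by (simp add: sum_diff)
      also have "\<bar>\<dots>\<bar> \<le> (\<Sum>I\<in>lattice_points L k b' - ?M k. m)"
      proof (rule order.trans[OF sum_abs sum_mono])
        fix I assume "I \<in> lattice_points L k b' - ?M k"
        then have "I \<in> ?P k" using sub by blast
        then show "\<bar>f (rvec I /\<^sub>R real k)\<bar> \<le> m" using k by (intro m(2) norm_lattice_points) auto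
      qed
      also have "\<dots> = m * real (card (lattice_points L k b' - ?M k))" by simp
      also have "\<dots> \<le> m * real (card (?P k - ?M k))"
        using sub m(1) finite_lattice_points_dilated by (intro mult_left_mono of_nat_mono card_mono) auto
      also have "\<dots> \<le> m * (E * real k ^ (CARD('n) - 1))" by (intro mult_left_mono cardPM m)
      finally show ?thesis .
    qed
    have "\<bar>lattice_sum k b f - lattice_sum k (\<lambda>_. 0) f\<bar>
        \<le> \<bar>lattice_sum k b f - lattice_sum k (\<lambda>_. - int B) f\<bar> + \<bar>lattice_sum k (\<lambda>_. 0) f - lattice_sum k (\<lambda>_. - int B) f\<bar>"
      by linarith
    also have "\<dots> \<le> m * (E * real k ^ (CARD('n) - 1)) + m * (E * real k ^ (CARD('n) - 1))"
      by (intro add_mono part b) simp_all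
    finally show "\<bar>lattice_sum k b f - lattice_sum k (\<lambda>_. 0) f\<bar> \<le> (2 * m * E) * real k ^ (CARD('n) - 1)"
      by (simp add: algebra_simps)
  qed
qed

lemma AE_off_boundary: "AE x in lborel. \<forall>ell\<in>L. rvec ell \<bullet> x \<noteq> 1"
  by (intro AE_finite_allI fin AE_not_on_hyperplane rvec_nonzero)

text \<open>
  The lattice points, scaled by \<open>1/k\<close>, that satisfy the inequalities up to a bounded error fill the
  interior of the polytope and leave its exterior.
\<close>

lemma eventually_in_lattice_points:
  assumes x: "\<forall>ell\<in>L. rvec ell \<bullet> x < 1"
  shows "\<forall>\<^sub>F k in sequentially. floor_vec (real k *\<^sub>R x) \<in> lattice_points L k b"
proof -
  have lim: "(\<lambda>k. rvec ell \<bullet> (rvec (floor_vec (real k *\<^sub>R x)) /\<^sub>R real k) - real_of_int (b ell) / real k) \<longlonglongrightarrow> rvec ell \<bullet> x" for ell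
    using tendsto_diff[OF tendsto_inner[OF tendsto_const[of "rvec ell"] scaled_floor_tendsto] lim_const_over_n[of "real_of_int (b ell)"]] by simp
  have "\<forall>\<^sub>F k in sequentially. \<forall>ell\<in>L. rvec ell \<bullet> (rvec (floor_vec (real k *\<^sub>R x)) /\<^sub>R real k) - real_of_int (b ell) / real k < 1"
    using fin x order_tendstoD(2)[OF lim] by (intro eventually_ball_finite) auto
  then show ?thesis using eventually_gt_at_top[of 0]
  proof eventually_elim
    case (elim k)
    show ?case unfolding lattice_points_def
    proof (intro CollectI ballI)
      fix ell assume "ell \<in> L"
      with elim have "rvec ell \<bullet> rvec (floor_vec (real k *\<^sub>R x)) < real k + real_of_int (b ell)" by (simp add: field_simps)
      then show "pairing ell (floor_vec (real k *\<^sub>R x)) \<le> int k + b ell" unfolding rvec_inner_pairing by linarith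
    qed
  qed
qed

lemma eventually_notin_lattice_points:
  assumes x: "ell \<in> L" "1 < rvec ell \<bullet> x"
  shows "\<forall>\<^sub>F k in sequentially. floor_vec (real k *\<^sub>R x) \<notin> lattice_points L k b"
proof -
  have lim: "(\<lambda>k. rvec ell \<bullet> (rvec (floor_vec (real k *\<^sub>R x)) /\<^sub>R real k) - real_of_int (b ell) / real k) \<longlonglongrightarrow> rvec ell \<bullet> x"
    using tendsto_diff[OF tendsto_inner[OF tendsto_const[of "rvec ell"] scaled_floor_tendsto] lim_const_over_n[of "real_of_int (b ell)"]] by simp
  from order_tendstoD(1)[OF lim x(2)] eventually_gt_at_top[of 0] show ?thesis
  proof eventually_elim
    case (elim k)
    then have "real k + real_of_int (b ell) < rvec ell \<bullet> rvec (floor_vec (real k *\<^sub>R x))" by (simp add: field_simps)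
    then have "int k + b ell < pairing ell (floor_vec (real k *\<^sub>R x))" unfolding rvec_inner_pairing by linarith
    then show ?case using x(1) by (force simp: lattice_points_def)
  qed
qed

lemma lattice_points_mono:
  "(\<And>ell. ell \<in> L \<Longrightarrow> b ell \<le> b' ell) \<Longrightarrow> lattice_points L k b \<subseteq> lattice_points L k b'"
  by (force simp: lattice_points_def)

lemma lattice_variation_bound:
  assumes f: "ae_smooth f"
  obtains C where "0 \<le> C" "\<And>k I z. 0 < k \<Longrightarrow> I \<in> lattice_points L k (\<lambda>_. int B) \<Longrightarrow> norm z \<le> r \<Longrightarrow>
      \<bar>f ((rvec I + z) /\<^sub>R real k) - f (rvec I /\<^sub>R real k)\<bar> \<le> C * r / real k"
proof -
  define \<rho> where "\<rho> = (1 + real B) * radius + \<bar>r\<bar>"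
  obtain C where C: "0 \<le> C" "\<And>u v. norm u \<le> \<rho> \<Longrightarrow> norm v \<le> \<rho> \<Longrightarrow> \<bar>f u - f v\<bar> \<le> C * norm (u - v)"
    using ae_smooth_lipschitz[OF f] by metis
  show thesis
  proof (rule that[OF C(1)])
    fix k I and z :: "real ^ 'n"
    assume k: "0 < k" and I: "I \<in> lattice_points L k (\<lambda>_. int B)" and z: "norm z \<le> r"
    have 1: "norm (rvec I /\<^sub>R real k) \<le> (1 + real B) * radius"
      using k by (intro norm_lattice_points[OF I]) auto
    have nz: "norm (z /\<^sub>R real k) = norm z / real k" by (simp add: divide_inverse mult.commute)
    have zr: "norm z / real k \<le> r / real k" using z by (intro divide_right_mono) auto
    have "r / real k \<le> r" using k order.trans[OF norm_ge_zero z] by (simp add: divide_le_eq mult_le_cancel_left1)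
    then have "norm ((rvec I + z) /\<^sub>R real k) \<le> \<rho>" "norm (rvec I /\<^sub>R real k) \<le> \<rho>"
      using 1 nz zr norm_triangle_ineq[of "rvec I /\<^sub>R real k" "z /\<^sub>R real k"]
      unfolding \<rho>_def scaleR_add_right by linarith+
    then have "\<bar>f ((rvec I + z) /\<^sub>R real k) - f (rvec I /\<^sub>R real k)\<bar> \<le> C * norm ((rvec I + z) /\<^sub>R real k - rvec I /\<^sub>R real k)"
      by (rule C(2))
    also have "(rvec I + z) /\<^sub>R real k - rvec I /\<^sub>R real k = z /\<^sub>R real k" by (simp add: scaleR_add_right)
    also have "C * norm (z /\<^sub>R real k) \<le> C * (r / real k)" unfolding nz by (intro mult_left_mono zr C)
    finally show "\<bar>f ((rvec I + z) /\<^sub>R real k) - f (rvec I /\<^sub>R real k)\<bar> \<le> C * r / real k" by simp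
  qed
qed

definition variation :: "nat \<Rightarrow> (int ^ 'n \<Rightarrow> int) \<Rightarrow> real ^ 'n \<Rightarrow> (real ^ 'n \<Rightarrow> real) \<Rightarrow> real" where
  "variation k b y f = (\<Sum>I\<in>lattice_points L k b. f ((rvec I + y) /\<^sub>R real k) - f (rvec I /\<^sub>R real k))"

text \<open>
  The first-order variation of \<open>f\<close> between \<open>I/k\<close> and \<open>(I \<pm> y)/k\<close> is odd in \<open>y\<close>, so it cancels
  in the symmetrised sum.
\<close>

lemma symmetric_difference_limit:
  assumes f: "ae_smooth f" and b: "\<And>ell. ell \<in> L \<Longrightarrow> b ell \<le> int B" "\<And>ell. ell \<in> L \<Longrightarrow> b' ell \<le> int B"
  shows "(\<lambda>k. (variation k b y f + variation k b' (- y) f) / real k ^ (CARD('n) - 1)) \<longlonglongrightarrow> 0"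
proof -
  define h where "h k I = real k *
     ((if I \<in> lattice_points L k b then f ((rvec I + y) /\<^sub>R real k) - f (rvec I /\<^sub>R real k) else 0)
     + (if I \<in> lattice_points L k b' then f ((rvec I - y) /\<^sub>R real k) - f (rvec I /\<^sub>R real k) else 0))" for k I
  define s where "s k x = h k (floor_vec (real k *\<^sub>R x))" for k x
  let ?N = "\<lambda>k. lattice_points L k b \<union> lattice_points L k b'"
  have finN: "finite (?N k)" for k by (simp add: finite_lattice_points_dilated)
  have h0: "h k I = 0" if "I \<notin> ?N k" for k I using that by (simp add: h_def)
  note si = sum_eq_integral_floor[where A = "?N k" and h = "h k" for k, OF finN h0]
  have hm: "(\<lambda>z. h k (floor_vec z)) \<in> borel_measurable borel" for k
    using borel_measurable_integrable[OF si(2)] by simp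
  have sm: "s k \<in> borel_measurable lborel" for k
    unfolding s_def by (rule measurable_compose[OF _ hm]) measurable
  have sum_eq: "(variation k b y f + variation k b' (- y) f) / real k ^ (CARD('n) - 1)
      = (LINT x|lborel. s k x)" (is "?A / _ = _") if k: "0 < k" for k
  proof -
    have "(\<Sum>I\<in>?N k. h k I) = real k * ?A"
    proof -
      have 1: "(\<Sum>I\<in>?N k. if I \<in> lattice_points L k b then f ((rvec I + y) /\<^sub>R real k) - f (rvec I /\<^sub>R real k) else 0)
         = variation k b y f"
        unfolding variation_def by (rule sum.mono_neutral_cong_right[OF finN]) auto
      have 2: "(\<Sum>I\<in>?N k. if I \<in> lattice_points L k b' then f ((rvec I - y) /\<^sub>R real k) - f (rvec I /\<^sub>R real k) else 0)
         = variation k b' (- y) f"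
        unfolding variation_def by (rule sum.mono_neutral_cong_right[OF finN]) auto
      show ?thesis unfolding h_def sum_distrib_left[symmetric] sum.distrib 1 2 ..
    qed
    then have "real k * ?A = real k ^ CARD('n) * (LINT x|lborel. s k x)"
      using si(1)[of k] lborel_integral_scale[OF hm, of "real k" k] k by (simp add: s_def)
    also have "real k ^ CARD('n) = real k * real k ^ (CARD('n) - 1)"
      by (metis power_eq_if zero_less_card_finite less_irrefl)
    finally have "?A = real k ^ (CARD('n) - 1) * (LINT x|lborel. s k x)" using k by simp
    then show ?thesis using k by simp
  qed
  obtain C where C: "0 \<le> C" "\<And>k I z. 0 < k \<Longrightarrow> I \<in> lattice_points L k (\<lambda>_. int B) \<Longrightarrow> norm z \<le> norm y \<Longrightarrow>
      \<bar>f ((rvec I + z) /\<^sub>R real k) - f (rvec I /\<^sub>R real k)\<bar> \<le> C * norm y / real k"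
    using lattice_variation_bound[OF f, of B "norm y"] by metis
  have diff_bound: "\<bar>f ((rvec I + z) /\<^sub>R real k) - f (rvec I /\<^sub>R real k)\<bar> \<le> C * norm y / real k"
    if "I \<in> lattice_points L k c" "\<And>ell. ell \<in> L \<Longrightarrow> c ell \<le> int B" "0 < k" "norm z = norm y" for I k c z
    using that lattice_points_mono[of c "\<lambda>_. int B" k] by (intro C(2)) auto
  have bound: "\<bar>s k x\<bar> \<le> 2 * C * norm y * indicator (cball 0 ((1 + real B) * radius + real CARD('n))) x" if k: "0 < k" for k x
  proof (cases "floor_vec (real k *\<^sub>R x) \<in> ?N k")
    case False
    then show ?thesis using C(1) by (simp add: s_def h0)
  next
    case True
    let ?I = "floor_vec (real k *\<^sub>R x)"
    have J: "norm (rvec ?I /\<^sub>R real k) \<le> (1 + real B) * radius"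
      using norm_lattice_points[of ?I k b B] norm_lattice_points[of ?I k b' B] True b k by blast
    have "real CARD('n) / real k \<le> real CARD('n)" using k by (simp add: divide_le_eq mult_le_cancel_left1)
    then have "norm (rvec ?I /\<^sub>R real k - x) \<le> real CARD('n)" using near_scaled_floor[OF k, of x] by linarith
    then have "norm x \<le> (1 + real B) * radius + real CARD('n)"
      using J norm_triangle_ineq4[of "rvec ?I /\<^sub>R real k" "rvec ?I /\<^sub>R real k - x"] by simp
    then have ind: "indicator (cball 0 ((1 + real B) * radius + real CARD('n))) x = (1 :: real)" by simp
    let ?p = "if ?I \<in> lattice_points L k b then f ((rvec ?I + y) /\<^sub>R real k) - f (rvec ?I /\<^sub>R real k) else 0"
    let ?q = "if ?I \<in> lattice_points L k b' then f ((rvec ?I - y) /\<^sub>R real k) - f (rvec ?I /\<^sub>R real k) else 0"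
    have c0: "0 \<le> C * norm y / real k" using C(1) by simp
    have "\<bar>?p\<bar> \<le> C * norm y / real k" "\<bar>?q\<bar> \<le> C * norm y / real k"
      using diff_bound[of ?I k b y] diff_bound[of ?I k b' "- y"] b k c0 by auto
    then have "\<bar>?p + ?q\<bar> \<le> 2 * (C * norm y / real k)" by linarith
    then have "real k * \<bar>?p + ?q\<bar> \<le> real k * (2 * (C * norm y / real k))" by (rule mult_left_mono) simp
    also have "\<dots> = 2 * C * norm y" using k by simp
    finally show ?thesis unfolding ind s_def h_def by (simp add: abs_mult)
  qed
  have "(\<lambda>k. LINT x|lborel. s (Suc k) x) \<longlonglongrightarrow> (LINT x|(lborel :: (real ^ 'n) measure). (0 :: real))"
  proof (rule integral_dominated_convergence)
    show "integrable lborel (\<lambda>x :: real ^ 'n. 2 * C * norm y * indicator (cball 0 ((1 + real B) * radius + real CARD('n))) x)"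
      by (intro integrable_mult_right integrable_real_indicator emeasure_bounded_finite) auto
    show "AE x in lborel. norm (s (Suc k) x) \<le> 2 * C * norm y * indicator (cball 0 ((1 + real B) * radius + real CARD('n))) x" for k
      using bound[of "Suc k"] by simp
    show "s (Suc k) \<in> borel_measurable lborel" for k by (rule sm)
    have "AE x in lborel. f differentiable (at x)" using f by (simp add: ae_smooth_def)
    then have "AE x in lborel. (\<lambda>k. s k x) \<longlonglongrightarrow> 0"
      using AE_off_boundary
    proof eventually_elim
      case (elim x)
      show ?case
      proof (cases "\<forall>ell\<in>L. rvec ell \<bullet> x < 1")
        case True
        obtain A where A: "(f has_derivative A) (at x)" using elim(1) by (auto simp: differentiable_def)
        interpret A: linear A using A by (rule has_derivative_linear)
        define a where "a k = rvec (floor_vec (real k *\<^sub>R x)) /\<^sub>R real k - x" for k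
        have na: "norm (a k) \<le> real CARD('n) / real k" if "0 < k" for k
          unfolding a_def by (rule near_scaled_floor[OF that])
        let ?C = "real CARD('n) + norm y"
        have nz: "norm (a k + z /\<^sub>R real k) \<le> ?C / real k" if "0 < k" "norm z \<le> norm y" for k z
        proof -
          have "norm (z /\<^sub>R real k) \<le> norm y / real k" using that by (simp add: divide_inverse mult.commute mult_right_mono)
          then show ?thesis using na[OF that(1)] norm_triangle_ineq[of "a k" "z /\<^sub>R real k"]
            by (simp add: add_divide_distrib)
        qed
        have rem: "(\<lambda>k. real k * (f (x + (a k + z /\<^sub>R real k)) - f x - A (a k + z /\<^sub>R real k))) \<longlonglongrightarrow> 0"
          if "norm z \<le> norm y" for z
          by (rule derivative_remainder_limit[OF A nz[OF _ that]])
        \<comment> \<open>the derivative \<open>A\<close> drops out of \<open>f(a + y/k) + f(a - y/k) - 2 f(a)\<close>\<close>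
        have lim: "(\<lambda>k. real k * (f (x + (a k + y /\<^sub>R real k)) - f x - A (a k + y /\<^sub>R real k))
           + real k * (f (x + (a k + (- y) /\<^sub>R real k)) - f x - A (a k + (- y) /\<^sub>R real k))
           - 2 * (real k * (f (x + (a k + 0 /\<^sub>R real k)) - f x - A (a k + 0 /\<^sub>R real k)))) \<longlonglongrightarrow> 0 + 0 - 2 * 0"
          by (intro tendsto_intros rem) simp_all
        have "\<forall>\<^sub>F k in sequentially. real k * (f (x + (a k + y /\<^sub>R real k)) - f x - A (a k + y /\<^sub>R real k))
           + real k * (f (x + (a k + (- y) /\<^sub>R real k)) - f x - A (a k + (- y) /\<^sub>R real k))
           - 2 * (real k * (f (x + (a k + 0 /\<^sub>R real k)) - f x - A (a k + 0 /\<^sub>R real k))) = s k x"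
          using eventually_in_lattice_points[OF True, of b] eventually_in_lattice_points[OF True, of b'] eventually_gt_at_top[of 0]
        proof eventually_elim
          case (elim k)
          have pt: "x + (a k + z /\<^sub>R real k) = (rvec (floor_vec (real k *\<^sub>R x)) + z) /\<^sub>R real k" for z
            by (simp add: a_def scaleR_add_right)
          have pt0: "x + (a k + 0 /\<^sub>R real k) = rvec (floor_vec (real k *\<^sub>R x)) /\<^sub>R real k" by (simp add: a_def)
          have "(rvec (floor_vec (real k *\<^sub>R x)) + (- y)) = rvec (floor_vec (real k *\<^sub>R x)) - y" by simp
          then show ?case unfolding s_def h_def pt[of y] pt[of "- y"] pt0 using elim
            by (simp add: A.add A.diff A.scaleR A.neg algebra_simps)
        qed
        from Lim_transform_eventually[OF lim this] show ?thesis by simp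
      next
        case False
        then obtain ell where ell: "ell \<in> L" "1 < rvec ell \<bullet> x" using elim(2) by force
        have ev: "\<forall>\<^sub>F k in sequentially. 0 = s k x"
          using eventually_notin_lattice_points[OF ell, of b] eventually_notin_lattice_points[OF ell, of b']
          by eventually_elim (simp add: s_def h_def)
        show ?thesis by (rule Lim_transform_eventually[OF tendsto_const ev])
      qed
    qed
    then show "AE x in lborel. (\<lambda>k. s (Suc k) x) \<longlonglongrightarrow> 0" by eventually_elim (rule LIMSEQ_Suc)
  qed simp
  then have "(\<lambda>k. LINT x|lborel. s (Suc k) x) \<longlonglongrightarrow> 0" by simp
  then have "(\<lambda>k. LINT x|lborel. s k x) \<longlonglongrightarrow> 0" by (rule LIMSEQ_imp_Suc)
  moreover have "\<forall>\<^sub>F k in sequentially. (LINT x|lborel. s k x) =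
      (variation k b y f + variation k b' (- y) f) / real k ^ (CARD('n) - 1)"
    using eventually_gt_at_top[of 0] by eventually_elim (rule sum_eq[symmetric])
  ultimately show ?thesis by (rule Lim_transform_eventually)
qed

end

context lattice_polytope
begin

lemma compact_P: "compact (moment_polytope L)"
  using bnd closed_moment_polytope by (simp add: compact_eq_bounded_closed)

lemma integrable_on_P:
  "continuous_on UNIV f \<Longrightarrow> integrable lborel (\<lambda>x. indicator (moment_polytope L) x * f x :: real)"
  using borel_integrable_compact[OF compact_P, of f] continuous_on_subset[of UNIV f "moment_polytope L"] by simp

lemma translate_in_dilation_iff:
  assumes "0 < k"
  shows "(rvec I + y) /\<^sub>R real k \<in> moment_polytope L
    \<longleftrightarrow> I \<in> lattice_points L k (\<lambda>ell. \<lfloor>- (rvec ell \<bullet> y)\<rfloor>)"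
proof -
  have "rvec ell \<bullet> ((rvec I + y) /\<^sub>R real k) \<le> 1 \<longleftrightarrow> pairing ell I \<le> int k + \<lfloor>- (rvec ell \<bullet> y)\<rfloor>" for ell
  proof -
    have "rvec ell \<bullet> ((rvec I + y) /\<^sub>R real k) \<le> 1 \<longleftrightarrow> real_of_int (pairing ell I - int k) \<le> - (rvec ell \<bullet> y)"
      using assms by (simp add: inner_add_right rvec_inner_pairing field_simps)
    also have "\<dots> \<longleftrightarrow> pairing ell I - int k \<le> \<lfloor>- (rvec ell \<bullet> y)\<rfloor>" by (rule le_floor_iff[symmetric])
    also have "\<dots> \<longleftrightarrow> pairing ell I \<le> int k + \<lfloor>- (rvec ell \<bullet> y)\<rfloor>" by linarith
    finally show ?thesis .
  qed
  then show ?thesis by (simp add: moment_polytope_def lattice_points_def)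
qed

text \<open>
  Averaging over a unit cube of translations \<open>y\<close> turns the integral into lattice sums over the
  polytopes with facets moved to \<open>\<lfloor>- ell(y)\<rfloor>\<close>. Averaging \<open>y\<close> with \<open>-y\<close> removes the first-order
  variation of \<open>f\<close>, and since \<open>\<lfloor>t\<rfloor> + \<lfloor>-t\<rfloor> = -1\<close> off the integers it moves every facet inwards by
  one half on average.
\<close>

theorem euler_maclaurin:
  assumes f: "ae_smooth f"
  shows "(\<lambda>k. (lattice_sum k (\<lambda>_. 0) f - real k ^ CARD('n) * (LINT x:moment_polytope L|lborel. f x))
      / real k ^ (CARD('n) - 1)) \<longlonglongrightarrow> boundary_term f / 2"
proof -
  let ?P = "moment_polytope L" and ?n = "real CARD('n)"
  let ?C = "{y :: real ^ 'n. floor_vec y = 0}"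
  have cont: "continuous_on UNIV f" using f by (rule ae_smooth_continuous)
  define F where "F x = indicator ?P x * f x" for x
  have F: "integrable lborel F" unfolding F_def using integrable_on_P[OF cont] .
  have Fm: "F \<in> borel_measurable borel" using borel_measurable_integrable[OF F] by simp
  define \<beta> where "\<beta> y ell = \<lfloor>- (rvec ell \<bullet> y)\<rfloor>" for y :: "real ^ 'n" and ell
  define B where "B = nat \<lceil>(\<Sum>ell\<in>L. norm (rvec ell)) * ?n\<rceil> + 1"
  have \<beta>_bound: "\<bar>\<beta> y ell\<bar> \<le> int B" if "ell \<in> L" "norm y \<le> ?n" for y ell
  proof -
    have "\<bar>rvec ell \<bullet> y\<bar> \<le> norm (rvec ell) * norm y" by (rule Cauchy_Schwarz_ineq2)
    also have "\<dots> \<le> (\<Sum>ell\<in>L. norm (rvec ell)) * ?n"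
      using that fin by (intro mult_mono member_le_sum sum_nonneg) auto
    finally show ?thesis unfolding \<beta>_def B_def by linarith
  qed
  let ?N = "\<lambda>k. lattice_points L k (\<lambda>_. int B)"
  have \<beta>_sub: "lattice_points L k (\<beta> y) \<subseteq> ?N k" if "norm y \<le> ?n" for k y
    using \<beta>_bound that by (intro lattice_points_mono) (metis abs_le_iff)
  have normC: "norm y \<le> ?n" if "y \<in> ?C" for y
    using norm_floor_vec[of y] that by simp
  define H where "H k z = F (z /\<^sub>R real k)" for k z
  have H_eq: "H k (rvec I + y) = (if I \<in> lattice_points L k (\<beta> y) then f ((rvec I + y) /\<^sub>R real k) else 0)"
    if "0 < k" for k I y
    using translate_in_dilation_iff[OF that, of I y] by (simp add: H_def F_def \<beta>_def[abs_def])
  have H_eq': "H k (rvec I - y) = (if I \<in> lattice_points L k (\<beta> (- y)) then f ((rvec I - y) /\<^sub>R real k) else 0)"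
    if "0 < k" for k I y
    using H_eq[OF that, of I "- y"] by simp
  define T where "T k y = (\<Sum>I\<in>?N k. H k (rvec I + y) + H k (rvec I - y))" for k y
  \<comment> \<open>the integral of \<open>E k\<close> is twice the rescaled error, and it is computed pointwise in \<open>y\<close>\<close>
  define E where "E k y = indicator ?C y * ((2 * lattice_sum k (\<lambda>_. 0) f - T k y) / real k ^ (CARD('n) - 1))" for k y
  have C1: "integrable lborel (indicator ?C :: _ \<Rightarrow> real)" "(LINT y|lborel. indicator ?C y) = (1 :: real)"
    using emeasure_cube[of "0 :: int ^ 'n"] cube_measurable[of "0 :: int ^ 'n"]
    by (auto intro!: integrable_real_indicator simp: measure_def)
  have E_int: "integrable lborel (E k)"
    and E_val: "(LINT y|lborel. E k y) = 2 * ((lattice_sum k (\<lambda>_. 0) f - real k ^ CARD('n) * (LINT x:?P|lborel. f x)) / real k ^ (CARD('n) - 1))"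
    if k: "0 < k" for k
  proof -
    have Hm: "H k \<in> borel_measurable borel"
      unfolding H_def by (rule measurable_compose[OF _ Fm]) measurable
    have Hi: "integrable lborel (H k)"
    proof -
      have "compact ((\<lambda>x. real k *\<^sub>R x) ` ?P)" by (rule compact_scaling[OF compact_P])
      moreover have "continuous_on ((\<lambda>x. real k *\<^sub>R x) ` ?P) (\<lambda>z. f (z /\<^sub>R real k))"
        by (intro continuous_on_compose2[OF cont] continuous_intros) auto
      ultimately have "integrable lborel (\<lambda>z. indicator ((\<lambda>x. real k *\<^sub>R x) ` ?P) z *\<^sub>R f (z /\<^sub>R real k))"
        by (rule borel_integrable_compact)
      moreover have "z \<in> (\<lambda>x. real k *\<^sub>R x) ` ?P \<longleftrightarrow> z /\<^sub>R real k \<in> ?P" for z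
        using k by (auto simp: image_iff intro!: bexI[of _ "z /\<^sub>R real k"])
      ultimately show ?thesis by (simp add: H_def[abs_def] F_def indicator_def)
    qed
    have mem: "I \<in> ?N k" if "H k (rvec I + y) \<noteq> 0" "norm y \<le> ?n" for I y
      using that H_eq[OF k, of I y] \<beta>_sub[of y k] by (auto split: if_splits)
    have "floor_vec z \<in> ?N k" if "H k z \<noteq> 0" for z
      using mem[of "floor_vec z" "z - rvec (floor_vec z)"] that norm_floor_vec[of z] by (simp add: norm_minus_commute)
    \<comment> \<open>the cubes \<open>I + C\<close> and \<open>I - C\<close> both tile, which gives the translations \<open>y\<close> and \<open>-y\<close>\<close>
    note i1 = integral_over_cube[OF Hi finite_lattice_points_dilated this]
    have "floor_vec z \<in> uminus ` ?N k" if "H k (- z) \<noteq> 0" for z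
      using mem[of "- floor_vec z" "rvec (floor_vec z) - z"] that norm_floor_vec[of z]
      by (intro image_eqI[of _ _ "- floor_vec z"]) (simp_all add: rvec_minus)
    note i2 = integral_over_cube[OF lborel_integral_reflect(2)[OF Hi] finite_imageI[OF finite_lattice_points_dilated] this]
    have s2: "(\<Sum>I\<in>uminus ` ?N k. H k (- (y + rvec I))) = (\<Sum>I\<in>?N k. H k (rvec I - y))" for y
      by (subst sum.reindex) (auto simp: rvec_minus inj_on_def)
    have s1: "(\<Sum>I\<in>?N k. H k (y + rvec I)) = (\<Sum>I\<in>?N k. H k (rvec I + y))" for y
      by (simp add: add.commute)
    have Ti: "integrable lborel (\<lambda>y. indicator ?C y * T k y)"
      and Tv: "(LINT y|lborel. indicator ?C y * T k y) = 2 * (LINT z|lborel. H k z)"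
      using i1 i2 lborel_integral_reflect(1)[OF Hi] unfolding s1 s2 T_def sum.distrib distrib_left by simp_all
    have HF: "(LINT z|lborel. H k z) = real k ^ CARD('n) * (LINT x:?P|lborel. f x)"
      using lborel_integral_scale[OF Hm, of "real k"] k
      by (simp add: H_def F_def[abs_def] set_lebesgue_integral_def)
    have E: "E k y = (2 * lattice_sum k (\<lambda>_. 0) f * indicator ?C y - indicator ?C y * T k y) / real k ^ (CARD('n) - 1)" for y
      by (simp add: E_def algebra_simps diff_divide_distrib)
    show "integrable lborel (E k)" unfolding E[abs_def] using C1 Ti by simp
    show "(LINT y|lborel. E k y) = 2 * ((lattice_sum k (\<lambda>_. 0) f - real k ^ CARD('n) * (LINT x:?P|lborel. f x)) / real k ^ (CARD('n) - 1))"
      unfolding E[abs_def] using C1 Ti Tv HF by (simp add: diff_divide_distrib right_diff_distrib)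
  qed
  define dev where "dev k y = - ((lattice_sum k (\<beta> y) f - lattice_sum k (\<lambda>_. 0) f) / real k ^ (CARD('n) - 1))
      - ((lattice_sum k (\<beta> (- y)) f - lattice_sum k (\<lambda>_. 0) f) / real k ^ (CARD('n) - 1))
      - (variation k (\<beta> y) y f + variation k (\<beta> (- y)) (- y) f) / real k ^ (CARD('n) - 1)" for k y
  have split: "(2 * lattice_sum k (\<lambda>_. 0) f - T k y) / real k ^ (CARD('n) - 1) = dev k y" if y: "norm y \<le> ?n" and k: "0 < k" for k y
  proof -
    have "(\<Sum>I\<in>?N k. H k (rvec I + y)) = (\<Sum>I\<in>lattice_points L k (\<beta> y). f ((rvec I + y) /\<^sub>R real k))"
      by (rule sum.mono_neutral_cong_right) (use \<beta>_sub[OF y] in \<open>auto simp: H_eq[OF k] finite_lattice_points_dilated\<close>)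
    moreover have "(\<Sum>I\<in>?N k. H k (rvec I - y)) = (\<Sum>I\<in>lattice_points L k (\<beta> (- y)). f ((rvec I - y) /\<^sub>R real k))"
      by (rule sum.mono_neutral_cong_right) (use \<beta>_sub[of "- y"] y in \<open>auto simp: H_eq'[OF k] finite_lattice_points_dilated\<close>)
    ultimately have T: "T k y = (\<Sum>I\<in>lattice_points L k (\<beta> y). f ((rvec I + y) /\<^sub>R real k))
        + (\<Sum>I\<in>lattice_points L k (\<beta> (- y)). f ((rvec I - y) /\<^sub>R real k))"
      by (simp add: T_def sum.distrib)
    show ?thesis
      unfolding T dev_def variation_def sum_subtractf lattice_sum_def[of k "\<beta> y"] lattice_sum_def[of k "\<beta> (- y)"]
      by (simp add: add_divide_distrib diff_divide_distrib)
  qed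
  obtain D where D: "\<And>k b. 0 < k \<Longrightarrow> (\<And>ell. ell \<in> L \<Longrightarrow> \<bar>b ell\<bar> \<le> int B) \<Longrightarrow>
    \<bar>lattice_sum k b f - lattice_sum k (\<lambda>_. 0) f\<bar> \<le> D * real k ^ (CARD('n) - 1)"
    using shift_bound[OF f, of B] by blast
  obtain c where c: "\<And>k. 0 < k \<Longrightarrow> real (card (?N k)) \<le> c * real k ^ CARD('n)"
    using card_lattice_points_bound[of B] by blast
  obtain K where K: "0 \<le> K" "\<And>k I z. 0 < k \<Longrightarrow> I \<in> ?N k \<Longrightarrow> norm z \<le> ?n \<Longrightarrow>
      \<bar>f ((rvec I + z) /\<^sub>R real k) - f (rvec I /\<^sub>R real k)\<bar> \<le> K * ?n / real k"
    using lattice_variation_bound[OF f, of B ?n] by blast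
  have vari: "\<bar>variation k (\<beta> z) z f\<bar> \<le> c * K * ?n * real k ^ (CARD('n) - 1)" if k: "0 < k" and z: "norm z \<le> ?n" for k z
  proof -
    have "\<bar>variation k (\<beta> z) z f\<bar> \<le> (\<Sum>I\<in>lattice_points L k (\<beta> z). K * ?n / real k)"
      unfolding variation_def using \<beta>_sub[OF z, of k] k z by (intro order.trans[OF sum_abs sum_mono] K) auto
    also have "\<dots> = real (card (lattice_points L k (\<beta> z))) * (K * ?n / real k)" by simp
    also have "\<dots> \<le> real (card (?N k)) * (K * ?n / real k)"
      using \<beta>_sub[OF z, of k] K(1) by (intro mult_right_mono of_nat_mono card_mono finite_lattice_points_dilated) auto
    also have "\<dots> \<le> c * real k ^ CARD('n) * (K * ?n / real k)"
      using K(1) by (intro mult_right_mono c k) auto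
    also have "real k ^ CARD('n) = real k * real k ^ (CARD('n) - 1)"
      by (metis power_eq_if zero_less_card_finite less_irrefl)
    finally show ?thesis using k by (simp add: mult_ac)
  qed
  have "(\<lambda>k. LINT y|lborel. E (Suc k) y) \<longlonglongrightarrow> (LINT y|lborel. indicator ?C y * boundary_term f)"
  proof (rule integral_dominated_convergence)
    show "integrable lborel (\<lambda>y. indicator ?C y * (2 * D + 2 * (c * K * ?n)))" using C1(1) by simp
    show "AE y in lborel. norm (E (Suc k) y) \<le> indicator ?C y * (2 * D + 2 * (c * K * ?n))" for k
    proof (rule AE_I2)
      fix y
      show "norm (E (Suc k) y) \<le> indicator ?C y * (2 * D + 2 * (c * K * ?n))"
      proof (cases "y \<in> ?C")
        case False
        then show ?thesis by (simp add: E_def)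
      next
        case True
        let ?q = "real (Suc k) ^ (CARD('n) - 1)"
        have y: "norm y \<le> ?n" "norm (- y) \<le> ?n" using normC[OF True] by simp_all
        have div: "\<bar>x / ?q\<bar> \<le> d" if "\<bar>x\<bar> \<le> d * ?q" for x d
          using that by (simp add: abs_divide pos_divide_le_eq)
        have 1: "\<bar>(lattice_sum (Suc k) (\<beta> y) f - lattice_sum (Suc k) (\<lambda>_. 0) f) / ?q\<bar> \<le> D"
          "\<bar>(lattice_sum (Suc k) (\<beta> (- y)) f - lattice_sum (Suc k) (\<lambda>_. 0) f) / ?q\<bar> \<le> D"
          using y by (intro div D \<beta>_bound; simp)+
        have 2: "\<bar>(variation (Suc k) (\<beta> y) y f + variation (Suc k) (\<beta> (- y)) (- y) f) / ?q\<bar> \<le> 2 * (c * K * ?n)"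
          using vari[of "Suc k" y] vari[of "Suc k" "- y"] y by (intro div) simp
        have "norm (E (Suc k) y) = \<bar>(2 * lattice_sum (Suc k) (\<lambda>_. 0) f - T (Suc k) y) / ?q\<bar>"
          using True by (simp add: E_def)
        also have "\<dots> \<le> 2 * D + 2 * (c * K * ?n)"
          unfolding split[OF y(1) zero_less_Suc] dev_def using 1 2 by linarith
        finally show ?thesis using True by simp
      qed
    qed
    show "E (Suc k) \<in> borel_measurable lborel" for k
      using E_int[of "Suc k"] by (intro borel_measurable_integrable) simp
    show "(\<lambda>y. indicator ?C y * boundary_term f) \<in> borel_measurable lborel"
      using C1(1) by (intro borel_measurable_integrable) simp
    have "AE y in lborel. \<forall>ell\<in>L. \<forall>i::int. rvec ell \<bullet> y \<noteq> real_of_int i"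
      by (intro AE_finite_allI fin) (simp add: AE_all_countable AE_not_on_hyperplane rvec_nonzero)
    then have "AE y in lborel. (\<lambda>k. E k y) \<longlonglongrightarrow> indicator ?C y * boundary_term f"
    proof eventually_elim
      case (elim y)
      show ?case
      proof (cases "y \<in> ?C")
        case False
        then show ?thesis by (simp add: E_def)
      next
        case True
        then have y: "norm y \<le> ?n" "norm (- y) \<le> ?n" using normC by simp_all
        have neg: "real_of_int (\<beta> y ell) + real_of_int (\<beta> (- y) ell) = -1" if "ell \<in> L" for ell
        proof -
          have "real_of_int \<lfloor>rvec ell \<bullet> y\<rfloor> \<noteq> rvec ell \<bullet> y" using elim that by metis
          then have "\<lfloor>rvec ell \<bullet> y\<rfloor> + \<lfloor>- (rvec ell \<bullet> y)\<rfloor> = -1" by linarith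
          then show ?thesis by (simp add: \<beta>_def flip: of_int_add)
        qed
        have "(\<lambda>k. dev k y)
          \<longlonglongrightarrow> - (\<Sum>ell\<in>L. real_of_int (\<beta> y ell) * facet_integral L ell f)
            - (\<Sum>ell\<in>L. real_of_int (\<beta> (- y) ell) * facet_integral L ell f) - 0"
          unfolding dev_def using y \<beta>_bound
          by (intro tendsto_intros shift_limit[OF cont] symmetric_difference_limit[OF f, of _ B]) (metis abs_le_iff)+
        also have "- (\<Sum>ell\<in>L. real_of_int (\<beta> y ell) * facet_integral L ell f)
            - (\<Sum>ell\<in>L. real_of_int (\<beta> (- y) ell) * facet_integral L ell f) - 0
          = - (\<Sum>ell\<in>L. (real_of_int (\<beta> y ell) + real_of_int (\<beta> (- y) ell)) * facet_integral L ell f)"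
          by (simp add: distrib_right sum.distrib)
        also have "\<dots> = boundary_term f" by (simp add: neg boundary_term_def sum_negf)
        finally have lim: "(\<lambda>k. dev k y) \<longlonglongrightarrow> boundary_term f" .
        have "\<forall>\<^sub>F k in sequentially. dev k y = E k y"
          using eventually_gt_at_top[of 0]
          by eventually_elim (use split[OF y(1)] True in \<open>simp add: E_def\<close>)
        from Lim_transform_eventually[OF lim this] show ?thesis using True by simp
      qed
    qed
    then show "AE y in lborel. (\<lambda>k. E (Suc k) y) \<longlonglongrightarrow> indicator ?C y * boundary_term f"
      by eventually_elim (rule LIMSEQ_Suc)
  qed
  then have "(\<lambda>k. LINT y|lborel. E (Suc k) y) \<longlonglongrightarrow> boundary_term f"
    using C1 by simp
  then have "(\<lambda>k. LINT y|lborel. E k y) \<longlonglongrightarrow> boundary_term f" by (rule LIMSEQ_imp_Suc)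
  then have "(\<lambda>k. (LINT y|lborel. E k y) / 2) \<longlonglongrightarrow> boundary_term f / 2" by (intro tendsto_intros) simp_all
  moreover have "\<forall>\<^sub>F k in sequentially. (LINT y|lborel. E k y) / 2
      = (lattice_sum k (\<lambda>_. 0) f - real k ^ CARD('n) * (LINT x:?P|lborel. f x)) / real k ^ (CARD('n) - 1)"
    using eventually_gt_at_top[of 0]
  proof eventually_elim
    case (elim k)
    have half: "2 * x / 2 = x" for x :: real by simp
    show ?case unfolding E_val[OF elim] by (rule half)
  qed
  ultimately show ?thesis by (rule Lim_transform_eventually)
qed

lemma lattice_sum_leading_term:
  assumes f: "ae_smooth f"
  shows "(\<lambda>k. lattice_sum k (\<lambda>_. 0) f / real k ^ CARD('n)) \<longlonglongrightarrow> (LINT x:moment_polytope L|lborel. f x)"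
proof -
  let ?I = "LINT x:moment_polytope L|lborel. f x"
  have lim: "(\<lambda>k. (lattice_sum k (\<lambda>_. 0) f - real k ^ CARD('n) * ?I) / real k ^ (CARD('n) - 1) * (1 / real k) + ?I)
      \<longlonglongrightarrow> boundary_term f / 2 * 0 + ?I"
    by (intro tendsto_intros euler_maclaurin[OF f] lim_const_over_n)
  have ev: "\<forall>\<^sub>F k in sequentially. (lattice_sum k (\<lambda>_. 0) f - real k ^ CARD('n) * ?I) / real k ^ (CARD('n) - 1) * (1 / real k) + ?I
      = lattice_sum k (\<lambda>_. 0) f / real k ^ CARD('n)"
    using eventually_gt_at_top[of 0]
  proof eventually_elim
    case (elim k)
    have "real k ^ CARD('n) = real k ^ (CARD('n) - 1) * real k"
      by (metis mult.commute power_eq_if zero_less_card_finite less_irrefl)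
    then have "(lattice_sum k (\<lambda>_. 0) f - real k ^ CARD('n) * ?I) / real k ^ (CARD('n) - 1) * (1 / real k)
      = (lattice_sum k (\<lambda>_. 0) f - real k ^ CARD('n) * ?I) / real k ^ CARD('n)" by simp
    also have "\<dots> = lattice_sum k (\<lambda>_. 0) f / real k ^ CARD('n) - ?I"
      using elim by (simp add: diff_divide_distrib)
    finally show ?case by simp
  qed
  from Lim_transform_eventually[OF lim ev] show ?thesis by simp
qed

end

section \<open>The expansion of the modified Futaki invariant\<close>

context lattice_polytope
begin

lemma shrink_limit:
  assumes "ae_smooth f"
  shows "(\<lambda>k. (lattice_sum k (\<lambda>_. 0) f - lattice_sum k (\<lambda>_. -1) f) / real k ^ (CARD('n) - 1))
    \<longlonglongrightarrow> boundary_term f"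
  using tendsto_minus[OF shift_limit[OF ae_smooth_continuous[OF assms], of "\<lambda>_. -1"]]
  by (simp add: boundary_term_def sum_negf minus_divide_left del: tendsto_minus_cancel_left)

lemma pow_card: "x ^ CARD('n) = x * x ^ (CARD('n) - 1)" for x :: real
  by (metis power_eq_if zero_less_card_finite less_irrefl)

lemma exp_second_order:
  fixes t :: real
  assumes "\<bar>t\<bar> \<le> c"
  shows "\<bar>exp t - 1 - t\<bar> \<le> exp c * t\<^sup>2"
proof -
  obtain s where s: "\<bar>s\<bar> \<le> \<bar>t\<bar>" "exp t = (\<Sum>m<2. t ^ m / fact m) + exp s / fact 2 * t ^ 2"
    using Maclaurin_exp_le[of t 2] by blast
  have "exp t - 1 - t = exp s / 2 * t\<^sup>2" using s(2) by (simp add: numeral_2_eq_2)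
  then have "\<bar>exp t - 1 - t\<bar> = \<bar>exp s / 2 * t\<^sup>2\<bar>" by (rule arg_cong)
  also have "\<dots> = exp s / 2 * t\<^sup>2" by (simp add: abs_mult)
  also have "\<dots> \<le> exp c * t\<^sup>2"
  proof (intro mult_right_mono)
    have "exp s \<le> exp c" using s(1) assms by simp
    then show "exp s / 2 \<le> exp c" using exp_gt_zero[of s] by linarith
  qed simp
  finally show ?thesis .
qed

text \<open>
  The divergence theorem for the field \<open>x e\<^sup>\<theta>\<^sup>(\<^sup>x\<^sup>)\<close>. As all facets have lattice distance \<open>1\<close> from the
  origin, moving every facet inwards by one layer turns \<open>k P\<close> into \<open>(k - 1) P\<close>; the change of the
  lattice sum is the boundary integral, and by the asymptotics of both sums it is also the
  derivative of a dilation.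
\<close>

theorem divergence_identity:
  "boundary_term (\<lambda>x. exp (\<theta> \<bullet> x))
    = (LINT x:moment_polytope L|lborel. (real CARD('n) + \<theta> \<bullet> x) * exp (\<theta> \<bullet> x))"
proof -
  define f where "f x = exp (\<theta> \<bullet> x)" for x
  define g where "g x = \<theta> \<bullet> x * exp (\<theta> \<bullet> x)" for x
  have f: "ae_smooth f" and g: "ae_smooth g"
    unfolding f_def g_def by (intro ae_smooth_exp ae_smooth_mult ae_smooth_inner)+
  let ?P = "moment_polytope L" and ?n = "CARD('n)"
  let ?F = "LINT x:?P|lborel. f x" and ?G = "LINT x:?P|lborel. g x"
  let ?A = "\<lambda>k. lattice_sum k (\<lambda>_. 0)"
  have shift: "lattice_points L (Suc k) (\<lambda>_. -1) = lattice_points L k (\<lambda>_. 0)" for k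
    by (simp add: lattice_points_def)
  define c where "c = norm \<theta> * radius"
  \<comment> \<open>the second-order remainder when the scaling of \<open>k P\<close> changes from \<open>1/k\<close> to \<open>1/(k + 1)\<close>\<close>
  define err where "err k = lattice_sum (Suc k) (\<lambda>_. -1) f - ?A k f + ?A k g / real (Suc k)" for k
  have err_bound: "\<bar>err k\<bar> \<le> exp c * c\<^sup>2 / real (Suc k) ^ 2 * ?A k f" if k: "0 < k" for k
  proof -
    have term_bound: "\<bar>f (rvec I /\<^sub>R real (Suc k)) - f (rvec I /\<^sub>R real k) + g (rvec I /\<^sub>R real k) / real (Suc k)\<bar>
        \<le> exp c * c\<^sup>2 / real (Suc k) ^ 2 * f (rvec I /\<^sub>R real k)" if I: "I \<in> lattice_points L k (\<lambda>_. 0)" for I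
    proof -
      define x where "x = rvec I /\<^sub>R real k"
      define t where "t = - (\<theta> \<bullet> x) / real (Suc k)"
      have "norm x \<le> radius"
        using norm_lattice_points[OF I k, of 0] by (simp add: x_def)
      then have tx: "\<bar>\<theta> \<bullet> x\<bar> \<le> c"
        using Cauchy_Schwarz_ineq2[of \<theta> x] mult_left_mono[of "norm x" radius "norm \<theta>"] by (simp add: c_def)
      have c0: "0 \<le> c" using tx by linarith
      have "\<bar>t\<bar> = \<bar>\<theta> \<bullet> x\<bar> / real (Suc k)" by (simp add: t_def abs_divide)
      also have "\<dots> \<le> c / real (Suc k)" using tx by (intro divide_right_mono) simp_all
      finally have t1: "\<bar>t\<bar> \<le> c / real (Suc k)" .
      also have "c / real (Suc k) \<le> c" using c0 by (simp add: divide_le_eq mult_le_cancel_left1)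
      finally have t2: "\<bar>t\<bar> \<le> c" .
      have "rvec I /\<^sub>R real (Suc k) = (real k / real (Suc k)) *\<^sub>R x"
        using k by (simp add: x_def divide_inverse)
      moreover have "\<theta> \<bullet> ((real k / real (Suc k)) *\<^sub>R x) = \<theta> \<bullet> x + t"
        by (simp add: t_def field_simps)
      ultimately have "f (rvec I /\<^sub>R real (Suc k)) = f x * exp t" by (simp add: f_def exp_add)
      then have "f (rvec I /\<^sub>R real (Suc k)) - f x + g x / real (Suc k) = f x * (exp t - 1 - t)"
        by (simp add: f_def g_def t_def algebra_simps)
      then have "\<bar>f (rvec I /\<^sub>R real (Suc k)) - f x + g x / real (Suc k)\<bar> = f x * \<bar>exp t - 1 - t\<bar>"
        by (simp add: abs_mult f_def)
      also have "\<dots> \<le> f x * (exp c * (c / real (Suc k))\<^sup>2)"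
      proof (intro mult_left_mono)
        have "t\<^sup>2 \<le> (c / real (Suc k))\<^sup>2" using t1 by (metis abs_ge_zero power2_abs power_mono)
        then show "\<bar>exp t - 1 - t\<bar> \<le> exp c * (c / real (Suc k))\<^sup>2"
          using exp_second_order[OF t2] by (meson exp_ge_zero mult_left_mono order.trans)
      qed (simp add: f_def)
      finally show ?thesis by (simp add: x_def power_divide mult_ac)
    qed
    have "err k = (\<Sum>I\<in>lattice_points L k (\<lambda>_. 0). f (rvec I /\<^sub>R real (Suc k)) - f (rvec I /\<^sub>R real k) + g (rvec I /\<^sub>R real k) / real (Suc k))"
      unfolding err_def lattice_sum_def shift by (simp only: sum.distrib sum_subtractf sum_divide_distrib)
    also have "\<bar>\<dots>\<bar> \<le> (\<Sum>I\<in>lattice_points L k (\<lambda>_. 0). exp c * c\<^sup>2 / real (Suc k) ^ 2 * f (rvec I /\<^sub>R real k))"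
      by (rule order.trans[OF sum_abs sum_mono]) (rule term_bound)
    also have "\<dots> = exp c * c\<^sup>2 / real (Suc k) ^ 2 * ?A k f"
      unfolding lattice_sum_def by (rule sum_distrib_left[symmetric])
    finally show ?thesis .
  qed
  have ratio: "(\<lambda>k. real k / real (Suc k)) \<longlonglongrightarrow> 1" by (rule LIMSEQ_n_over_Suc_n)
  have ratio_pow: "(\<lambda>k. (real k / real (Suc k)) ^ m) \<longlonglongrightarrow> 1" for m
    using tendsto_power[OF ratio, of m] by simp
  have inv: "(\<lambda>k. 1 / real (Suc k)) \<longlonglongrightarrow> 0" using LIMSEQ_inverse_real_of_nat by (simp add: inverse_eq_divide)
  note lead = lattice_sum_leading_term and em = euler_maclaurin
  have Suc0: "real (Suc k) \<noteq> 0" for k by simp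
  have err0: "(\<lambda>k. err k / real (Suc k) ^ (?n - 1)) \<longlonglongrightarrow> 0"
  proof (rule Lim_null_comparison)
    show "\<forall>\<^sub>F k in sequentially. norm (err k / real (Suc k) ^ (?n - 1))
        \<le> exp c * c\<^sup>2 * (1 / real (Suc k)) * (?A k f / real k ^ ?n) * (real k / real (Suc k)) ^ ?n"
      using eventually_gt_at_top[of 0]
    proof eventually_elim
      case (elim k)
      have "norm (err k / real (Suc k) ^ (?n - 1)) = \<bar>err k\<bar> / real (Suc k) ^ (?n - 1)"
        by (simp add: abs_divide)
      also have "\<dots> \<le> (exp c * c\<^sup>2 / real (Suc k) ^ 2 * ?A k f) / real (Suc k) ^ (?n - 1)"
        by (intro divide_right_mono err_bound elim) simp
      also have "\<dots> = exp c * c\<^sup>2 * (1 / real (Suc k)) * (?A k f / real k ^ ?n) * (real k / real (Suc k)) ^ ?n"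
      proof -
        have "real k ^ ?n \<noteq> 0" using elim by simp
        then show ?thesis unfolding power_divide pow_card[of "real (Suc k)"]
          by (simp add: power2_eq_square del: of_nat_Suc)
      qed
      finally show ?case .
    qed
    have "(\<lambda>k. exp c * c\<^sup>2 * (1 / real (Suc k)) * (?A k f / real k ^ ?n) * (real k / real (Suc k)) ^ ?n)
      \<longlonglongrightarrow> exp c * c\<^sup>2 * 0 * ?F * 1"
      by (intro tendsto_mult tendsto_const inv lead f ratio_pow)
    then show "(\<lambda>k. exp c * c\<^sup>2 * (1 / real (Suc k)) * (?A k f / real k ^ ?n) * (real k / real (Suc k)) ^ ?n) \<longlonglongrightarrow> 0"
      by simp
  qed
  have pow_diff: "(\<lambda>k. (real (Suc k) ^ ?n - real k ^ ?n) / real (Suc k) ^ (?n - 1)) \<longlonglongrightarrow> real ?n"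
  proof -
    have "(\<lambda>k. \<Sum>i<?n. (real k / real (Suc k)) ^ (?n - Suc i)) \<longlonglongrightarrow> (\<Sum>i<?n. 1)"
      by (intro tendsto_sum ratio_pow)
    moreover have "(real (Suc k) ^ ?n - real k ^ ?n) / real (Suc k) ^ (?n - 1) = (\<Sum>i<?n. (real k / real (Suc k)) ^ (?n - Suc i))" for k
    proof -
      have "real (Suc k) ^ ?n - real k ^ ?n = (\<Sum>i<?n. real k ^ (?n - Suc i) * real (Suc k) ^ i)"
        using diff_power_eq_sum[of "real (Suc k)" "?n - 1" "real k"]
        by (simp add: lessThan_Suc_atMost) (rule sum.cong[OF refl mult.commute])
      also have "\<dots> / real (Suc k) ^ (?n - 1) = (\<Sum>i<?n. (real k / real (Suc k)) ^ (?n - Suc i))"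
        unfolding sum_divide_distrib
      proof (intro sum.cong refl)
        fix i assume "i \<in> {..<?n}"
        then have "real (Suc k) ^ (?n - 1) = real (Suc k) ^ (?n - Suc i) * real (Suc k) ^ i"
          by (simp flip: power_add)
        then show "real k ^ (?n - Suc i) * real (Suc k) ^ i / real (Suc k) ^ (?n - 1) = (real k / real (Suc k)) ^ (?n - Suc i)"
          by (simp add: power_divide)
      qed
      finally show ?thesis .
    qed
    ultimately show ?thesis by simp
  qed
  have lim: "(\<lambda>k. (?A (Suc k) f - real (Suc k) ^ ?n * ?F) / real (Suc k) ^ (?n - 1)
      - (?A k f - real k ^ ?n * ?F) / real k ^ (?n - 1) * (real k / real (Suc k)) ^ (?n - 1)
      + (real (Suc k) ^ ?n - real k ^ ?n) / real (Suc k) ^ (?n - 1) * ?F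
      + ?A k g / real k ^ ?n * (real k / real (Suc k)) ^ ?n - err k / real (Suc k) ^ (?n - 1))
    \<longlonglongrightarrow> boundary_term f / 2 - boundary_term f / 2 * 1 + real ?n * ?F + ?G * 1 - 0"
    by (intro tendsto_add tendsto_diff tendsto_mult tendsto_const LIMSEQ_Suc[OF em[OF f]] em lead f g ratio_pow pow_diff err0)
  have "\<forall>\<^sub>F k in sequentially. (?A (Suc k) f - real (Suc k) ^ ?n * ?F) / real (Suc k) ^ (?n - 1)
      - (?A k f - real k ^ ?n * ?F) / real k ^ (?n - 1) * (real k / real (Suc k)) ^ (?n - 1)
      + (real (Suc k) ^ ?n - real k ^ ?n) / real (Suc k) ^ (?n - 1) * ?F
      + ?A k g / real k ^ ?n * (real k / real (Suc k)) ^ ?n - err k / real (Suc k) ^ (?n - 1)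
    = (?A (Suc k) f - lattice_sum (Suc k) (\<lambda>_. -1) f) / real (Suc k) ^ (?n - 1)"
    using eventually_gt_at_top[of 0]
  proof eventually_elim
    case (elim k)
    define q where "q = real (Suc k) ^ (?n - 1)"
    have 1: "(?A k f - real k ^ ?n * ?F) / real k ^ (?n - 1) * (real k / real (Suc k)) ^ (?n - 1) = (?A k f - real k ^ ?n * ?F) / q"
      using elim by (simp add: power_divide q_def)
    have 2: "?A k g / real k ^ ?n * (real k / real (Suc k)) ^ ?n = ?A k g / real (Suc k) / q"
      using elim unfolding power_divide pow_card[of "real (Suc k)"] q_def by (simp del: of_nat_Suc)
    show ?case unfolding 1 2 q_def[symmetric] err_def
      by (simp add: diff_divide_distrib add_divide_distrib left_diff_distrib)
  qed
  from Lim_transform_eventually[OF lim this]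
  have "(\<lambda>k. (?A (Suc k) f - lattice_sum (Suc k) (\<lambda>_. -1) f) / real (Suc k) ^ (?n - 1)) \<longlonglongrightarrow> real ?n * ?F + ?G"
    by simp
  from LIMSEQ_unique[OF LIMSEQ_Suc[OF shrink_limit[OF f]] this]
  have "boundary_term f = real ?n * ?F + ?G" .
  also have "\<dots> = (LINT x:?P|lborel. real ?n * f x + g x)"
  proof -
    have "set_integrable lborel ?P f" "set_integrable lborel ?P g"
      using integrable_on_P[OF ae_smooth_continuous[OF f]] integrable_on_P[OF ae_smooth_continuous[OF g]]
      by (simp_all add: set_integrable_def)
    then show ?thesis by (simp add: set_integral_add)
  qed
  finally show ?thesis by (simp add: f_def[abs_def] g_def distrib_right)
qed

text \<open>
  With \<open>g = e\<^sup>\<theta> (R - u)\<close> the quotient is \<open>- (A\<^sub>k(g) - A\<^sub>k(\<theta> g) / (2 k)) / A\<^sub>k(1)\<close>, where \<open>A\<^sub>k\<close> sums over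
  \<open>k P\<close>; two terms of numerator and denominator determine the coefficient of \<open>1/k\<close>.
\<close>

lemma quotient_expansion:
  fixes g h :: "real ^ 'n \<Rightarrow> real"
  assumes g: "ae_smooth g" and h: "ae_smooth h"
  defines "V \<equiv> measure lborel (moment_polytope L)"
  assumes V: "0 < V"
  shows "(\<lambda>k. real k * (- (lattice_sum k (\<lambda>_. 0) g - lattice_sum k (\<lambda>_. 0) h / (2 * real k)) / lattice_sum k (\<lambda>_. 0) (\<lambda>_. 1)
      + (LINT x:moment_polytope L|lborel. g x) / V))
    \<longlonglongrightarrow> 1 / (2 * V) * (real CARD('n) * (LINT x:moment_polytope L|lborel. g x)
        + (LINT x:moment_polytope L|lborel. h x) - boundary_term g)"
proof -
  let ?P = "moment_polytope L" and ?n = "CARD('n)"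
  let ?G = "LINT x:?P|lborel. g x" and ?H = "LINT x:?P|lborel. h x"
  let ?A = "\<lambda>k. lattice_sum k (\<lambda>_. 0)"
  let ?q = "\<lambda>k. real k ^ (?n - 1)"
  have one: "ae_smooth (\<lambda>_ :: real ^ 'n. 1)" by (rule ae_smooth_const)
  have V_int: "(LINT x:?P|lborel. 1) = V"
  proof -
    have "emeasure lborel ?P < \<infinity>" using emeasure_bounded_finite[OF bnd] .
    then show ?thesis using closed_moment_polytope[of L]
      by (simp add: V_def set_lebesgue_integral_def)
  qed
  have bt1: "boundary_term (\<lambda>_. 1) = real ?n * V"
  proof -
    have "(LINT x:?P|lborel. real ?n * 1) = real ?n * (LINT x:?P|lborel. 1)" by (rule set_integral_mult_right)
    then show ?thesis using divergence_identity[of 0]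
      by (simp only: inner_zero_left exp_zero add_0_right mult_1_right V_int)
  qed
  have lim: "(\<lambda>k. (- V * ((?A k g - real k ^ ?n * ?G) / ?q k) + ?G * ((?A k (\<lambda>_. 1) - real k ^ ?n * V) / ?q k)
      + V * (?A k h / real k ^ ?n) / 2) / (V * (?A k (\<lambda>_. 1) / real k ^ ?n)))
    \<longlonglongrightarrow> (- V * (boundary_term g / 2) + ?G * (boundary_term (\<lambda>_. 1) / 2) + V * ?H / 2) / (V * V)"
  proof -
    note one_lims = euler_maclaurin[OF one, unfolded V_int] lattice_sum_leading_term[OF one, unfolded V_int]
    show ?thesis
      by (rule tendsto_divide[OF tendsto_add[OF tendsto_add[OF
            tendsto_mult[OF tendsto_const euler_maclaurin[OF g]]
            tendsto_mult[OF tendsto_const one_lims(1)]]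
            tendsto_divide[OF tendsto_mult[OF tendsto_const lattice_sum_leading_term[OF h]] tendsto_const]]
            tendsto_mult[OF tendsto_const one_lims(2)]]) (use V in simp_all)
  qed
  have val: "(- V * (boundary_term g / 2) + ?G * (boundary_term (\<lambda>_. 1) / 2) + V * ?H / 2) / (V * V)
     = 1 / (2 * V) * (real ?n * ?G + ?H - boundary_term g)"
    using V unfolding bt1 by (simp add: field_simps)
  have "\<forall>\<^sub>F k in sequentially. 0 < ?A k (\<lambda>_. 1) / real k ^ ?n"
    using lattice_sum_leading_term[OF one] V unfolding V_int by (rule order_tendstoD(1))
  then have "\<forall>\<^sub>F k in sequentially. (- V * ((?A k g - real k ^ ?n * ?G) / ?q k) + ?G * ((?A k (\<lambda>_. 1) - real k ^ ?n * V) / ?q k)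
      + V * (?A k h / real k ^ ?n) / 2) / (V * (?A k (\<lambda>_. 1) / real k ^ ?n))
     = real k * (- (?A k g - ?A k h / (2 * real k)) / ?A k (\<lambda>_. 1) + ?G / V)"
    using eventually_gt_at_top[of 0]
  proof eventually_elim
    case (elim k)
    have N: "?A k (\<lambda>_. 1) \<noteq> 0" using elim by auto
    have q: "?q k \<noteq> 0" "real k \<noteq> 0" using elim by auto
    have key: "(- V * ((a - k' * p * G) / p) + G * ((N - k' * p * V) / p) + V * (h' / (k' * p)) / 2) / (V * (N / (k' * p)))
      = k' * (- (a - h' / (2 * k')) / N + G / V)" if "N \<noteq> 0" "p \<noteq> 0" "k' \<noteq> 0" for a k' p G N h' :: real
    proof -
      have "(- V * ((a - k' * p * G) / p) + G * ((N - k' * p * V) / p) + V * (h' / (k' * p)) / 2)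
        = (- V * a + G * N + V * h' / (2 * k')) / p"
        using that by (simp add: field_simps)
      also have "\<dots> / (V * (N / (k' * p))) = k' * ((- V * a + G * N + V * h' / (2 * k')) / (V * N))"
        using that V by simp
      also have "(- V * a + G * N + V * h' / (2 * k')) / (V * N) = - (a - h' / (2 * k')) / N + G / V"
        using that V by (simp add: field_simps)
      finally show ?thesis .
    qed
    show ?case unfolding pow_card by (rule key[OF N q])
  qed
  from Lim_transform_eventually[OF lim this] show ?thesis unfolding val .
qed

end

text \<open>
  The Bezout identity for the entries of \<open>ell\<close>.
\<close>

lemma pairing_primitive:
  assumes "primitive_vector ell"
  obtains I0 where "pairing ell I0 = 1"
proof -
  have "\<exists>c :: 'a \<Rightarrow> int. (\<Sum>j\<in>A. ell $ j * c j) = (GCD j\<in>A. ell $ j)" if "finite A" for A :: "'a set"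
    using that
  proof (induction A rule: finite_induct)
    case (insert a A)
    then obtain c where c: "(\<Sum>j\<in>A. ell $ j * c j) = (GCD j\<in>A. ell $ j)" by blast
    obtain x y where xy: "x * ell $ a + y * (GCD j\<in>A. ell $ j) = gcd (ell $ a) (GCD j\<in>A. ell $ j)"
      using bezout_int by blast
    have "(\<Sum>j\<in>insert a A. ell $ j * (if j = a then x else y * c j)) = ell $ a * x + (\<Sum>j\<in>A. y * (ell $ j * c j))"
      using insert.hyps by (auto intro!: sum.cong)
    also have "(\<Sum>j\<in>A. y * (ell $ j * c j)) = y * (GCD j\<in>A. ell $ j)"
      by (simp only: sum_distrib_left[symmetric] c)
    also have "ell $ a * x + y * (GCD j\<in>A. ell $ j) = gcd (ell $ a) (GCD j\<in>A. ell $ j)"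
      by (subst mult.commute) (rule xy)
    also have "\<dots> = (GCD j\<in>insert a A. ell $ j)" by simp
    finally show ?case by (intro exI)
  qed simp
  from this[of UNIV] obtain c where "(\<Sum>j\<in>UNIV. ell $ j * c j) = 1"
    using assms by (auto simp: primitive_vector_def)
  then show thesis using that[of "\<chi> j. c j"] by (simp add: pairing_def)
qed

lemma volume_moment_polytope_pos:
  assumes "finite L" "bounded (moment_polytope L)"
  shows "0 < measure lborel (moment_polytope L)"
proof -
  have "open (\<Inter>ell\<in>L. {x. rvec ell \<bullet> x < 1})"
    using assms(1) by (intro open_INT) (auto intro: open_halfspace_lt)
  moreover have "0 \<in> (\<Inter>ell\<in>L. {x. rvec ell \<bullet> x < 1})" by auto
  ultimately obtain e where e: "0 < e" "ball 0 e \<subseteq> (\<Inter>ell\<in>L. {x. rvec ell \<bullet> x < 1})"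
    unfolding open_contains_ball by blast
  have sub: "ball 0 e \<subseteq> moment_polytope L" using e(2) by (force simp: moment_polytope_def)
  have "0 < measure lborel (ball (0 :: real ^ 'a) e)"
    using content_ball_pos[OF e(1), of "0 :: real ^ 'a"] by (simp add: measure_completion)
  also have "\<dots> \<le> measure lborel (moment_polytope L)"
    using closed_moment_polytope[of L] emeasure_bounded_finite[OF assms(2)]
    by (intro measure_mono_fmeasurable[OF sub]) (auto simp: fmeasurable_def)
  finally show ?thesis .
qed

theorem proposition3p1:
  fixes L :: "(int ^ 'n) set"
    and \<theta> :: "real ^ 'n"
    and \<Lambda> :: "((int ^ 'n) \<times> rat) set"
    and R l :: nat
  assumes "toric_fano_manifold L"
    and "soliton_vector_field L \<theta>"
    and "finite \<Lambda>" and "\<Lambda> \<noteq> {}"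
    and "\<forall>x\<in>moment_polytope L. 0 < PL_convex \<Lambda> x"
    and "\<forall>x\<in>moment_polytope L. PL_convex \<Lambda> x < real R"
    and "1 \<le> l"
    and "integral_polytope
           (scaled_closure l (degeneration_polytope (moment_polytope L) (PL_convex \<Lambda>) R))"
  shows "has_modified_Futaki_invariant l
           (scaled_closure l (degeneration_polytope (moment_polytope L) (PL_convex \<Lambda>) R)) \<theta>
           (1 / (2 * measure lborel (moment_polytope L)) * L_functional L \<theta> (PL_convex \<Lambda>))"
proof -
  have fano: "finite L" "bounded (moment_polytope L)" "\<And>ell. ell \<in> L \<Longrightarrow> primitive_vector ell"
    using assms(1) by (auto simp: toric_fano_manifold_def)
  interpret P: lattice_polytope L
  proof unfold_locales
    show "\<exists>I0. pairing ell I0 = 1" if "ell \<in> L" for ell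
      using pairing_primitive[OF fano(3)[OF that]] by blast
  qed fact+
  interpret D: toric_degeneration L \<Lambda> R l
    using assms fano by unfold_locales auto
  let ?P = "moment_polytope L" and ?u = "PL_convex \<Lambda>"
  define V where "V = measure lborel ?P"
  have V: "0 < V" unfolding V_def using fano by (intro volume_moment_polytope_pos)
  define e where "e x = exp (\<theta> \<bullet> x)" for x
  \<comment> \<open>\<open>S\<^sub>1 = k A\<^sub>k(g)\<close> and \<open>2 S\<^sub>2 = A\<^sub>k(h)\<close>\<close>
  define g where "g x = e x * (real R - ?u x)" for x
  define h where "h x = e x * (\<theta> \<bullet> x) * (real R - ?u x)" for x
  have e: "ae_smooth e" unfolding e_def by (rule ae_smooth_exp)
  have u: "ae_smooth ?u" using assms by (intro ae_smooth_PL_convex)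
  have g: "ae_smooth g" and h: "ae_smooth h"
    unfolding g_def h_def by (intro ae_smooth_mult ae_smooth_diff ae_smooth_const ae_smooth_inner e u)+
  have dil: "D.dilated_points k = lattice_points L k (\<lambda>_. 0)" for k
  proof -
    have "rvec ell \<bullet> rvec I \<le> real k \<longleftrightarrow> pairing ell I \<le> int k + 0" for ell I :: "int ^ 'n"
      unfolding rvec_inner_pairing by linarith
    then show ?thesis by (simp only: D.dilated_points_def lattice_points_def)
  qed
  define F1 where "F1 = 1 / (2 * V) * L_functional L \<theta> ?u"
  define G where "G = (LINT x:?P|lborel. g x)"
  \<comment> \<open>the terms with the constant \<open>R\<close> cancel by the divergence identity\<close>
  have F1: "1 / (2 * V) * (real CARD('n) * G + (LINT x:?P|lborel. h x) - P.boundary_term g) = F1"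
  proof -
    let ?U = "\<lambda>x. ?u x * e x"
    have U: "ae_smooth ?U" by (intro ae_smooth_mult u e)
    have cont: "continuous_on UNIV e" "continuous_on UNIV ?U" "continuous_on UNIV g"
      using e U g by (simp_all add: ae_smooth_continuous)
    \<comment> \<open>linearity of the boundary term, being a limit of lattice sums\<close>
    have "(\<lambda>k. (P.lattice_sum k (\<lambda>_. 0) g - P.lattice_sum k (\<lambda>_. -1) g) / real k ^ (CARD('n) - 1))
       \<longlonglongrightarrow> real R * P.boundary_term e - P.boundary_term ?U"
    proof -
      have lin: "P.lattice_sum k b g = real R * P.lattice_sum k b e - P.lattice_sum k b ?U" for k b
        by (simp add: P.lattice_sum_def g_def sum_distrib_left sum_subtractf[symmetric] algebra_simps)
      have "(\<lambda>k. real R * ((P.lattice_sum k (\<lambda>_. 0) e - P.lattice_sum k (\<lambda>_. -1) e) / real k ^ (CARD('n) - 1))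
          - (P.lattice_sum k (\<lambda>_. 0) ?U - P.lattice_sum k (\<lambda>_. -1) ?U) / real k ^ (CARD('n) - 1))
        \<longlonglongrightarrow> real R * P.boundary_term e - P.boundary_term ?U"
        by (intro tendsto_diff tendsto_mult tendsto_const P.shrink_limit e U)
      moreover have "(r * a - b - (r * c - d)) / q = r * ((a - c) / q) - (b - d) / q" for a b c d q r :: real
        by (cases "q = 0") (simp_all add: field_simps)
      ultimately show ?thesis unfolding lin by simp
    qed
    then have bt_g: "P.boundary_term g = real R * P.boundary_term e - P.boundary_term ?U"
      using LIMSEQ_unique[OF P.shrink_limit[OF g]] by blast
    have bt_e: "P.boundary_term e = (LINT x:?P|lborel. (real CARD('n) + \<theta> \<bullet> x) * e x)"
      unfolding e_def by (rule P.divergence_identity)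
    have int: "set_integrable lborel ?P (\<lambda>x. (real CARD('n) + \<theta> \<bullet> x) * e x)"
      "set_integrable lborel ?P (\<lambda>x. (real CARD('n) + \<theta> \<bullet> x) * e x * ?u x)"
      "set_integrable lborel ?P g" "set_integrable lborel ?P h"
      using P.integrable_on_P[OF ae_smooth_continuous[OF g]] P.integrable_on_P[OF ae_smooth_continuous[OF h]]
      unfolding set_integrable_def real_scaleR_def
      by (auto intro!: P.integrable_on_P continuous_intros cont ae_smooth_continuous[OF u])
    have "real CARD('n) * G + (LINT x:?P|lborel. h x) = (LINT x:?P|lborel. real CARD('n) * g x + h x)"
      using int(3,4) by (simp add: G_def)
    also have "\<dots> = (LINT x:?P|lborel. real R * ((real CARD('n) + \<theta> \<bullet> x) * e x) - (real CARD('n) + \<theta> \<bullet> x) * e x * ?u x)"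
      by (simp add: g_def h_def algebra_simps)
    also have "\<dots> = real R * P.boundary_term e - (LINT x:?P|lborel. (real CARD('n) + \<theta> \<bullet> x) * e x * ?u x)"
      using int(1,2) by (simp add: bt_e)
    finally have "real CARD('n) * G + (LINT x:?P|lborel. h x) - P.boundary_term g
        = P.boundary_term ?U - (LINT x:?P|lborel. (real CARD('n) + \<theta> \<bullet> x) * e x * ?u x)"
      by (simp add: bt_g)
    also have "\<dots> = L_functional L \<theta> ?u"
      unfolding L_functional_def boundary_integral_def P.boundary_term_def facet_integral_def e_def ..
    finally show ?thesis by (simp add: F1_def)
  qed
  define q where "q k = - (P.lattice_sum k (\<lambda>_. 0) g - P.lattice_sum k (\<lambda>_. 0) h / (2 * real k)) / P.lattice_sum k (\<lambda>_. 0) (\<lambda>_. 1)" for k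
  have qlim: "(\<lambda>k. real k * (q k + G / V)) \<longlonglongrightarrow> F1"
    using P.quotient_expansion[OF g h] V unfolding q_def G_def[symmetric] V_def[symmetric] F1 by simp
  let ?H = "\<lambda>m. global_sections D.K (central_fibre D.K) m"
  define spectrum where "spectrum m N X v \<longleftrightarrow> N = fun_space.dim (?H m)
      \<and> simultaneous_eigenvalues (?H m) (X_time_one \<theta>) v_time_one N X v
      \<and> N = card (D.dilated_points (l * m))
      \<and> (\<forall>F :: real \<Rightarrow> real \<Rightarrow> real. (\<Sum>\<alpha><N. F (X \<alpha>) (v \<alpha>))
          = (\<Sum>I\<in>D.dilated_points (l * m). F (\<theta> \<bullet> rvec I) (D.height (l * m) I)))" for m N X v
  have "\<exists>N X v. spectrum m N X v" if m: "0 < m" for m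
  proof (rule D.eigenvalues_on_central_fibre[OF m, of \<theta>])
    fix N X v
    assume "N = fun_space.dim (?H m)" "simultaneous_eigenvalues (?H m) (X_time_one \<theta>) v_time_one N X v"
      "N = card (D.dilated_points (l * m))"
      "\<And>F :: real \<Rightarrow> real \<Rightarrow> real. (\<Sum>\<alpha><N. F (X \<alpha>) (v \<alpha>))
          = (\<Sum>I\<in>D.dilated_points (l * m). F (\<theta> \<bullet> rvec I) (D.height (l * m) I))"
    then have "spectrum m N X v" unfolding spectrum_def by (intro conjI allI)
    then show ?thesis by (intro exI)
  qed
  then obtain N X v where eigen: "\<And>m. 0 < m \<Longrightarrow> spectrum m (N m) (X m) (v m)" by metis
  note g' = eigen[unfolded spectrum_def]
  note NXv = conjunct1[OF g'] conjunct1[OF conjunct2[OF g']] conjunct1[OF conjunct2[OF conjunct2[OF g']]]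
    spec[OF conjunct2[OF conjunct2[OF conjunct2[OF g']]]]
  have quot: "- (S1 (l * m) (N m) (X m) (v m) - S2 (l * m) (N m) (X m) (v m)) / (real (l * m) * real (N m)) = q (l * m)"
    if m: "0 < m" for m
  proof -
    define k where "k = l * m"
    have k: "0 < k" using m assms(7) by (simp add: k_def)
    have hI: "D.height k I = real k * (real R - ?u (rvec I /\<^sub>R real k))" for I by (simp add: D.height_def)
    have xI: "\<theta> \<bullet> (rvec I /\<^sub>R real k) = (\<theta> \<bullet> rvec I) / real k" for I by (simp add: divide_inverse)
    have "S1 k (N m) (X m) (v m) = (\<Sum>I\<in>lattice_points L k (\<lambda>_. 0). exp (\<theta> \<bullet> rvec I / real k) * D.height k I)"
      unfolding S1_def using NXv(4)[OF m, of "\<lambda>x y. exp (x / real k) * y"] by (simp add: k_def dil)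
    also have "\<dots> = real k * P.lattice_sum k (\<lambda>_. 0) g"
      unfolding P.lattice_sum_def sum_distrib_left g_def e_def xI hI by (simp add: mult_ac)
    finally have S1: "S1 k (N m) (X m) (v m) = real k * P.lattice_sum k (\<lambda>_. 0) g" .
    have "S2 k (N m) (X m) (v m) = 1 / 2 * (\<Sum>I\<in>lattice_points L k (\<lambda>_. 0). exp (\<theta> \<bullet> rvec I / real k) * (\<theta> \<bullet> rvec I / real k) * (D.height k I / real k))"
      unfolding S2_def using NXv(4)[OF m, of "\<lambda>x y. exp (x / real k) * (x / real k) * (y / real k)"] by (simp add: k_def dil)
    also have "(\<Sum>I\<in>lattice_points L k (\<lambda>_. 0). exp (\<theta> \<bullet> rvec I / real k) * (\<theta> \<bullet> rvec I / real k) * (D.height k I / real k))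
        = P.lattice_sum k (\<lambda>_. 0) h"
      unfolding P.lattice_sum_def h_def e_def xI hI using k by (intro sum.cong refl) simp
    finally have S2: "S2 k (N m) (X m) (v m) = 1 / 2 * P.lattice_sum k (\<lambda>_. 0) h" .
    have N: "real (N m) = P.lattice_sum k (\<lambda>_. 0) (\<lambda>_. 1)"
      using NXv(3)[OF m] by (simp add: P.lattice_sum_def k_def dil)
    have "- (k' * a - 1 / 2 * b) / (k' * n) = - (a - b / (2 * k')) / n" if "0 < k'" for k' a b n :: real
    proof -
      have "- (k' * a - 1 / 2 * b) = k' * - (a - b / (2 * k'))" using that by (simp add: field_simps)
      then show ?thesis using that by simp
    qed
    from this[of "real k"] show ?thesis unfolding k_def[symmetric] S1 S2 N q_def using k by simp
  qed
  have "(\<lambda>m. q (l * m) - (- G / V + F1 / real (l * m))) \<in> o(\<lambda>m. 1 / real (l * m))"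
  proof (rule smalloI_tendsto)
    have mono: "filterlim (\<lambda>m. l * m) sequentially sequentially"
      using assms(7) by (intro filterlim_subseq) (auto simp: strict_mono_def)
    have "(\<lambda>m. real (l * m) * (q (l * m) + G / V) - F1) \<longlonglongrightarrow> F1 - F1"
      by (intro tendsto_diff tendsto_const filterlim_compose[OF qlim mono])
    moreover have "\<forall>\<^sub>F m in sequentially. real (l * m) * (q (l * m) + G / V) - F1
        = (q (l * m) - (- G / V + F1 / real (l * m))) / (1 / real (l * m))"
      using eventually_gt_at_top[of 0]
    proof eventually_elim
      case (elim m)
      have "k * (x + y) - F1 = (x - (- y + F1 / k)) / (1 / k)" if "0 < k" for k x y :: real
        using that by (simp add: field_simps)
      from this[of "real (l * m)" "q (l * m)" "G / V"] show ?case using elim assms(7) by simp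
    qed
    ultimately show "(\<lambda>m. (q (l * m) - (- G / V + F1 / real (l * m))) / (1 / real (l * m))) \<longlonglongrightarrow> 0"
      by (simp add: Lim_transform_eventually)
    show "\<forall>\<^sub>F m in sequentially. 1 / real (l * m) \<noteq> 0"
      using eventually_gt_at_top[of 0] by eventually_elim (use assms(7) in auto)
  qed
  also have "?this \<longleftrightarrow> (\<lambda>m. - (S1 (l * m) (N m) (X m) (v m) - S2 (l * m) (N m) (X m) (v m)) / (real (l * m) * real (N m))
      - (- G / V + F1 / real (l * m))) \<in> o(\<lambda>m. 1 / real (l * m))"
  proof (rule landau_o.small.in_cong)
    show "\<forall>\<^sub>F m in sequentially. q (l * m) - (- G / V + F1 / real (l * m)) =
      - (S1 (l * m) (N m) (X m) (v m) - S2 (l * m) (N m) (X m) (v m)) / (real (l * m) * real (N m)) - (- G / V + F1 / real (l * m))"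
      using eventually_gt_at_top[of 0] by eventually_elim (simp only: quot)
  qed
  finally have "has_modified_Futaki_invariant l D.K \<theta> F1"
    unfolding has_modified_Futaki_invariant_def using NXv(1,2) by blast
  then show ?thesis by (simp add: D.K_def F1_def V_def)
qed

end
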